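(* Let $\mathbb{F}$ be a finite field of odd order $q$, let $\theta$ be a non-trivial additive character of $\mathbb{F}$, and let $\epsilon=1$ if $q\equiv1\pmod 4$ and $\epsilon=-1$ if $q\equiv3\pmod4$. For $n\ge2$, even $s$ with $2\le s\le n$, and $1\le r\le n$, $$\Psi^{(3)}_n(s,r)=(-1)^{r+x+1}\epsilon^{y+1}q^{n+x^2+x-y-1}\,(q^{2N-(-1)^n};q^{-2})_x\begin{bmatrix} N \\ x \end{bmatrix}_{q^2}K^{\mathrm{Aff}}_y(x;q^{-2N+(-1)^n},N;q^2),$$ where $N=\lfloor\frac{n-2}2\rfloor$, $y=\frac{s-2}2$, $x=\lfloor\frac{r-1}2\rfloor$. Here $\Psi^{(3)}_n$ is the block defined in the context of the matrix of the Fourier transformation of $\operatorname{GL}_n(\mathbb{F})$-invariant functions on symmetric matrices.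
   Context: $\operatorname{Sym}_n$ is the space of $n\times n$ symmetric matrices over $\mathbb{F}$, with $\operatorname{GL}_n(\mathbb{F})$ acting by $a\mapsto ga\,{}^tg$. Fix a non-square $\delta\in\mathbb{F}$. Every non-zero $a\in\operatorname{Sym}_n$ is in the orbit of exactly one of the matrices $\operatorname{diag}(1,\dots,1,0,\dots,0)$ or $\operatorname{diag}(1,\dots,1,\delta,0,\dots,0)$; put $\operatorname{sgn}(a)=1$ in the first case, $-1$ in the second, and $\operatorname{sgn}(0)=1$. Identify $\operatorname{Sym}_n$ with its character group via $a\mapsto\theta_a$, $\theta_a(b)=\theta(\operatorname{trace}({}^tab))$. On $\operatorname{Sym}_n$, let $\chi_r$ ($0\le r\le n$) be the characteristic function of the matrices of rank $r$, and ${}^{\operatorname{sgn}}\chi_r(a)=\operatorname{sgn}(a)\chi_r(a)$ ($1\le r\le n$). These form a basis of the $\operatorname{GL}_n(\mathbb{F})$-invariant functions on $\operatorname{Sym}_n$. Use the same notation on the character group: $\chi_s(\theta_a)=\chi_s(a)$, ${}^{\operatorname{sgn}}\chi_s(\theta_a)={}^{\operatorname{sgn}}\chi_s(a)$. The Fourier transformation is $\mathcal{F}\varphi(\xi)=\sum_{a\in\operatorname{Sym}_n}\overline{\xi(a)}\varphi(a)$. The numbers $\Psi^{(i)}_n(s,r)$ are defined by $$\mathcal{F}(\chi_r)=\sum_{s=0}^n\Psi^{(1)}_n(s,r)\chi_s+\sum_{s=1}^n\Psi^{(3)}_n(s,r)\,{}^{\operatorname{sgn}}\chi_s\quad(0\le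 r\le n),$$ $$\mathcal{F}({}^{\operatorname{sgn}}\chi_r)=\sum_{s=0}^n\Psi^{(2)}_n(s,r)\chi_s+\sum_{s=1}^n\Psi^{(4)}_n(s,r)\,{}^{\operatorname{sgn}}\chi_s\quad(1\le r\le n).$$ Notation: $(a;q)_k=(1-a)(1-aq)\cdots(1-aq^{k-1})$, $(a;q)_0=1$; $\begin{bmatrix} N \\ x \end{bmatrix}_q=\dfrac{(q^N;q^{-1})_x}{(q;q)_x}$ (which is $0$ for $x=N+1$). Affine $q$-Krawtchouk polynomial: for integers $0\le y\le N$, $$K^{\mathrm{Aff}}_y(x;a,N;q)=\sum_{k=0}^{y}\frac{(q^{-y};q)_k\,(q^{-x};q)_k}{(q^{-N};q)_k\,(a;q)_k\,(q;q)_k}\,q^k$$ (a polynomial in $q^{-x}$); in the claim these are used with $q$ replaced by $q^2$. *)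

theory Defs
  imports "HOL-Library.FuncSet" "HOL-Library.Cardinality" "Jordan_Normal_Form.DL_Rank"
begin

definition Sym :: "nat \<Rightarrow> 'a::field mat set" where
  "Sym n = {a \<in> carrier_mat n n. transpose_mat a = a}"

definition GL :: "nat \<Rightarrow> 'a::field mat set" where
  "GL n = {g \<in> carrier_mat n n. invertible_mat g}"

definition congruence_orbit :: "nat \<Rightarrow> 'a::field mat \<Rightarrow> 'a mat set" where
  "congruence_orbit n a = (\<lambda>g. g * a * transpose_mat g) ` GL n"

text \<open>The matrix \<open>diag(1,\<dots>,1,d,0,\<dots>,0)\<close> whose last non-zero entry \<open>d\<close> is in position \<open>r \<ge> 1\<close>.\<close>

definition normal_form :: "nat \<Rightarrow> nat \<Rightarrow> 'a::field \<Rightarrow> 'a mat" where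
  "normal_form n r d = mat_diag n (\<lambda>i. if i + 1 < r then 1 else if i + 1 = r then d else 0)"

text \<open>For a finite field of odd order and a non-square \<open>\<delta>\<close>, every symmetric matrix falls under
  one of the first three cases; the value \<open>0\<close> is only taken outside \<open>Sym n\<close>.\<close>

definition sgn_sym :: "'a::field \<Rightarrow> nat \<Rightarrow> 'a mat \<Rightarrow> complex" where
  "sgn_sym \<delta> n a =
    (if a = 0\<^sub>m n n then 1
     else if \<exists>r\<in>{1..n}. a \<in> congruence_orbit n (normal_form n r 1) then 1
     else if \<exists>r\<in>{1..n}. a \<in> congruence_orbit n (normal_form n r \<delta>) then - 1
     else 0)"

definition chi :: "nat \<Rightarrow> nat \<Rightarrow> 'a::field mat \<Rightarrow> complex" where
  "chi n r a = (if vec_space.rank n a = r then 1 else 0)"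

definition sgn_chi :: "'a::field \<Rightarrow> nat \<Rightarrow> nat \<Rightarrow> 'a mat \<Rightarrow> complex" where
  "sgn_chi \<delta> n r a = sgn_sym \<delta> n a * chi n r a"

definition additive_character_on :: "'b::plus set \<Rightarrow> ('b \<Rightarrow> complex) \<Rightarrow> bool" where
  "additive_character_on A \<xi> \<longleftrightarrow>
    (\<forall>a\<in>A. \<xi> a \<noteq> 0) \<and> (\<forall>a\<in>A. \<forall>b\<in>A. \<xi> (a + b) = \<xi> a * \<xi> b)"

text \<open>Characters of \<open>Sym n\<close> are taken to be \<open>undefined\<close> outside \<open>Sym n\<close>, so that equality of
  characters is equality of functions.\<close>

definition Sym_chars :: "nat \<Rightarrow> ('a::field mat \<Rightarrow> complex) set" where
  "Sym_chars n = {\<xi> \<in> extensional (Sym n). additive_character_on (Sym n) \<xi>}"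

definition mat_trace :: "'a::comm_monoid_add mat \<Rightarrow> 'a" where
  "mat_trace a = (\<Sum>i<dim_row a. a $$ (i, i))"

definition Sym_char :: "('a::field \<Rightarrow> complex) \<Rightarrow> nat \<Rightarrow> 'a mat \<Rightarrow> 'a mat \<Rightarrow> complex" where
  "Sym_char \<theta> n a = (\<lambda>b\<in>Sym n. \<theta> (mat_trace (transpose_mat a * b)))"

text \<open>Transport of a function on \<open>Sym n\<close> to the character group along the identification
  \<open>a \<mapsto> \<theta>\<^sub>a\<close>, which is a bijection from \<open>Sym n\<close> onto \<open>Sym_chars n\<close> when \<open>\<theta>\<close> is
  non-trivial and the field is finite of odd order.\<close>

definition on_chars :: "('a::field \<Rightarrow> complex) \<Rightarrow> nat \<Rightarrow> ('a mat \<Rightarrow> complex) \<Rightarrow>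
    ('a mat \<Rightarrow> complex) \<Rightarrow> complex" where
  "on_chars \<theta> n \<phi> \<xi> = \<phi> (the_inv_into (Sym n) (Sym_char \<theta> n) \<xi>)"

definition fourier :: "nat \<Rightarrow> ('a::field mat \<Rightarrow> complex) \<Rightarrow> ('a mat \<Rightarrow> complex) \<Rightarrow> complex" where
  "fourier n \<phi> \<xi> = (\<Sum>a\<in>Sym n. cnj (\<xi> a) * \<phi> a)"

text \<open>The coefficients \<open>(c, d)\<close> of a function on the character group with respect to the basis
  \<open>chi n s\<close> (\<open>0 \<le> s \<le> n\<close>), \<open>sgn_chi \<delta> n s\<close> (\<open>1 \<le> s \<le> n\<close>). Both families are extended by
  zero to all indices, which makes them unique as functions on the natural numbers.\<close>

definition is_expansion :: "('a::field \<Rightarrow> complex) \<Rightarrow> 'a \<Rightarrow> nat \<Rightarrow>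
    (('a mat \<Rightarrow> complex) \<Rightarrow> complex) \<Rightarrow> (nat \<Rightarrow> complex) \<Rightarrow> (nat \<Rightarrow> complex) \<Rightarrow> bool" where
  "is_expansion \<theta> \<delta> n \<Phi> c d \<longleftrightarrow>
    (\<forall>s. s \<notin> {0..n} \<longrightarrow> c s = 0) \<and> (\<forall>s. s \<notin> {1..n} \<longrightarrow> d s = 0) \<and>
    (\<forall>\<xi>\<in>Sym_chars n. \<Phi> \<xi> =
      (\<Sum>s=0..n. c s * on_chars \<theta> n (chi n s) \<xi>) +
      (\<Sum>s=1..n. d s * on_chars \<theta> n (sgn_chi \<delta> n s) \<xi>))"

definition expansion :: "('a::field \<Rightarrow> complex) \<Rightarrow> 'a \<Rightarrow> nat \<Rightarrow>
    (('a mat \<Rightarrow> complex) \<Rightarrow> complex) \<Rightarrow> (nat \<Rightarrow> complex) \<times> (nat \<Rightarrow> complex)" where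
  "expansion \<theta> \<delta> n \<Phi> = (THE (c, d). is_expansion \<theta> \<delta> n \<Phi> c d)"

definition Psi1 :: "('a::field \<Rightarrow> complex) \<Rightarrow> 'a \<Rightarrow> nat \<Rightarrow> nat \<Rightarrow> nat \<Rightarrow> complex" where
  "Psi1 \<theta> \<delta> n s r = fst (expansion \<theta> \<delta> n (fourier n (chi n r))) s"

definition Psi2 :: "('a::field \<Rightarrow> complex) \<Rightarrow> 'a \<Rightarrow> nat \<Rightarrow> nat \<Rightarrow> nat \<Rightarrow> complex" where
  "Psi2 \<theta> \<delta> n s r = fst (expansion \<theta> \<delta> n (fourier n (sgn_chi \<delta> n r))) s"

definition Psi3 :: "('a::field \<Rightarrow> complex) \<Rightarrow> 'a \<Rightarrow> nat \<Rightarrow> nat \<Rightarrow> nat \<Rightarrow> complex" where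
  "Psi3 \<theta> \<delta> n s r = snd (expansion \<theta> \<delta> n (fourier n (chi n r))) s"

definition Psi4 :: "('a::field \<Rightarrow> complex) \<Rightarrow> 'a \<Rightarrow> nat \<Rightarrow> nat \<Rightarrow> nat \<Rightarrow> complex" where
  "Psi4 \<theta> \<delta> n s r = snd (expansion \<theta> \<delta> n (fourier n (sgn_chi \<delta> n r))) s"

definition qpoch :: "'b::field \<Rightarrow> 'b \<Rightarrow> nat \<Rightarrow> 'b" where
  "qpoch a q k = (\<Prod>i<k. 1 - a * q ^ i)"

definition qbinom :: "'b::field \<Rightarrow> nat \<Rightarrow> nat \<Rightarrow> 'b" where
  "qbinom q N x = qpoch (q ^ N) (inverse q) x / qpoch q q x"

definition affine_qKrawtchouk :: "nat \<Rightarrow> nat \<Rightarrow> 'b::field \<Rightarrow> nat \<Rightarrow> 'b \<Rightarrow> 'b" where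
  "affine_qKrawtchouk y x a N q =
    (\<Sum>k=0..y. qpoch (q powi (- int y)) q k * qpoch (q powi (- int x)) q k /
      (qpoch (q powi (- int N)) q k * qpoch a q k * qpoch q q k) * q ^ k)"

end

theory Submission
  imports Defs "HOL-Number_Theory.Residues"
begin

text \<open>
  Let \<open>S(a, r)\<close> be the sum of \<open>\<theta>(trace(ab))\<close> over the symmetric \<open>b\<close> of rank \<open>r\<close>, so that
  \<open>2 \<Psi>(s,r) = S(a,r) - S(a',r)\<close> for the two normal forms \<open>a\<close>, \<open>a'\<close> of rank \<open>s\<close>.
  Deleting one row and column of \<open>b\<close> relates \<open>S\<close> in size \<open>n\<close> to \<open>S\<close> in sizes \<open>n - 1\<close> and \<open>n - 2\<close>; the sum
  over the deleted column is a Gauss sum. For even \<open>s\<close>, deleting the last non-zero diagonal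
  entry leaves the same form of odd rank \<open>s - 1\<close> on both sides, and only the Gauss sums differ:
  \<open>\<Psi>(s,r)\<close> is \<open>\<epsilon>\<^bsup>s/2\<^esup> q\<^bsup>n-s/2\<^esup>\<close> times \<open>S\<close> at rank \<open>s - 1\<close>, size \<open>n - 1\<close> and \<open>r - 1\<close>.
  At forms of odd rank the same recursion closes up and involves no signs. With \<open>V\<^sub>n(s,r)\<close> for
  their value, it reads \<open>V\<^sub>n(s,r) = V\<^bsub>n-1\<^esub>(s,r) + q\<^bsup>n-1\<^esup>(q\<^bsup>n-1-s\<^esup> - 1) V\<^bsub>n-2\<^esub>(s,r-2)\<close> for \<open>s < n\<close> and
  \<open>V\<^sub>n(n,r) = V\<^bsub>n-2\<^esub>(n-2,r) - q\<^bsup>n-1\<^esup> V\<^bsub>n-2\<^esub>(n-2,r-2)\<close>. The affine \<open>q\<close>-Krawtchouk expression satisfies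
  both because of the contiguity relation \<open>V\<^sub>n(s,r) = V\<^sub>n(s-2,r) - q\<^bsup>2n-s\<^esup> V\<^bsub>n-2\<^esub>(s-2,r-2)\<close>.
\<close>

subsection \<open>The recursion for affine q-Krawtchouk polynomials\<close>

text \<open>Odd rank is singled out by the corner entry \<open>c\<close> of the bordered matrix.
  After summation over the column, \<open>c\<close> carries \<open>qchar c\<close> to the power of
  the number of non-zero diagonal entries left. If that number is odd and the deleted entry is zero,
  the sum over \<open>c\<close> vanishes, so neither a Gauss sum nor a term at r - 1 enters. From a
  nondegenerate form of odd rank two entries are deleted: the two steps have coefficients -h and h,
  the linear contributions cancel, and what survives is h^2, a power of q. So the value depends on
  size and rank only, not on the form or on \<theta>. In the even case the Gauss sum remains in an
  even power, and its square is \<open>qchar (- 1) * q\<close>; this is where \<epsilon> comes from.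

  The closed form has base q^2 while the size drops by one. At rank one its two products in q^2
  interleave to a single product in q, which makes the recursion in the size visible; contiguity
  then carries it to the higher odd ranks.\<close>

lemma qpoch_0 [simp]: "qpoch a q 0 = 1"
  by (simp add: qpoch_def)

lemma qpoch_Suc: "qpoch a q (Suc k) = qpoch a q k * (1 - a * q ^ k)"
  by (simp add: qpoch_def)

lemma qpoch_Suc_shift: "qpoch a q (Suc k) = (1 - a) * qpoch (a * q) q k"
  unfolding qpoch_def by (subst prod.lessThan_Suc_shift) (simp add: mult.assoc)

lemma qpoch_eq_0: "i < k \<Longrightarrow> a * q ^ i = 1 \<Longrightarrow> qpoch a q k = 0"
  by (auto simp: qpoch_def)

text \<open>The two products share all but one factor: the first has an extra leading factor, the
  second an extra trailing one.\<close>

lemma qpoch_inverse_power_diff: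
  fixes Q :: "'b::field"
  assumes "Q \<noteq> 0"
  shows "qpoch (inverse Q ^ Suc y) Q (Suc j) - qpoch (inverse Q ^ y) Q (Suc j) =
    - qpoch (inverse Q ^ y) Q j * inverse Q ^ Suc y * (1 - Q ^ Suc j)"
proof -
  have 1: "qpoch (inverse Q ^ Suc y) Q (Suc j) = (1 - inverse Q ^ Suc y) * qpoch (inverse Q ^ y) Q j"
    using assms by (simp add: qpoch_Suc_shift field_simps)
  have 2: "inverse Q ^ y * Q ^ j = inverse Q ^ Suc y * Q ^ Suc j" using assms by simp
  have gen: "(1 - t) * A - A * (1 - t * v) = - A * t * (1 - v)" for t A v :: 'b
    by (simp add: algebra_simps)
  show ?thesis
    unfolding 1 qpoch_Suc[of "inverse Q ^ y"] 2 by (rule gen)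
qed

lemma powi_minus_int: "(q::'b::field) powi (- int k) = inverse q ^ k"
  by (simp add: power_int_minus power_inverse)

text \<open>By \<open>qpoch_inverse_power_diff\<close> each difference of terms picks up
  \<open>1 - Q ^ k\<close>, which cancels the last factor of \<open>qpoch Q Q k\<close>. The other
  products lose their first factor, and this lowers \<open>x\<close> and \<open>N\<close> by one and
  turns \<open>a\<close> into \<open>a * Q\<close>.\<close>

lemma affine_qKrawtchouk_Suc:
  fixes Q a :: "'b::field"
  assumes "Q \<noteq> 0" "\<And>k. k > 0 \<Longrightarrow> Q ^ k \<noteq> 1"
  shows "affine_qKrawtchouk (Suc y) (Suc x) a (Suc N) Q - affine_qKrawtchouk y (Suc x) a (Suc N) Q =
    - (inverse Q ^ y * (1 - inverse Q ^ Suc x) / ((1 - inverse Q ^ Suc N) * (1 - a))) *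
    affine_qKrawtchouk y x (a * Q) N Q"
proof -
  define T where "T z x' a' N' k = qpoch (inverse Q ^ z) Q k * qpoch (inverse Q ^ x') Q k /
      (qpoch (inverse Q ^ N') Q k * qpoch a' Q k * qpoch Q Q k) * Q ^ k" for z x' a' N' k
  have K: "affine_qKrawtchouk z x' a' N' Q = (\<Sum>k=0..z. T z x' a' N' k)" for z x' a' N'
    unfolding affine_qKrawtchouk_def T_def powi_minus_int ..
  have sh: "qpoch (inverse Q ^ Suc m) Q (Suc j) = (1 - inverse Q ^ Suc m) * qpoch (inverse Q ^ m) Q j" for m j
    using assms by (simp add: qpoch_Suc_shift field_simps)
  have sh': "qpoch Q Q (Suc j) = qpoch Q Q j * (1 - Q ^ Suc j)" for j
    by (simp add: qpoch_Suc)
  \<comment> \<open>The shorter sum may be extended to \<open>k = Suc y\<close>, because its upper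
    parameter vanishes there.\<close>
  have last: "T y (Suc x) a (Suc N) (Suc y) = 0"
    unfolding T_def using assms by (subst qpoch_eq_0[of y]) (auto simp: field_simps)
  have step: "T (Suc y) (Suc x) a (Suc N) (Suc j) - T y (Suc x) a (Suc N) (Suc j) =
    - (inverse Q ^ y * (1 - inverse Q ^ Suc x) / ((1 - inverse Q ^ Suc N) * (1 - a))) * T y x (a * Q) N j" for j
  proof -
    have nz: "1 - Q ^ Suc j \<noteq> 0" using assms(2)[of "Suc j"] by simp
    have "T (Suc y) (Suc x) a (Suc N) (Suc j) - T y (Suc x) a (Suc N) (Suc j) =
      (qpoch (inverse Q ^ Suc y) Q (Suc j) - qpoch (inverse Q ^ y) Q (Suc j)) * qpoch (inverse Q ^ Suc x) Q (Suc j) /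
      (qpoch (inverse Q ^ Suc N) Q (Suc j) * qpoch a Q (Suc j) * qpoch Q Q (Suc j)) * Q ^ Suc j"
      unfolding T_def by (simp only: diff_divide_distrib left_diff_distrib)
    also have "\<dots> = - (inverse Q ^ y * (1 - inverse Q ^ Suc x) / ((1 - inverse Q ^ Suc N) * (1 - a))) * T y x (a * Q) N j"
    proof -
      have ts: "inverse Q ^ Suc y * Q ^ Suc j = inverse Q ^ y * Q ^ j" using assms by (simp add: field_simps)
      \<comment> \<open>Here \<open>falling_prod\<close> is a variable, standing for
        \<open>qpoch (inverse Q ^ y) Q j\<close>. Only \<open>v\<close> is cancelled; if another
        denominator is zero, both sides are 0 by the convention for division.\<close>
      have gen: "(- falling_prod * t * v) * (e * X) / ((f * M) * (h * A) * (D * v)) * s = - (u * e / (f * h)) * (falling_prod * X / (M * A * D) * w)"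
        if "v \<noteq> 0" "t * s = u * w" for falling_prod t v e X f M h A D s u w :: 'b
      proof -
        have "(- falling_prod * t * v) * (e * X) / ((f * M) * (h * A) * (D * v)) * s = - (falling_prod * e * X / (f * M * h * A * D)) * (t * s)"
          using that(1) by (simp add: divide_inverse)
        also have "\<dots> = - (u * e / (f * h)) * (falling_prod * X / (M * A * D) * w)"
          unfolding that(2) by (simp add: divide_inverse)
        finally show ?thesis .
      qed
      show ?thesis
        unfolding qpoch_inverse_power_diff[OF assms(1)] sh[of x] sh[of N] sh'[of j] qpoch_Suc_shift[of a] T_def
        by (rule gen[OF nz ts])
    qed
    finally show ?thesis .
  qed
  have "affine_qKrawtchouk (Suc y) (Suc x) a (Suc N) Q - affine_qKrawtchouk y (Suc x) a (Suc N) Q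
    = (\<Sum>k=0..Suc y. T (Suc y) (Suc x) a (Suc N) k - T y (Suc x) a (Suc N) k)"
    unfolding K sum_subtractf using last by simp
  also have "\<dots> = (\<Sum>j=0..y. T (Suc y) (Suc x) a (Suc N) (Suc j) - T y (Suc x) a (Suc N) (Suc j))"
    by (subst sum.atLeast0_atMost_Suc_shift) (simp add: T_def)
  finally show ?thesis unfolding step K by (simp add: sum_distrib_left)
qed

lemma affine_qKrawtchouk_0_right [simp]: "affine_qKrawtchouk y 0 a N Q = 1"
proof -
  have "affine_qKrawtchouk y 0 a N Q = (\<Sum>k\<in>{0}. qpoch (Q powi (- int y)) Q k * qpoch (Q powi (- int 0)) Q k /
      (qpoch (Q powi (- int N)) Q k * qpoch a Q k * qpoch Q Q k) * Q ^ k)"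
    unfolding affine_qKrawtchouk_def
    by (rule sum.mono_neutral_right) (auto simp: gr0_conv_Suc intro!: qpoch_eq_0[of 0])
  then show ?thesis by simp
qed

lemma affine_qKrawtchouk_0_left [simp]: "affine_qKrawtchouk 0 x a N Q = 1"
  by (simp add: affine_qKrawtchouk_def)

lemma qbinom_Suc_Suc:
  assumes "(Q::'b::field) \<noteq> 0"
  shows "qbinom Q (Suc N) (Suc x) = (1 - Q ^ Suc N) / (1 - Q ^ Suc x) * qbinom Q N x"
proof -
  have "Q ^ Suc N * inverse Q = Q ^ N" using assms by simp
  then have "qpoch (Q ^ Suc N) (inverse Q) (Suc x) = (1 - Q ^ Suc N) * qpoch (Q ^ N) (inverse Q) x"
    by (simp only: qpoch_Suc_shift)
  moreover have "qpoch Q Q (Suc x) = (1 - Q ^ Suc x) * qpoch Q Q x" by (simp add: qpoch_Suc)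
  ultimately show ?thesis unfolding qbinom_def by (simp only: times_divide_times_eq)
qed

text \<open>The weight absorbs the rational coefficient of \<open>affine_qKrawtchouk_Suc\<close>:
  with \<open>a = inverse b\<close> all factors of the shape 1 - z cancel and a monomial is left,
  while passing from \<open>a\<close> to \<open>a * Q\<close> becomes passing from \<open>b\<close>
  to \<open>b / Q\<close>.\<close>

lemma weighted_qKrawtchouk_Suc:
  fixes Q b :: "'b::field"
  assumes Q: "Q \<noteq> 0" "\<And>k. k > 0 \<Longrightarrow> Q ^ k \<noteq> 1" and b: "b \<noteq> 0" "b \<noteq> 1"
  shows "qpoch b (inverse Q) (Suc x) * qbinom Q (Suc N) (Suc x) * affine_qKrawtchouk (Suc y) (Suc x) (inverse b) (Suc N) Q
    = qpoch b (inverse Q) (Suc x) * qbinom Q (Suc N) (Suc x) * affine_qKrawtchouk y (Suc x) (inverse b) (Suc N) Q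
      + b * Q ^ N / (Q ^ x * Q ^ y) * (qpoch (b / Q) (inverse Q) x * qbinom Q N x * affine_qKrawtchouk y x (inverse (b / Q)) N Q)"
proof -
  have nz: "1 - Q ^ Suc N \<noteq> 0" "1 - Q ^ Suc x \<noteq> 0" using Q(2)[of "Suc _"] by auto
  have i: "1 - inverse Q ^ Suc m = - (inverse Q ^ Suc m * (1 - Q ^ Suc m))" for m
    using Q(1) by (simp add: field_simps)
  have j: "1 - inverse b = - (inverse b * (1 - b))" using b by (simp add: field_simps)
  have pb: "qpoch b (inverse Q) (Suc x) = (1 - b) * qpoch (b / Q) (inverse Q) x"
    by (simp only: qpoch_Suc_shift divide_inverse)
  define K' where "K' = affine_qKrawtchouk y x (inverse (b / Q)) N Q"
  have K: "affine_qKrawtchouk (Suc y) (Suc x) (inverse b) (Suc N) Q = affine_qKrawtchouk y (Suc x) (inverse b) (Suc N) Q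
     - (inverse Q ^ y * (1 - inverse Q ^ Suc x) / ((1 - inverse Q ^ Suc N) * (1 - inverse b))) * K'"
    using affine_qKrawtchouk_Suc[OF Q, of y x "inverse b" N] unfolding K'_def
    by (simp add: algebra_simps divide_inverse)
  have "- ((1 - b) * ((1 - Q ^ Suc N) / (1 - Q ^ Suc x)) * (inverse Q ^ y * (1 - inverse Q ^ Suc x) / ((1 - inverse Q ^ Suc N) * (1 - inverse b))))
     = b * Q ^ N / (Q ^ x * Q ^ y)"
    unfolding i j using nz Q(1) b by (simp add: power_inverse divide_simps del: power_Suc)
  then have "- ((1 - b) * ((1 - Q ^ Suc N) / (1 - Q ^ Suc x)) * (inverse Q ^ y * (1 - inverse Q ^ Suc x) / ((1 - inverse Q ^ Suc N) * (1 - inverse b)))) * (qpoch (b / Q) (inverse Q) x * qbinom Q N x * K')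
     = b * Q ^ N / (Q ^ x * Q ^ y) * (qpoch (b / Q) (inverse Q) x * qbinom Q N x * K')"
    by (simp only:)
  then show ?thesis
    unfolding K pb qbinom_Suc_Suc[OF Q(1)] K'_def[symmetric]
    by (simp only: right_diff_distrib) (simp add: mult_ac)
qed


section \<open>The closed form at forms of odd rank and its recursions\<close>

definition qexp :: "nat \<Rightarrow> int" where
  "qexp n = 2 * int ((n - 1) div 2) + (- 1) ^ n"

lemma qexp_Suc_Suc: "m \<ge> 1 \<Longrightarrow> qexp (Suc (Suc m)) = qexp m + 2"
  by (cases m) (auto simp: qexp_def)

text \<open>The exponents \<open>qexp n\<close> and \<open>2 * ((n - 1) div 2)\<close> are
  \<open>n - 1\<close> and \<open>n - 2\<close>, with \<open>qexp n\<close> the odd one; the parity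
  of \<open>n\<close> only decides the order. Whatever is symmetric in the two is uniform in
  \<open>n\<close>.\<close>

lemma qexp_cases:
  assumes "n \<ge> 1"
  obtains "even n" "qexp n = int n - 1" "2 * int ((n - 1) div 2) = int n - 2"
    | "odd n" "qexp n = int n - 2" "2 * int ((n - 1) div 2) = int n - 1"
proof (cases "even n")
  case True
  then obtain k where "n = 2 * k" by (auto elim: evenE)
  with assms obtain l where "n = 2 * Suc l" by (cases k) auto
  with True that(1) show ?thesis by (auto simp: qexp_def)
next
  case False
  then obtain k where "n = 2 * k + 1" by (auto elim: oddE)
  with False that(2) show ?thesis by (auto simp: qexp_def)
qed

lemma qexp_add_even: "n \<ge> 1 \<Longrightarrow> qexp n + 2 * int ((n - 1) div 2) = 2 * int n - 3"
  by (erule qexp_cases) auto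

text \<open>The value of the character sum over matrices of size \<open>n\<close> and rank \<open>r\<close> at a form of rank
  \<open>2 y + 1\<close>. The theorem uses it for \<open>n - 1\<close> and \<open>r - 1\<close> in place of \<open>n\<close> and \<open>r\<close>.\<close>

definition odd_rank_sum :: "'b::field \<Rightarrow> nat \<Rightarrow> nat \<Rightarrow> int \<Rightarrow> 'b" where
  "odd_rank_sum q n y r = (if r < 0 then 0 else
     let x = nat r div 2; N = (n - 1) div 2 in
     (- 1) ^ (nat r + x) * q ^ (x\<^sup>2 + x) * qpoch (q powi qexp n) (inverse (q\<^sup>2)) x * qbinom (q\<^sup>2) N x *
     affine_qKrawtchouk y x (inverse (q powi qexp n)) N (q\<^sup>2))"

lemma odd_rank_sum_neg [simp]: "r < 0 \<Longrightarrow> odd_rank_sum q n y r = 0"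
  by (simp add: odd_rank_sum_def)

lemma odd_rank_sum_less_2:
  assumes "0 \<le> r" "r < 2"
  shows "odd_rank_sum q n y r = (- 1) ^ nat r"
proof -
  have "nat r div 2 = 0" using assms by auto
  then show ?thesis using assms by (simp add: odd_rank_sum_def Let_def qbinom_def)
qed

lemma sq_add_Suc: "(Suc x)\<^sup>2 + Suc x = (x\<^sup>2 + x) + (2 * x + 2)"
  by (simp add: power2_eq_square)

lemma minus_one_Suc3: "(- 1 :: 'b::ring_1) ^ (Suc (Suc R) + Suc x) = - ((- 1) ^ (R + x))"
  by simp

context
  fixes q :: "'b::field"
  assumes q_nz: "q \<noteq> 0" and q_pow: "\<And>k. k > 0 \<Longrightarrow> q ^ k \<noteq> 1"
begin

lemma q_powi_neq_1: "k > 0 \<Longrightarrow> q powi k \<noteq> 1"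
  using q_pow[of "nat k"] by (simp add: power_int_def)

lemma Q_powi: "(q\<^sup>2) ^ k = q powi (2 * int k)"
  by (simp add: power_int_mult)

lemma Q_pow: "k > 0 \<Longrightarrow> (q\<^sup>2) ^ k \<noteq> 1"
  using q_pow[of "2 * k"] by (simp add: power_mult)

text \<open>\<open>weighted_qKrawtchouk_Suc\<close> at base \<open>q^2\<close>: lowering
  \<open>r\<close> by 2 lowers \<open>x\<close> by one, and lowering the size by 2 lowers
  \<open>N\<close> by one and \<open>qexp\<close> by two. The prefactor \<open>q ^ (x^2 + x)\<close>
  compensates the division by \<open>Q ^ x\<close>, so the coefficient does not depend on
  \<open>r\<close>.\<close>

lemma odd_rank_sum_Suc:
  assumes "2 * y + 1 \<le> m"
  shows "odd_rank_sum q (m + 2) (Suc y) r = odd_rank_sum q (m + 2) y r - q ^ (2 * m + 1 - 2 * y) * odd_rank_sum q m y (r - 2)"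
proof (cases "r < 2")
  case True
  then show ?thesis
    by (cases "r < 0") (simp_all add: odd_rank_sum_less_2)
next
  case False
  define R where "R = nat r - 2"
  define x where "x = R div 2"
  define N where "N = (m - 1) div 2"
  have m: "m \<ge> 1" using assms by simp
  have R: "nat r = Suc (Suc R)" "nat (r - 2) = R" using False by (auto simp: R_def)
  have x: "Suc (Suc R) div 2 = Suc x" by (simp add: x_def)
  have N: "(m + 2 - 1) div 2 = Suc N" using m by (auto simp: N_def)
  define b where "b = q powi qexp (m + 2)"
  have e: "qexp (m + 2) = qexp m + 2" using qexp_Suc_Suc[OF m] by simp
  have "qexp m \<ge> - 1" by (rule qexp_cases[OF m]) (use m in auto)
  then have b: "b \<noteq> 0" "b \<noteq> 1" using q_powi_neq_1[of "qexp m + 2"] q_nz unfolding b_def e by auto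
  have b': "q powi qexp m = b / q\<^sup>2"
    unfolding b_def e using q_nz by (simp add: power_int_add)
  define c where "c = (- 1 :: 'b) ^ (R + x) * q ^ (x\<^sup>2 + x)"
  define W where "W = qpoch (b / q\<^sup>2) (inverse (q\<^sup>2)) x * qbinom (q\<^sup>2) N x * affine_qKrawtchouk y x (inverse (b / q\<^sup>2)) N (q\<^sup>2)"
  have V1: "odd_rank_sum q (m + 2) z r = - (c * q ^ (2 * x + 2)) * (qpoch b (inverse (q\<^sup>2)) (Suc x) * qbinom (q\<^sup>2) (Suc N) (Suc x) * affine_qKrawtchouk z (Suc x) (inverse b) (Suc N) (q\<^sup>2))" for z
    using False unfolding odd_rank_sum_def Let_def R x N b_def[symmetric] c_def sq_add_Suc power_add[of q "x\<^sup>2 + x"] minus_one_Suc3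
    by (simp add: mult_ac)
  have V2: "odd_rank_sum q m y (r - 2) = c * W"
    unfolding odd_rank_sum_def Let_def R N_def[symmetric] x_def[symmetric] b' c_def W_def using False by (simp add: mult_ac)
  \<comment> \<open>The parity of \<open>m\<close> drops out because only the sum of the two
    exponents enters, which \<open>qexp_add_even\<close> gives as \<open>2 * m - 3\<close>.\<close>
  have exp: "q ^ (2 * x + 2) * (b * (q\<^sup>2) ^ N / ((q\<^sup>2) ^ x * (q\<^sup>2) ^ y)) = q ^ (2 * m + 1 - 2 * y)"
  proof -
    have "q ^ (2 * x + 2) * (b * (q\<^sup>2) ^ N / ((q\<^sup>2) ^ x * (q\<^sup>2) ^ y)) =
      q powi (int (2 * x + 2) + qexp (m + 2) + int (2 * N) - int (2 * x) - int (2 * y))"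
      unfolding b_def Q_powi power_int_of_nat[of q "2 * x + 2", symmetric]
      by (simp add: power_int_add power_int_diff q_nz field_simps)
    also have "int (2 * x + 2) + qexp (m + 2) + int (2 * N) - int (2 * x) - int (2 * y) = int (2 * m + 1 - 2 * y)"
      using qexp_add_even[OF m] assms unfolding e N_def by (simp add: of_nat_diff)
    finally show ?thesis by (simp only: power_int_of_nat)
  qed
  have "odd_rank_sum q (m + 2) (Suc y) r = odd_rank_sum q (m + 2) y r - (q ^ (2 * x + 2) * (b * (q\<^sup>2) ^ N / ((q\<^sup>2) ^ x * (q\<^sup>2) ^ y))) * (c * W)"
  proof -
    have gen: "- (c * u) * (A + v * w) = - (c * u) * A - u * v * (c * w)" for c u A v w :: 'b
      by (simp add: algebra_simps)
    have q2: "q\<^sup>2 \<noteq> 0" using q_nz by simp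
    show ?thesis unfolding V1 W_def
      by (subst weighted_qKrawtchouk_Suc[OF q2 Q_pow b]) (simp_all only: gen)
  qed
  then show ?thesis unfolding exp V2 .
qed

text \<open>The exponents are integers because they run below 0 for large \<open>j\<close>; if
  \<open>0 \<le> m < j\<close>, the factor with exponent 0 makes the product vanish.\<close>

definition falling_prod :: "int \<Rightarrow> nat \<Rightarrow> 'b" where
  "falling_prod m j = (\<Prod>i<j. 1 - q powi (m - int i))"

lemma falling_prod_Suc: "falling_prod m (Suc j) = falling_prod m j * (1 - q powi (m - int j))"
  by (simp add: falling_prod_def)

lemma falling_prod_Suc_shift: "falling_prod m (Suc j) = (1 - q powi m) * falling_prod (m - 1) j"
  unfolding falling_prod_def by (subst prod.lessThan_Suc_shift) (simp add: algebra_simps)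

text \<open>One product runs over every second exponent from \<open>n - 1\<close> downwards, the
  other from \<open>n - 2\<close> downwards, in the order given by \<open>qexp_cases\<close>;
  interleaved they form a single product with step \<open>q\<close>.\<close>

lemma qpoch_pair:
  assumes "n \<ge> 1"
  shows "qpoch (q powi qexp n) (inverse (q\<^sup>2)) x * qpoch ((q\<^sup>2) ^ ((n - 1) div 2)) (inverse (q\<^sup>2)) x = falling_prod (int n - 1) (2 * x)"
proof (induction x)
  case (Suc x)
  have i: "inverse (q\<^sup>2) ^ x = q powi (- int (2 * x))" unfolding power_inverse Q_powi by (simp add: power_int_minus)
  have 1: "q powi qexp n * inverse (q\<^sup>2) ^ x = q powi (qexp n - int (2 * x))"
    unfolding i using q_nz by (simp add: power_int_add[symmetric])
  have 2: "(q\<^sup>2) ^ ((n - 1) div 2) * inverse (q\<^sup>2) ^ x = q powi (2 * int ((n - 1) div 2) - int (2 * x))"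
    unfolding i Q_powi using q_nz by (simp add: power_int_add[symmetric])
  have z: "int n - 1 - int (Suc (2 * x)) = int n - 2 - int (2 * x)" by simp
  have 3: "(1 - q powi (qexp n - int (2 * x))) * (1 - q powi (2 * int ((n - 1) div 2) - int (2 * x)))
    = (1 - q powi (int n - 1 - int (2 * x))) * (1 - q powi (int n - 1 - int (Suc (2 * x))))"
    unfolding z by (rule qexp_cases[OF assms]) (simp_all only: mult.commute)
  have "falling_prod (int n - 1) (2 * Suc x) = falling_prod (int n - 1) (2 * x) * ((1 - q powi (int n - 1 - int (2 * x))) * (1 - q powi (int n - 1 - int (Suc (2 * x)))))"
    by (simp add: falling_prod_Suc mult.assoc)
  then show ?case unfolding 3[symmetric] Suc[symmetric] qpoch_Suc 1 2 by (simp only: mult_ac)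
qed (simp add: falling_prod_def)

lemma odd_rank_sum_0:
  assumes "r \<ge> 0" "n \<ge> 1"
  shows "odd_rank_sum q n 0 r = (- 1) ^ (nat r + nat r div 2) * q ^ ((nat r div 2)\<^sup>2 + nat r div 2) * falling_prod (int n - 1) (2 * (nat r div 2)) / qpoch (q\<^sup>2) (q\<^sup>2) (nat r div 2)"
  using assms(1) unfolding odd_rank_sum_def Let_def qbinom_def qpoch_pair[OF assms(2), symmetric] by simp

text \<open>The nondegenerate base case. For \<open>r \<ge> 2\<close> the factor
  \<open>qbinom (q^2) 0 (Suc x)\<close> vanishes, in accordance with the ranks of 1 by 1
  matrices.\<close>

lemma odd_rank_sum_1: "odd_rank_sum q 1 0 r = (if r = 0 then 1 else if r = 1 then - 1 else 0)"
proof (cases "r < 2")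
  case True
  then consider "r < 0" | "r = 0" | "r = 1" by linarith
  then show ?thesis by cases (simp_all add: odd_rank_sum_less_2)
next
  case False
  then have "nat r div 2 > 0" by auto
  then obtain x where x: "nat r div 2 = Suc x" by (metis gr0_conv_Suc)
  have "qbinom (q\<^sup>2) 0 (Suc x) = 0" by (simp add: qbinom_def qpoch_eq_0[of 0])
  then show ?thesis using False by (simp add: odd_rank_sum_def Let_def x)
qed

text \<open>At \<open>y = 0\<close> the Krawtchouk factor is 1, and \<open>odd_rank_sum_0\<close>
  gives a product of consecutive factors. The products for \<open>n\<close> and \<open>n - 1\<close>
  share all but one factor, so their difference factors completely.\<close>

lemma odd_rank_sum_0_rec:
  assumes "n \<ge> 2"
  shows "odd_rank_sum q n 0 r = odd_rank_sum q (n - 1) 0 r + q ^ (n - 1) * (q ^ (n - 2) - 1) * odd_rank_sum q (n - 2) 0 (r - 2)"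
proof (cases "r < 2")
  case True
  then show ?thesis by (cases "r < 0") (simp_all add: odd_rank_sum_less_2)
next
  case False
  define R where "R = nat r - 2"
  define x where "x = R div 2"
  have R: "nat r = Suc (Suc R)" "nat (r - 2) = R" using False by (auto simp: R_def)
  have x: "Suc (Suc R) div 2 = Suc x" by (simp add: x_def)
  have x2: "2 * Suc x = Suc (Suc (2 * x))" by simp
  define D where "D = qpoch (q\<^sup>2) (q\<^sup>2) x"
  have DS: "qpoch (q\<^sup>2) (q\<^sup>2) (Suc x) = D * (1 - q ^ (2 * x + 2))"
  proof -
    have "q\<^sup>2 * (q\<^sup>2) ^ x = q ^ (2 * x + 2)"
      by (simp only: power_mult[symmetric] power_add[symmetric] add.commute)
    then show ?thesis unfolding D_def qpoch_Suc by (simp only:)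
  qed
  have nz: "1 - q ^ (2 * x + 2) \<noteq> 0" using q_pow[of "2 * x + 2"] by simp
  define c where "c = (- 1 :: 'b) ^ (R + x) * q ^ (x\<^sup>2 + x) / D"
  have V1: "odd_rank_sum q k 0 r = - (c * q ^ (2 * x + 2)) * falling_prod (int k - 1) (Suc (Suc (2 * x))) / (1 - q ^ (2 * x + 2))" if "k \<ge> 1" for k
  proof -
    have "odd_rank_sum q k 0 r = (- 1) ^ (Suc (Suc R) + Suc x) * q ^ ((Suc x)\<^sup>2 + Suc x) * falling_prod (int k - 1) (2 * Suc x) / (D * (1 - q ^ (2 * x + 2)))"
      using odd_rank_sum_0[of r k] that False unfolding R x DS by simp
    then show ?thesis
      unfolding sq_add_Suc power_add[of q "x\<^sup>2 + x"] minus_one_Suc3 x2 c_def by (simp add: mult_ac)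
  qed
  have key: "falling_prod (int n - 1) (Suc (Suc (2 * x))) - falling_prod (int n - 2) (Suc (Suc (2 * x))) =
    q powi (int n - 3 - int (2 * x)) * (1 - q ^ (2 * x + 2)) * ((1 - q ^ (n - 2)) * falling_prod (int n - 3) (2 * x))"
  proof -
    have "falling_prod (int n - 1) (Suc (Suc (2 * x))) - falling_prod (int n - 2) (Suc (Suc (2 * x))) =
      ((1 - q powi (int n - 1)) - (1 - q powi (int n - 3 - int (2 * x)))) * falling_prod (int n - 2) (Suc (2 * x))"
    proof -
      have 1: "int n - 1 - 1 = int n - 2" "int n - 2 - int (Suc (2 * x)) = int n - 3 - int (2 * x)" by auto
      have "a * z - z * b = (a - b) * z" for a b z :: 'b by (simp add: algebra_simps)
      then show ?thesis unfolding falling_prod_Suc_shift[of "int n - 1"] falling_prod_Suc[of "int n - 2" "Suc _"] 1 .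
    qed
    also have "q powi (int n - 1) = q powi (int n - 3 - int (2 * x)) * q ^ (2 * x + 2)"
    proof -
      have "q powi (int n - 3 - int (2 * x) + int (2 * x + 2)) = q powi (int n - 3 - int (2 * x)) * q ^ (2 * x + 2)"
        using q_nz by (simp only: power_int_add power_int_of_nat simp_thms)
      then show ?thesis by (simp add: algebra_simps)
    qed
    also have "falling_prod (int n - 2) (Suc (2 * x)) = (1 - q ^ (n - 2)) * falling_prod (int n - 3) (2 * x)"
    proof -
      have 1: "int (n - 2) = int n - 2" "int n - 2 - 1 = int n - 3" using assms by auto
      show ?thesis unfolding falling_prod_Suc_shift power_int_of_nat[of q "n - 2", symmetric] 1 ..
    qed
    also have "((1 - q powi (int n - 3 - int (2 * x)) * q ^ (2 * x + 2)) - (1 - q powi (int n - 3 - int (2 * x)))) = q powi (int n - 3 - int (2 * x)) * (1 - q ^ (2 * x + 2))"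
    proof -
      have "(1 - u * v) - (1 - u) = u * (1 - v)" for u v :: 'b by (simp add: algebra_simps)
      then show ?thesis .
    qed
    finally show ?thesis .
  qed
  have "odd_rank_sum q n 0 r - odd_rank_sum q (n - 1) 0 r = - (c * q ^ (2 * x + 2)) * (falling_prod (int n - 1) (Suc (Suc (2 * x))) - falling_prod (int n - 2) (Suc (Suc (2 * x)))) / (1 - q ^ (2 * x + 2))"
  proof -
    have 1: "1 \<le> n" "1 \<le> n - 1" "int (n - 1) - 1 = int n - 2" using assms by auto
    have gen: "- c * a / v - - c * b / v = - c * (a - b) / v" for a b c v :: 'b
      by (simp add: diff_divide_distrib right_diff_distrib)
    show ?thesis unfolding V1[OF 1(1)] V1[OF 1(2)] 1(3) by (rule gen)
  qed
  also have "\<dots> = c * (q ^ (2 * x + 2) * q powi (int n - 3 - int (2 * x))) * ((q ^ (n - 2) - 1) * falling_prod (int n - 3) (2 * x))"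
  proof -
    have gen: "- (c * u) * (p * v * (w * z)) / v = c * (u * p) * (- w * z)" if "v \<noteq> 0" for c u p v w z :: 'b
      using that by simp
    show ?thesis unfolding key gen[OF nz] by simp
  qed
  also have "q ^ (2 * x + 2) * q powi (int n - 3 - int (2 * x)) = q ^ (n - 1)"
    using q_nz assms by (simp add: power_int_add[symmetric] of_nat_diff flip: power_int_of_nat)
  \<comment> \<open>For \<open>n = 2\<close> the formula \<open>odd_rank_sum_0\<close> does not
    apply at size 0, but there the coefficient \<open>q ^ 0 - 1\<close> is zero.\<close>
  also have "c * q ^ (n - 1) * ((q ^ (n - 2) - 1) * falling_prod (int n - 3) (2 * x)) = q ^ (n - 1) * (q ^ (n - 2) - 1) * odd_rank_sum q (n - 2) 0 (r - 2)"
  proof (cases "n = 2")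
    case False
    then have "odd_rank_sum q (n - 2) 0 (r - 2) = c * falling_prod (int n - 3) (2 * x)"
      using assms \<open>\<not> r < 2\<close> by (subst odd_rank_sum_0) (auto simp: R x_def[symmetric] c_def D_def of_nat_diff)
    then show ?thesis by (simp add: mult_ac)
  qed simp
  finally show ?thesis by (simp add: algebra_simps)
qed

text \<open>Contiguity expresses all three terms through \<open>y\<close> in place of
  \<open>Suc y\<close>; the induction hypothesis is then used twice, at sizes \<open>n\<close> and
  \<open>n - 2\<close>, and the powers of \<open>q\<close> match.\<close>

lemma odd_rank_sum_rec:
  assumes "n \<ge> 2 * y + 2"
  shows "odd_rank_sum q n y r = odd_rank_sum q (n - 1) y r + q ^ (n - 1) * (q ^ (n - 2 - 2 * y) - 1) * odd_rank_sum q (n - 2) y (r - 2)"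
  using assms
proof (induction y arbitrary: n r)
  case 0
  then show ?case using odd_rank_sum_0_rec[of n r] by simp
next
  case (Suc y)
  define k where "k = n - 4 - 2 * y"
  have n: "n = k + 2 * y + 4" using Suc.prems by (simp add: k_def)
  have ar: "n - 2 + 2 = n" "n - 3 + 2 = n - 1" "n - 4 + 2 = n - 2" "n - 2 - 1 = n - 3" "n - 2 - 2 = n - 4"
    "2 * (n - 2) + 1 - 2 * y = 2 * k + 2 * y + 5" "2 * (n - 3) + 1 - 2 * y = 2 * k + 2 * y + 3"
    "2 * (n - 4) + 1 - 2 * y = 2 * k + 2 * y + 1" "n - 1 = k + 2 * y + 3" "n - 2 - 2 * y = k + 2"
    "n - 3 = k + 2 * y + 1" "n - 4 - 2 * y = k" by (simp_all add: n)
  have ge: "2 * y + 2 \<le> n" "2 * y + 2 \<le> n - 2" by (simp_all add: n)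
  have a: "odd_rank_sum q n (Suc y) r = odd_rank_sum q n y r - q ^ (2 * k + 2 * y + 5) * odd_rank_sum q (n - 2) y (r - 2)"
    using odd_rank_sum_Suc[of y "n - 2" r] Suc.prems by (simp only: ar(1,6)) simp
  have b: "odd_rank_sum q (n - 1) (Suc y) r = odd_rank_sum q (n - 1) y r - q ^ (2 * k + 2 * y + 3) * odd_rank_sum q (n - 3) y (r - 2)"
    using odd_rank_sum_Suc[of y "n - 3" r] Suc.prems by (simp only: ar(2,7)) simp
  have c: "odd_rank_sum q n y r = odd_rank_sum q (n - 1) y r + q ^ (k + 2 * y + 3) * (q ^ (k + 2) - 1) * odd_rank_sum q (n - 2) y (r - 2)"
    using Suc.IH[of n r] ge by (simp only: ar(9,10))
  have d: "odd_rank_sum q (n - 2) y (r - 2) = odd_rank_sum q (n - 3) y (r - 2) + q ^ (k + 2 * y + 1) * (q ^ k - 1) * odd_rank_sum q (n - 4) y (r - 4)"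
    using Suc.IH[of "n - 2" "r - 2"] ge by (simp only: ar(4,5,11,12)) simp
  \<comment> \<open>Contiguity at size \<open>n - 2\<close> requires
    \<open>2 * y + 1 \<le> n - 4\<close>, which fails exactly for \<open>k = 0\<close>; the factor
    \<open>q ^ k - 1\<close> covers that case.\<close>
  have e: "(q ^ k - 1) * odd_rank_sum q (n - 2) (Suc y) (r - 2) = (q ^ k - 1) * (odd_rank_sum q (n - 2) y (r - 2) - q ^ (2 * k + 2 * y + 1) * odd_rank_sum q (n - 4) y (r - 4))"
  proof (cases "k = 0")
    case False
    then have "2 * y + 1 \<le> n - 4" by (simp add: n)
    then show ?thesis using odd_rank_sum_Suc[of y "n - 4" "r - 2"] by (simp only: ar(3,8)) simp
  qed simp
  define X where "X = q ^ k"
  define Y where "Y = q ^ (2 * y)"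
  have pw: "q ^ (2 * k + 2 * y + 5) = X * X * Y * q ^ 5" "q ^ (2 * k + 2 * y + 3) = X * X * Y * q ^ 3"
    "q ^ (k + 2 * y + 3) = X * Y * q ^ 3" "q ^ (k + 2) = X * q ^ 2" "q ^ (k + 2 * y + 1) = X * Y * q"
    "q ^ (2 * k + 2 * y + 1) = X * X * Y * q"
    unfolding X_def Y_def power_add[symmetric] power_Suc2[symmetric]
    by (auto intro!: arg_cong[where f = "power q"])
  have gen: "u + t * q ^ 3 * (X * q ^ 2 - 1) * v2 - X * t * q ^ 5 * v2 =
     u - X * t * q ^ 3 * v3 + t * q ^ 3 * ((X - 1) * (v2 - X * t * q * v4))"
    if "v2 = v3 + t * q * (X - 1) * v4" for u t v2 v3 v4
    unfolding that by (simp add: algebra_simps eval_nat_numeral)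
  have "odd_rank_sum q n (Suc y) r = odd_rank_sum q (n - 1) (Suc y) r + q ^ (k + 2 * y + 3) * ((q ^ k - 1) * odd_rank_sum q (n - 2) (Suc y) (r - 2))"
    using gen[OF d[unfolded pw X_def[symmetric]], of "odd_rank_sum q (n - 1) y r"]
    unfolding pw X_def[symmetric] e[unfolded pw X_def[symmetric]] a[unfolded pw X_def[symmetric]]
      b[unfolded pw X_def[symmetric]] c[unfolded pw X_def[symmetric]] by (simp only: mult.assoc)
  moreover have "n - 1 = k + 2 * y + 3" "n - 2 - 2 * Suc y = k" by (simp_all add: n)
  ultimately show ?case by (simp add: mult.assoc)
qed

text \<open>Contiguity leaves a form of rank \<open>2 * y + 1\<close> in size
  \<open>2 * y + 3\<close>, and \<open>odd_rank_sum_rec\<close> lowers the size twice, the second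
  time with coefficient \<open>q ^ 0 - 1 = 0\<close>. The coefficients
  \<open>- (q ^ (2 * y + 3))\<close> and \<open>q ^ (2 * y + 2) * (q - 1)\<close> add up to the
  stated one.\<close>

lemma odd_rank_sum_diag: "odd_rank_sum q (2 * y + 3) (Suc y) r = odd_rank_sum q (2 * y + 1) y r - q ^ (2 * y + 2) * odd_rank_sum q (2 * y + 1) y (r - 2)"
proof -
  have 1: "odd_rank_sum q (2 * y + 3) (Suc y) r = odd_rank_sum q (2 * y + 3) y r - q ^ (2 * y + 3) * odd_rank_sum q (2 * y + 1) y (r - 2)"
    using odd_rank_sum_Suc[of y "2 * y + 1" r] by (simp add: numeral_3_eq_3)
  have 2: "odd_rank_sum q (2 * y + 3) y r = odd_rank_sum q (2 * y + 2) y r + q ^ (2 * y + 2) * (q - 1) * odd_rank_sum q (2 * y + 1) y (r - 2)"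
    using odd_rank_sum_rec[of y "2 * y + 3" r] by simp
  have 3: "odd_rank_sum q (2 * y + 2) y r = odd_rank_sum q (2 * y + 1) y r"
    using odd_rank_sum_rec[of y "2 * y + 2" r] by simp
  have 4: "q ^ (2 * y + 3) = q * q ^ (2 * y + 2)" by (simp add: numeral_3_eq_3)
  show ?thesis unfolding 1 2 3 4 by (simp add: algebra_simps)
qed

end

subsection \<open>Quadratic characters and Gauss sums\<close>

definition qchar :: "'a::field \<Rightarrow> complex" where
  "qchar x = (if x = 0 then 0 else if \<exists>y. x = y\<^sup>2 then 1 else - 1)"

lemma qchar_0 [simp]: "qchar 0 = 0"
  by (simp add: qchar_def)

lemma qchar_1 [simp]: "qchar 1 = 1"
  by (auto simp: qchar_def intro: exI[of _ 1])

lemma qchar_sq: "x \<noteq> 0 \<Longrightarrow> qchar x * qchar x = 1"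
  by (simp add: qchar_def)

lemma two_neq_0_of_odd_card:
  assumes "odd CARD('a::{field,finite})"
  shows "(2::'a) \<noteq> 0"
proof
  assume "(2::'a) = 0"
  then have "of_nat 2 = (0::'a)" by simp
  then have "CHAR('a) dvd 2" by (simp only: of_nat_eq_0_iff_char_dvd)
  moreover have "CHAR('a) \<noteq> 1" by simp
  ultimately have "CHAR('a) = 2" using prime_nat_iff two_is_prime_nat by blast
  then show False using CHAR_dvd_CARD[where 'a = 'a] assms by simp
qed

lemma card_field_ge_2: "CARD('a::{field,finite}) \<ge> 2"
  using card_mono[of UNIV "{0, 1 :: 'a}"] by simp

text \<open>Multiplication by \<open>x\<close> permutes the non-zero elements and hence preserves
  their product.\<close>

lemma power_card_minus_1:
  fixes x :: "'a::{field,finite}"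
  assumes "x \<noteq> 0"
  shows "x ^ (CARD('a) - 1) = 1"
proof -
  have "(\<Prod>y\<in>UNIV-{0}. x * y) = x ^ (CARD('a) - 1) * \<Prod>(UNIV-{0})"
    by (simp add: prod.distrib)
  also have "(\<Prod>y\<in>UNIV-{0}. x * y) = (\<Prod>y\<in>UNIV-{0}. y)"
    by (rule prod.reindex_bij_witness[of _ "\<lambda>y. y / x" "\<lambda>y. x * y"]) (use assms in auto)
  finally show ?thesis by simp
qed

context
  assumes odd_card: "odd CARD('a::{field,finite})"
begin

lemma square_eq_cases: "{y. y\<^sup>2 = (z::'a)\<^sup>2} = {z, - z}"
  by (auto simp: power2_eq_iff)

lemma card_sqrt:
  fixes x :: 'a
  shows "of_nat (card {y. y\<^sup>2 = x}) = 1 + qchar x"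
proof (cases "\<exists>z. x = z\<^sup>2")
  case True
  then obtain z where z: "x = z\<^sup>2" by blast
  have "z \<noteq> - z" if "z \<noteq> 0"
  proof
    assume "z = - z"
    then have "2 * z = 0" by (metis add.right_inverse mult_2)
    then show False using two_neq_0_of_odd_card[OF odd_card] that by simp
  qed
  then show ?thesis unfolding z square_eq_cases by (cases "z = 0") (auto simp: qchar_def)
next
  case False
  have "{y. y\<^sup>2 = x} = {}" using False by blast
  moreover have "x \<noteq> 0" using False by (metis power_zero_numeral)
  ultimately have "{y. y\<^sup>2 = x} = {}" "x \<noteq> 0" by blast+
  then show ?thesis using False by (simp add: qchar_def)
qed

text \<open>Every \<open>z\<close> has \<open>1 + qchar z\<close> square roots.\<close>

lemma sum_over_squares:
  fixes f :: "'a \<Rightarrow> complex"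
  shows "(\<Sum>x\<in>UNIV. f (x\<^sup>2)) = (\<Sum>z\<in>UNIV. (1 + qchar z) * f z)"
proof -
  have "(\<Sum>x\<in>UNIV. f (x\<^sup>2)) = (\<Sum>z\<in>UNIV. \<Sum>x\<in>{x\<in>UNIV. x\<^sup>2 = z}. f (x\<^sup>2))"
    by (rule sum.group[symmetric]) auto
  also have "\<dots> = (\<Sum>z\<in>UNIV. (1 + qchar z) * f z)"
    by (rule sum.cong) (simp_all flip: card_sqrt)
  finally show ?thesis .
qed

lemma sum_qchar: "(\<Sum>z\<in>UNIV. qchar (z::'a)) = 0"
  using sum_over_squares[of "\<lambda>_. 1"] by (simp add: sum.distrib)

text \<open>The values of \<open>qchar\<close> sum to zero, so the non-zero elements are half
  squares and half non-squares.\<close>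

lemma card_nonzero_squares: "2 * card {x::'a. x \<noteq> 0 \<and> (\<exists>y. x = y\<^sup>2)} = CARD('a) - 1"
proof -
  let ?S = "{x::'a. x \<noteq> 0 \<and> (\<exists>y. x = y\<^sup>2)}"
  let ?N = "{x::'a. x \<noteq> 0 \<and> \<not> (\<exists>y. x = y\<^sup>2)}"
  have un: "UNIV - {0} = ?S \<union> ?N" by auto
  have "0 = (\<Sum>z\<in>UNIV - {0}. qchar (z::'a))" using sum_qchar by (simp add: sum.remove[of _ 0])
  also have "\<dots> = (\<Sum>z\<in>?S. qchar z) + (\<Sum>z\<in>?N. qchar z)"
    unfolding un by (rule sum.union_disjoint) auto
  also have "\<dots> = of_nat (card ?S) - of_nat (card ?N)"
  proof -
    have "(\<Sum>z\<in>?S. qchar z) = (\<Sum>z\<in>?S. 1)" by (rule sum.cong) (auto simp: qchar_def)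
    moreover have "(\<Sum>z\<in>?N. qchar z) = (\<Sum>z\<in>?N. - 1)" by (rule sum.cong) (auto simp: qchar_def)
    ultimately show ?thesis by simp
  qed
  finally have "card ?S = card ?N" by simp
  moreover have "card (UNIV - {0::'a}) = card ?S + card ?N"
    unfolding un by (rule card_Un_disjoint) auto
  ultimately show ?thesis by (simp add: card_Diff_subset)
qed

lemma half_card: "2 * ((CARD('a) - 1) div 2) = CARD('a) - 1"
  using odd_card by presburger

lemma one_neq_minus_one: "(1::'a) \<noteq> - 1"
proof
  assume "(1::'a) = - 1"
  then have "(1::'a) + 1 = 0" by (metis add.right_inverse)
  then show False using two_neq_0_of_odd_card[OF odd_card] by simp
qed

text \<open>The non-zero squares are \<open>m = (CARD('a) - 1) div 2\<close> roots of
  \<open>X^m - 1\<close>, hence all of its roots. For any other non-zero element the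
  \<open>m\<close>-th power has square 1 without being 1.\<close>

lemma euler_criterion_field:
  fixes x :: 'a
  assumes "x \<noteq> 0"
  shows "x ^ ((CARD('a) - 1) div 2) = (if \<exists>y. x = y\<^sup>2 then 1 else - 1)"
proof -
  define m where "m = (CARD('a) - 1) div 2"
  have m2: "2 * m = CARD('a) - 1" unfolding m_def by (rule half_card)
  have m0: "m > 0" using m2 card_field_ge_2[where 'a = 'a] by (cases m) auto
  define p :: "'a poly" where "p = Polynomial.monom 1 m - 1"
  have p: "poly p y = y ^ m - 1" for y by (simp add: p_def poly_monom)
  have deg: "degree p \<le> m" unfolding p_def by (rule degree_diff_le) (simp_all add: degree_monom_le)
  have p0: "p \<noteq> 0"
  proof
    assume "p = 0"
    then have "poly p 0 = 0" by simp
    then show False using m0 unfolding p by (simp add: zero_power)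
  qed
  let ?S = "{x::'a. x \<noteq> 0 \<and> (\<exists>y. x = y\<^sup>2)}"
  have sub: "?S \<subseteq> {y. poly p y = 0}"
  proof
    fix z :: 'a assume "z \<in> ?S"
    then obtain y where "z = y\<^sup>2" "y \<noteq> 0" by auto
    have "z ^ m = y ^ (2 * m)" using \<open>z = y\<^sup>2\<close> by (simp add: power_mult)
    also have "\<dots> = 1" unfolding m2 by (rule power_card_minus_1) fact
    finally show "z \<in> {y. poly p y = 0}" by (simp add: p)
  qed
  have fin: "finite {y. poly p y = 0}" by (rule poly_roots_finite[OF p0])
  have "card {y. poly p y = 0} \<le> m" using card_poly_roots_bound[OF p0] deg by simp
  moreover have "card ?S = m" using card_nonzero_squares m2 by simp
  ultimately have eq: "?S = {y. poly p y = 0}" by (metis card_seteq[OF fin sub])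
  show ?thesis
  proof (cases "\<exists>y. x = y\<^sup>2")
    case True
    then have "x \<in> ?S" using assms by simp
    then show ?thesis unfolding eq using True by (simp add: p m_def)
  next
    case False
    then have "x \<notin> ?S" by simp
    then have "x ^ m \<noteq> 1" unfolding eq by (simp add: p)
    moreover have "(x ^ m)\<^sup>2 = 1"
      unfolding power_mult[symmetric] mult.commute[of m] m2 by (rule power_card_minus_1[OF assms])
    ultimately show ?thesis using False by (simp add: m_def power2_eq_1_iff)
  qed
qed

text \<open>By Euler's criterion \<open>qchar\<close> is a power map whose values \<open>1\<close>
  and \<open>- 1\<close> in the field are read as complex numbers; the reading is faithful because
  they are distinct in odd characteristic.\<close>

lemma qchar_mult: "qchar (x * y :: 'a) = qchar x * qchar y"
proof (cases "x = 0 \<or> y = 0")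
  case False
  define m where "m = (CARD('a) - 1) div 2"
  have e: "(z ^ m = 1) = (\<exists>y. z = y\<^sup>2)" if "z \<noteq> 0" for z :: 'a
    using euler_criterion_field[OF that] one_neq_minus_one unfolding m_def by auto
  have e': "(z ^ m = - 1) = (\<not> (\<exists>y. z = y\<^sup>2))" if "z \<noteq> 0" for z :: 'a
    using euler_criterion_field[OF that] one_neq_minus_one unfolding m_def by auto
  have q: "qchar z = (if z ^ m = 1 then 1 else - 1)" if "z \<noteq> 0" for z :: 'a
    using e[OF that] that by (simp add: qchar_def)
  have "z ^ m = 1 \<or> z ^ m = - 1" if "z \<noteq> 0" for z :: 'a
    using e[OF that] e'[OF that] by blast
  then have "x ^ m = 1 \<or> x ^ m = - 1" "y ^ m = 1 \<or> y ^ m = - 1" using False by auto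
  then show ?thesis using False one_neq_minus_one
    by (auto simp: q power_mult_distrib)
qed auto

lemma qchar_minus_one: "qchar (- 1 :: 'a) = (if CARD('a) mod 4 = 1 then 1 else - 1)"
proof -
  define m where "m = (CARD('a) - 1) div 2"
  have m2: "2 * m = CARD('a) - 1" unfolding m_def by (rule half_card)
  have "even m \<longleftrightarrow> CARD('a) mod 4 = 1"
    using m2 card_field_ge_2[where 'a = 'a] by presburger
  moreover have "(\<exists>y. (- 1 :: 'a) = y\<^sup>2) \<longleftrightarrow> even m"
    using euler_criterion_field[of "- 1"] one_neq_minus_one unfolding m_def[symmetric]
    by (cases "even m") (auto split: if_splits)
  ultimately show ?thesis by (simp add: qchar_def)
qed

end

section \<open>Gauss sums of a nontrivial additive character\<close>

locale odd_field_char =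
  fixes \<theta> :: "'a::{field,finite} \<Rightarrow> complex" and q :: complex
  assumes odd_card: "odd CARD('a)"
    and char: "additive_character_on UNIV \<theta>"
    and nontriv: "\<exists>t. \<theta> t \<noteq> 1"
    and q: "q = of_nat CARD('a)"
begin

lemma two_neq_0: "(2::'a) \<noteq> 0"
  by (rule two_neq_0_of_odd_card[OF odd_card])

lemma theta_add: "\<theta> (x + y) = \<theta> x * \<theta> y"
  using char by (auto simp: additive_character_on_def)

lemma theta_nz: "\<theta> x \<noteq> 0"
  using char by (auto simp: additive_character_on_def)

lemma theta_0 [simp]: "\<theta> 0 = 1"
  using theta_add[of 0 0] theta_nz[of 0] by simp

text \<open>Orthogonality: translating \<open>x\<close> by \<open>z / t\<close> multiplies the sum
  by \<open>\<theta> z\<close>, which is not 1.\<close>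

lemma sum_theta_mult: "(\<Sum>x\<in>UNIV. \<theta> (t * x)) = (if t = 0 then q else 0)"
proof (cases "t = 0")
  case False
  obtain z where z: "\<theta> z \<noteq> 1" using nontriv by blast
  have "(\<Sum>x\<in>UNIV. \<theta> (t * x)) = (\<Sum>x\<in>UNIV. \<theta> (t * (x + z / t)))"
    by (rule sum.reindex_bij_witness[of _ "\<lambda>x. x + z / t" "\<lambda>x. x - z / t"]) auto
  also have "\<dots> = (\<Sum>x\<in>UNIV. \<theta> (t * x)) * \<theta> z"
    using False by (simp add: distrib_left theta_add sum_distrib_right)
  finally show ?thesis using z False by simp
qed (simp add: q)

lemma sum_theta_nonzero: "(\<Sum>x\<in>UNIV - {0}. \<theta> (t * x)) = (if t = 0 then q - 1 else - 1)"
  using sum_theta_mult[of t] by (simp add: sum.remove[of _ 0] algebra_simps eq_neg_iff_add_eq_0 split: if_splits)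

definition gauss :: complex where "gauss = (\<Sum>x\<in>UNIV. \<theta> (x\<^sup>2))"

lemma sum_qchar_theta_eq: "(\<Sum>z\<in>UNIV. qchar z * \<theta> (t * z)) = (\<Sum>x\<in>UNIV. \<theta> (t * x\<^sup>2)) - (\<Sum>z\<in>UNIV. \<theta> (t * z))"
  using sum_over_squares[OF odd_card, of "\<lambda>z. \<theta> (t * z)"] by (simp add: distrib_right sum.distrib)

lemma qchar_inverse: "qchar (inverse (c::'a)) = qchar c"
proof (cases "c = 0")
  case False
  then have "qchar c * qchar (inverse c) = 1" using qchar_mult[OF odd_card, of c "inverse c"] by simp
  then show ?thesis by (auto simp: qchar_def split: if_splits)
qed simp

lemma sum_qchar_theta: "(\<Sum>z\<in>UNIV. qchar z * \<theta> (t * z)) = qchar t * gauss"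
proof (cases "t = 0")
  case True
  then show ?thesis using sum_qchar[OF odd_card] by simp
next
  case False
  have "(\<Sum>z\<in>UNIV. qchar z * \<theta> (t * z)) = (\<Sum>z\<in>UNIV. qchar (inverse t * z) * \<theta> z)"
    by (rule sum.reindex_bij_witness[of _ "\<lambda>z. inverse t * z" "\<lambda>z. t * z"]) (use False in \<open>auto simp: mult.assoc[symmetric]\<close>)
  also have "\<dots> = qchar t * (\<Sum>z\<in>UNIV. qchar z * \<theta> (1 * z))"
    by (simp add: qchar_mult[OF odd_card] qchar_inverse sum_distrib_left mult.assoc)
  also have "(\<Sum>z\<in>UNIV. qchar z * \<theta> (1 * z)) = gauss"
    unfolding sum_qchar_theta_eq sum_theta_mult by (simp add: gauss_def)
  finally show ?thesis .
qed

lemma sum_theta_square: "(\<Sum>x\<in>UNIV. \<theta> (c * x\<^sup>2)) = (if c = 0 then q else qchar c * gauss)"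
  using sum_qchar_theta[of c] unfolding sum_qchar_theta_eq sum_theta_mult by (auto simp: q split: if_splits)

lemma sum_qchar_theta_nonzero: "(\<Sum>z\<in>UNIV - {0}. qchar z * \<theta> (t * z)) = qchar t * gauss"
  using sum_qchar_theta[of t] by (simp add: sum.remove[of _ 0])

lemma four_neq_0: "(4::'a) \<noteq> 0"
proof
  assume "(4::'a) = 0"
  then have "2 * 2 = (0::'a)" by simp
  then show False using two_neq_0 mult_eq_0_iff by blast
qed

text \<open>\<open>qchar (- 1) * gauss\<close> is the sum of \<open>\<theta> (- (y^2))\<close>, so
  multiplying it by \<open>gauss\<close> gives a double sum over \<open>x^2 - y^2\<close>. In the
  coordinates \<open>u = x - y\<close> and \<open>v = x + y\<close>, available since 2 is
  invertible, orthogonality leaves only \<open>u = 0\<close>.\<close>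

lemma gauss_square: "gauss\<^sup>2 = qchar (- 1 :: 'a) * q"
proof -
  have "gauss * (qchar (- 1 :: 'a) * gauss) = (\<Sum>x\<in>UNIV. \<theta> (x\<^sup>2)) * (\<Sum>y\<in>UNIV. \<theta> (- 1 * y\<^sup>2))"
    unfolding sum_theta_square gauss_def[symmetric] by simp
  also have "\<dots> = (\<Sum>(x,y)\<in>UNIV \<times> UNIV. \<theta> (x\<^sup>2 - y\<^sup>2))"
    by (simp add: sum_product sum.cartesian_product theta_add[symmetric])
  also have "\<dots> = (\<Sum>(u,v)\<in>UNIV \<times> UNIV. \<theta> (u * v))"
    by (rule sum.reindex_bij_witness[of _ "\<lambda>(u,v). ((u + v) / 2, (v - u) / 2)" "\<lambda>(x,y). (x - y, x + y)"])
      (use two_neq_0 four_neq_0 in \<open>auto simp: field_simps power2_eq_square\<close>)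
  also have "\<dots> = (\<Sum>u\<in>(UNIV::'a set). if u = 0 then q else 0)"
    by (simp only: sum.cartesian_product[symmetric] sum_theta_mult)
  finally have "gauss * (qchar (- 1 :: 'a) * gauss) = q" by simp
  then have "qchar (- 1 :: 'a) * (gauss * (qchar (- 1 :: 'a) * gauss)) = qchar (- 1 :: 'a) * q" by simp
  moreover have "qchar (- 1 :: 'a) * (gauss * (qchar (- 1 :: 'a) * gauss)) = (qchar (- 1 :: 'a) * qchar (- 1 :: 'a)) * gauss\<^sup>2"
    by (simp add: power2_eq_square)
  ultimately show ?thesis using qchar_sq[of "- 1 :: 'a"] by simp
qed

end

subsection \<open>Character sums over bordered symmetric matrices\<close>

text \<open>Vectors and matrices are functions on all naturals vanishing off an index set
  \<open>I\<close>. Deleting a row and column then only shrinks \<open>I\<close>, without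
  renumbering.\<close>

definition vecs :: "nat set \<Rightarrow> (nat \<Rightarrow> 'a::zero) set" where
  "vecs I = {v. \<forall>i. i \<notin> I \<longrightarrow> v i = 0}"

definition symfuns :: "nat set \<Rightarrow> (nat \<Rightarrow> nat \<Rightarrow> 'a::zero) set" where
  "symfuns I = {b. (\<forall>i j. b i j = b j i) \<and> (\<forall>i j. i \<notin> I \<longrightarrow> b i j = 0)}"

definition kern :: "nat set \<Rightarrow> (nat \<Rightarrow> nat \<Rightarrow> 'a::comm_ring) \<Rightarrow> (nat \<Rightarrow> 'a) set" where
  "kern I b = {v \<in> vecs I. \<forall>i\<in>I. (\<Sum>k\<in>I. b i k * v k) = 0}"

definition border :: "nat \<Rightarrow> 'a \<Rightarrow> (nat \<Rightarrow> 'a) \<Rightarrow> (nat \<Rightarrow> nat \<Rightarrow> 'a) \<Rightarrow> nat \<Rightarrow> nat \<Rightarrow> 'a" where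
  "border j c u B = (\<lambda>i k. if i = j then (if k = j then c else u k) else if k = j then u i else B i k)"

lemma finite_vecs: "finite I \<Longrightarrow> finite (vecs I :: (nat \<Rightarrow> 'a::{finite,zero}) set)"
  using finite_set_of_finite_funs[of I "UNIV :: 'a set" 0] by (simp add: vecs_def)

lemma finite_symfuns:
  assumes "finite I"
  shows "finite (symfuns I :: (nat \<Rightarrow> nat \<Rightarrow> 'a::{finite,zero}) set)"
proof -
  let ?F = "{f. \<forall>x. (x \<in> I \<times> I \<longrightarrow> f x \<in> (UNIV :: 'a set)) \<and> (x \<notin> I \<times> I \<longrightarrow> f x = 0)}"
  have "finite ?F" using assms by (intro finite_set_of_finite_funs) auto
  moreover have "symfuns I \<subseteq> (\<lambda>f i j. f (i, j)) ` ?F"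
  proof
    fix b :: "nat \<Rightarrow> nat \<Rightarrow> 'a" assume b: "b \<in> symfuns I"
    have "(\<lambda>(i, j). b i j) \<in> ?F"
      using b unfolding symfuns_def by (auto split: prod.splits) metis
    then show "b \<in> (\<lambda>f i j. f (i, j)) ` ?F" by (rule rev_image_eqI) simp
  qed
  ultimately show ?thesis by (rule finite_surj)
qed

lemma sum_vecs_insert:
  fixes f :: "(nat \<Rightarrow> 'a::{finite,zero}) \<Rightarrow> 'b::comm_monoid_add"
  assumes "j \<notin> I"
  shows "sum f (vecs (insert j I)) = (\<Sum>c\<in>UNIV. \<Sum>v\<in>vecs I. f (v(j := c)))"
proof -
  have "sum f (vecs (insert j I)) = (\<Sum>(c, v)\<in>UNIV \<times> vecs I. f (v(j := c)))"
    by (rule sum.reindex_bij_witness[of _ "\<lambda>(c, v). v(j := c)" "\<lambda>v. (v j, v(j := 0))"])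
      (use assms in \<open>auto simp: vecs_def\<close>)
  then show ?thesis by (simp add: sum.cartesian_product)
qed

lemma vecs_empty [simp]: "vecs {} = {\<lambda>_. 0}"
  by (auto simp: vecs_def)

lemma card_vecs:
  assumes "finite I"
  shows "card (vecs I :: (nat \<Rightarrow> 'a::{finite,zero}) set) = CARD('a) ^ card I"
  using assms
proof (induction I)
  case (insert j I)
  then show ?case using sum_vecs_insert[of j I "\<lambda>_::nat \<Rightarrow> 'a. 1::nat"] by simp
qed simp

lemma sum_symfuns_insert:
  fixes f :: "(nat \<Rightarrow> nat \<Rightarrow> 'a::{finite,zero}) \<Rightarrow> 'b::comm_monoid_add"
  assumes "j \<notin> I"
  shows "sum f (symfuns (insert j I)) = (\<Sum>c\<in>UNIV. \<Sum>u\<in>vecs I. \<Sum>B\<in>symfuns I. f (border j c u B))"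
proof -
  have "sum f (symfuns (insert j I)) = (\<Sum>(c, u, B)\<in>UNIV \<times> vecs I \<times> symfuns I. f (border j c u B))"
    by (rule sum.reindex_bij_witness[of _ "\<lambda>(c, u, B). border j c u B"
          "\<lambda>b. (b j j, \<lambda>k. if k = j then 0 else b j k, \<lambda>i k. if i = j \<or> k = j then 0 else b i k)"])
      (use assms in \<open>auto simp: vecs_def symfuns_def border_def fun_eq_iff intro!: arg_cong[where f = f]\<close>)
  then show ?thesis by (simp add: sum.cartesian_product)
qed

text \<open>The kernel of the matrix with corner \<open>c\<close>, first column \<open>u\<close> and remaining block \<open>B\<close>; the first
  coordinate is split off as \<open>t\<close>.\<close>

definition bordered_kern :: "nat set \<Rightarrow> 'a \<Rightarrow> (nat \<Rightarrow> 'a) \<Rightarrow> (nat \<Rightarrow> nat \<Rightarrow> 'a::comm_ring) \<Rightarrow> ('a \<times> (nat \<Rightarrow> 'a)) set" where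
  "bordered_kern I c u B = {(t, v). v \<in> vecs I \<and> c * t + (\<Sum>k\<in>I. u k * v k) = 0 \<and>
     (\<forall>i\<in>I. u i * t + (\<Sum>k\<in>I. B i k * v k) = 0)}"

lemma card_kern_border:
  assumes "finite I" "j \<notin> I"
  shows "card (kern (insert j I) (border j c u B)) = card (bordered_kern I c u B)"
proof -
  have rest: "(\<Sum>k\<in>I. (if k = j then x else f k) * (if k = j then y else g k)) = (\<Sum>k\<in>I. f k * g k)"
    "(\<Sum>k\<in>I. (if k = j then x else f k) * g k) = (\<Sum>k\<in>I. f k * g k)" for x y f g
    by (rule sum.cong; use assms(2) in auto)+
  have ne: "i \<in> I \<Longrightarrow> i \<noteq> j" for i using assms(2) by auto
  have "bij_betw (\<lambda>v. (v j, v(j := 0))) (kern (insert j I) (border j c u B)) (bordered_kern I c u B)"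
    by (rule bij_betw_byWitness[where f' = "\<lambda>(t, v). v(j := t)"])
      (use assms ne in \<open>auto simp: kern_def bordered_kern_def vecs_def border_def fun_upd_def rest\<close>)
  then show ?thesis by (rule bij_betw_same_card)
qed

lemma solve_linear:
  fixes c :: "'a::field"
  assumes "c \<noteq> 0" "c * t + z = 0"
  shows "t = - z / c"
proof -
  have "c * t = - z" using assms(2) by (simp add: eq_neg_iff_add_eq_0)
  then show ?thesis using assms(1) by (metis nonzero_mult_div_cancel_left)
qed

text \<open>The corner equation determines \<open>t\<close> from \<open>v\<close>; substituting it
  into the other rows gives the Schur complement.\<close>

lemma card_bordered_kern_pivot:
  fixes c :: "'a::field"
  assumes "c \<noteq> 0"
  shows "card (bordered_kern I c u B) = card (kern I (\<lambda>i k. B i k - u i * u k / c))"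
proof -
  have s: "(\<Sum>k\<in>I. (B i k - u i * u k / c) * v k) = (\<Sum>k\<in>I. B i k * v k) - u i * (\<Sum>k\<in>I. u k * v k) / c" for i and v :: "nat \<Rightarrow> 'a"
  proof -
    have "(\<Sum>k\<in>I. (B i k - u i * u k / c) * v k) = (\<Sum>k\<in>I. B i k * v k - u i / c * (u k * v k))"
      by (rule sum.cong) (simp_all add: algebra_simps)
    then show ?thesis by (simp only: sum_subtractf sum_distrib_left[symmetric]) simp
  qed
  have t: "t = - (\<Sum>k\<in>I. u k * v k) / c" if "c * t + (\<Sum>k\<in>I. u k * v k) = 0" for t and v :: "nat \<Rightarrow> 'a"
    by (rule solve_linear[OF assms that])
  have "bij_betw snd (bordered_kern I c u B) (kern I (\<lambda>i k. B i k - u i * u k / c))"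
    by (rule bij_betw_byWitness[where f' = "\<lambda>v. (- (\<Sum>k\<in>I. u k * v k) / c, v)"])
      (use assms in \<open>auto simp: kern_def bordered_kern_def s dest!: t\<close>)
  then show ?thesis by (rule bij_betw_same_card)
qed

lemma card_bordered_kern_zero:
  fixes B :: "nat \<Rightarrow> nat \<Rightarrow> 'a::{field,finite}"
  shows "card (bordered_kern I 0 (\<lambda>_. 0) B) = CARD('a) * card (kern I B)"
proof -
  have "bordered_kern I 0 (\<lambda>_. 0) B = UNIV \<times> kern I B"
    by (auto simp: bordered_kern_def kern_def)
  then show ?thesis by (simp add: card_cartesian_product)
qed

text \<open>Adding to \<open>t\<close> the pairing of \<open>w\<close> with \<open>v\<close> absorbs
  the part \<open>u w^t\<close>. The part \<open>w u^t\<close> contributes a multiple of the pairing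
  of \<open>u\<close> with \<open>v\<close>, which is zero by the corner equation since the corner
  is 0.\<close>

lemma card_bordered_kern_translate:
  fixes w :: "nat \<Rightarrow> 'a::field"
  shows "card (bordered_kern I 0 u (\<lambda>i k. B i k + u i * w k + w i * u k)) = card (bordered_kern I 0 u B)"
proof -
  have s: "(\<Sum>k\<in>I. (B i k + u i * w k + w i * u k) * v k) = (\<Sum>k\<in>I. B i k * v k) + u i * (\<Sum>k\<in>I. w k * v k) + w i * (\<Sum>k\<in>I. u k * v k)" for i and v :: "nat \<Rightarrow> 'a"
  proof -
    have "(\<Sum>k\<in>I. (B i k + u i * w k + w i * u k) * v k) = (\<Sum>k\<in>I. B i k * v k + u i * (w k * v k) + w i * (u k * v k))"
      by (rule sum.cong) (simp_all add: algebra_simps)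
    then show ?thesis by (simp only: sum.distrib sum_distrib_left[symmetric])
  qed
  have "bij_betw (\<lambda>(t, v). (t + (\<Sum>k\<in>I. w k * v k), v)) (bordered_kern I 0 u (\<lambda>i k. B i k + u i * w k + w i * u k)) (bordered_kern I 0 u B)"
    by (rule bij_betw_byWitness[where f' = "\<lambda>(t, v). (t - (\<Sum>k\<in>I. w k * v k), v)"])
      (auto simp: bordered_kern_def s[unfolded add.assoc] distrib_left right_diff_distrib add_ac)
  then show ?thesis by (rule bij_betw_same_card)
qed

text \<open>Row \<open>p\<close> reads \<open>u p * t = 0\<close> and forces \<open>t = 0\<close>;
  the corner equation then fixes \<open>v p\<close>, and the remaining rows do not see
  \<open>v p\<close>.\<close>

lemma card_bordered_kern_delete:
  fixes B :: "nat \<Rightarrow> nat \<Rightarrow> 'a::field"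
  assumes "finite I" "p \<in> I" "u p \<noteq> 0" "B \<in> symfuns (I - {p})"
  shows "card (bordered_kern I 0 u B) = card (kern (I - {p}) B)"
proof -
  have B0: "B p k = 0" "B k p = 0" for k
    using assms(4) by (auto simp: symfuns_def dest: spec[of _ p])
  have I: "(\<Sum>k\<in>I. f k) = f p + (\<Sum>k\<in>I - {p}. f k)" for f :: "nat \<Rightarrow> 'a"
    by (rule sum.remove) (use assms in auto)
  have upd: "(\<Sum>k\<in>I - {p}. f k * (v(p := x)) k) = (\<Sum>k\<in>I - {p}. f k * v k)" for f v :: "nat \<Rightarrow> 'a" and x
    by (rule sum.cong) auto
  have t0: "t = 0" if "(t, v) \<in> bordered_kern I 0 u B" for t v
    using that assms(2,3) by (auto simp: bordered_kern_def B0)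
  have v: "v p = - (\<Sum>k\<in>I - {p}. u k * v k) / u p" if "(t, v) \<in> bordered_kern I 0 u B" for t v
    using that by (intro solve_linear[OF assms(3)]) (simp add: bordered_kern_def I)
  have "bij_betw (\<lambda>(t, v). v(p := 0)) (bordered_kern I 0 u B) (kern (I - {p}) B)"
  proof (rule bij_betw_byWitness[where f' = "\<lambda>v. (0, v(p := - (\<Sum>k\<in>I - {p}. u k * v k) / u p))"])
    show "\<forall>a\<in>bordered_kern I 0 u B. (\<lambda>v. (0, v(p := - (\<Sum>k\<in>I - {p}. u k * v k) / u p))) (case a of (t, v) \<Rightarrow> v(p := 0)) = a"
      using t0 v by (auto simp: upd fun_eq_iff)
    show "\<forall>v\<in>kern (I - {p}) B. (case (0, v(p := - (\<Sum>k\<in>I - {p}. u k * v k) / u p)) of (t, v) \<Rightarrow> v(p := 0)) = v"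
      by (auto simp: kern_def vecs_def fun_eq_iff)
    show "(\<lambda>(t, v). v(p := 0)) ` bordered_kern I 0 u B \<subseteq> kern (I - {p}) B"
    proof (clarify)
      fix t v assume tv: "(t, v) \<in> bordered_kern I 0 u B"
      then show "v(p := 0) \<in> kern (I - {p}) B"
        using t0[OF tv] by (auto simp: bordered_kern_def kern_def vecs_def I B0 upd)
    qed
    show "(\<lambda>v. (0, v(p := - (\<Sum>k\<in>I - {p}. u k * v k) / u p))) ` kern (I - {p}) B \<subseteq> bordered_kern I 0 u B"
      using assms(2,3) by (auto simp: bordered_kern_def kern_def vecs_def I B0 upd)
  qed
  then show ?thesis by (rule bij_betw_same_card)
qed


lemma sum_symfuns_shift:
  fixes f :: "(nat \<Rightarrow> nat \<Rightarrow> 'a::field) \<Rightarrow> complex"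
  assumes "D \<in> symfuns I"
  shows "(\<Sum>B\<in>symfuns I. f (\<lambda>i k. B i k + D i k)) = (\<Sum>B\<in>symfuns I. f B)"
  by (rule sum.reindex_bij_witness[of _ "\<lambda>B i k. B i k - D i k" "\<lambda>B i k. B i k + D i k"])
    (use assms in \<open>auto simp: symfuns_def\<close>)

lemma rank_two_in_symfuns: "u \<in> vecs I \<Longrightarrow> w \<in> vecs I \<Longrightarrow> (\<lambda>i k. u i * w k + w i * u k :: 'a::field) \<in> symfuns I"
  by (auto simp: symfuns_def vecs_def)

lemma rank_one_in_symfuns: "u \<in> vecs I \<Longrightarrow> (\<lambda>i k. u i * u k * (c::'a::field)) \<in> symfuns I"
  by (auto simp: symfuns_def vecs_def)

text \<open>Every symmetric form can be written uniquely as \<open>B + u w\<^sup>t + w u\<^sup>t\<close> with row \<open>p\<close> of \<open>B\<close> equal to zero.\<close>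

lemma sum_symfuns_clear_row:
  fixes f :: "(nat \<Rightarrow> nat \<Rightarrow> 'a::field) \<Rightarrow> complex"
  assumes two: "(2::'a) \<noteq> 0" and p: "p \<in> I" and u: "u \<in> vecs I" "u p \<noteq> 0"
  shows "(\<Sum>B\<in>symfuns I. f B) = (\<Sum>w\<in>vecs I. \<Sum>B\<in>symfuns (I - {p}). f (\<lambda>i k. B i k + u i * w k + w i * u k))"
proof -
  \<comment> \<open>The equation \<open>u p * w k + w p * u k = B p k\<close> at
    \<open>k = p\<close> gives \<open>w p = B p p / (2 * u p)\<close>; inserting this determines the
    other entries of \<open>w\<close>.\<close>
  define W where "W B = (\<lambda>k. (B p k - B p p / (2 * u p) * u k) / u p)" for B :: "nat \<Rightarrow> nat \<Rightarrow> 'a"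
  have Wp: "2 * (u p * W B p) = B p p" for B
    using two u(2) by (simp add: W_def field_simps)
  have Wk: "u p * W B k + W B p * u k = B p k" for B k
  proof -
    have "W B p = B p p / (2 * u p)" using two u(2) by (simp add: W_def field_simps)
    then show ?thesis using u(2) by (simp add: W_def)
  qed
  have WV: "W B \<in> vecs I" if "B \<in> symfuns I" for B
    using that u(1) by (auto simp: W_def vecs_def symfuns_def)
  have uniq: "W (\<lambda>i k. B i k + u i * w k + w i * u k) = w" if "B \<in> symfuns (I - {p})" for B w
  proof
    fix k
    have "B p k = 0" "B p p = 0" using that by (auto simp: symfuns_def)
    then show "W (\<lambda>i k. B i k + u i * w k + w i * u k) k = w k"
      using two u(2) by (simp add: W_def field_simps)
  qed
  have "(\<Sum>B\<in>symfuns I. f B) = (\<Sum>(w, B)\<in>vecs I \<times> symfuns (I - {p}). f (\<lambda>i k. B i k + u i * w k + w i * u k))"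
  proof (rule sum.reindex_bij_witness[of _ "\<lambda>(w, B). (\<lambda>i k. B i k + u i * w k + w i * u k)"
        "\<lambda>B. (W B, \<lambda>i k. B i k - u i * W B k - W B i * u k)"])
    fix B :: "nat \<Rightarrow> nat \<Rightarrow> 'a" assume B: "B \<in> symfuns I"
    have sym: "B i k = B k i" for i k using B by (auto simp: symfuns_def)
    show "(W B, \<lambda>i k. B i k - u i * W B k - W B i * u k) \<in> vecs I \<times> symfuns (I - {p})"
    proof (intro SigmaI WV[OF B])
      have "B i k - u i * W B k - W B i * u k = 0" if "i \<notin> I - {p}" for i k
      proof (cases "i = p")
        case True
        then show ?thesis using Wk[of B k] by (simp add: algebra_simps)
      next
        case False
        then show ?thesis using that B u(1) WV[OF B] by (auto simp: symfuns_def vecs_def)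
      qed
      moreover have "B i k - u i * W B k - W B i * u k = B k i - u k * W B i - W B k * u i" for i k
        using sym[of i k] by (simp add: algebra_simps)
      ultimately show "(\<lambda>i k. B i k - u i * W B k - W B i * u k) \<in> symfuns (I - {p})"
        unfolding symfuns_def by blast
    qed
  next
    fix b :: "(nat \<Rightarrow> 'a) \<times> (nat \<Rightarrow> nat \<Rightarrow> 'a)" assume b: "b \<in> vecs I \<times> symfuns (I - {p})"
    then obtain w B where wB: "b = (w, B)" "w \<in> vecs I" "B \<in> symfuns (I - {p})" by auto
    show "(W (case b of (w, B) \<Rightarrow> \<lambda>i k. B i k + u i * w k + w i * u k),
      \<lambda>i k. (case b of (w, B) \<Rightarrow> \<lambda>i k. B i k + u i * w k + w i * u k) i k -
         u i * W (case b of (w, B) \<Rightarrow> \<lambda>i k. B i k + u i * w k + w i * u k) k -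
         W (case b of (w, B) \<Rightarrow> \<lambda>i k. B i k + u i * w k + w i * u k) i * u k) = b"
      unfolding wB(1) by (simp add: uniq[OF wB(3)])
    show "(case b of (w, B) \<Rightarrow> \<lambda>i k. B i k + u i * w k + w i * u k) \<in> symfuns I"
      using wB(2,3) u(1) unfolding wB(1) by (auto simp: symfuns_def vecs_def)
  qed auto
  then show ?thesis by (simp add: sum.cartesian_product)
qed

section \<open>Summation over the deleted column and corner\<close>

context odd_field_char
begin

text \<open>The weight sees a matrix only through the size of its kernel. It is kept arbitrary
  because bordering may rescale the kernel, so that a rank condition on the large matrix turns into
  another weight on the small one.\<close>

definition weighted_char_sum :: "nat set \<Rightarrow> (nat \<Rightarrow> 'a) \<Rightarrow> (nat \<Rightarrow> complex) \<Rightarrow> complex" where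
  "weighted_char_sum I d w = (\<Sum>B\<in>symfuns I. \<theta> (\<Sum>i\<in>I. d i * B i i) * w (card (kern I B)))"

text \<open>A diagonal quadratic form splits into one-variable Gauss sums; a zero coefficient leaves
  its variable free and contributes \<open>q\<close>.\<close>

lemma sum_theta_quadratic:
  assumes "finite I" "c \<noteq> 0"
  shows "(\<Sum>u\<in>vecs I. \<theta> (\<Sum>i\<in>I. d i * (u i * u i * c))) =
    q ^ card {i\<in>I. d i = 0} * (gauss * qchar c) ^ card {i\<in>I. d i \<noteq> 0} * (\<Prod>i\<in>{i\<in>I. d i \<noteq> 0}. qchar (d i))"
  using assms(1)
proof (induction I)
  case (insert j I)
  have "(\<Sum>u\<in>vecs (insert j I). \<theta> (\<Sum>i\<in>insert j I. d i * (u i * u i * c))) =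
    (\<Sum>x\<in>UNIV. \<Sum>u\<in>vecs I. \<theta> (d j * (x * x * c)) * \<theta> (\<Sum>i\<in>I. d i * (u i * u i * c)))"
  proof (subst sum_vecs_insert[OF insert.hyps(2)], intro sum.cong refl)
    fix x and u :: "nat \<Rightarrow> 'a"
    have "(\<Sum>i\<in>I. d i * ((u(j := x)) i * (u(j := x)) i * c)) = (\<Sum>i\<in>I. d i * (u i * u i * c))"
      by (rule sum.cong) (use insert.hyps(2) in auto)
    then show "\<theta> (\<Sum>i\<in>insert j I. d i * ((u(j := x)) i * (u(j := x)) i * c)) = \<theta> (d j * (x * x * c)) * \<theta> (\<Sum>i\<in>I. d i * (u i * u i * c))"
      using insert.hyps by (simp add: theta_add)
  qed
  also have "\<dots> = (\<Sum>x\<in>UNIV. \<theta> (d j * (x * x * c))) * (\<Sum>u\<in>vecs I. \<theta> (\<Sum>i\<in>I. d i * (u i * u i * c)))"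
    by (simp add: sum_product)
  also have "(\<Sum>x\<in>UNIV. \<theta> (d j * (x * x * c))) = (\<Sum>x\<in>UNIV. \<theta> ((d j * c) * x\<^sup>2))"
    by (simp add: power2_eq_square mult_ac)
  also have "\<dots> = (if d j = 0 then q else qchar (d j) * (gauss * qchar c))"
    unfolding sum_theta_square using assms(2) by (simp add: qchar_mult[OF odd_card])
  finally show ?case
  proof -
    have Collect: "{i\<in>insert j I. P i} = (if P j then insert j {i\<in>I. P i} else {i\<in>I. P i})" for P by auto
    assume "(\<Sum>u\<in>vecs (insert j I). \<theta> (\<Sum>i\<in>insert j I. d i * (u i * u i * c))) =
      (if d j = 0 then q else qchar (d j) * (gauss * qchar c)) * (\<Sum>u\<in>vecs I. \<theta> (\<Sum>i\<in>I. d i * (u i * u i * c)))"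
    then show ?thesis unfolding insert.IH Collect using insert.hyps by (simp add: mult_ac)
  qed
qed simp

text \<open>As \<open>d i * u i = 0\<close> throughout, adding \<open>u w^t + w u^t\<close> to
  \<open>B\<close> changes neither the trace nor the size of the bordered kernel. In the
  decomposition of \<open>sum_symfuns_clear_row\<close> the vector \<open>w\<close> is therefore
  free, which accounts for \<open>q ^ card I\<close>.\<close>

lemma sum_isotropic_column:
  assumes "finite I" "u \<in> vecs I" "p \<in> I" "u p \<noteq> 0" "\<And>i. i \<in> I \<Longrightarrow> d i * u i = 0"
  shows "(\<Sum>B\<in>symfuns I. \<theta> (\<Sum>i\<in>I. d i * B i i) * w (card (bordered_kern I 0 u B))) = q ^ card I * weighted_char_sum (I - {p}) d w"
proof -
  have dp: "d p = 0" using assms(3-5) by (metis mult_eq_0_iff)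
  have "(\<Sum>B\<in>symfuns I. \<theta> (\<Sum>i\<in>I. d i * B i i) * w (card (bordered_kern I 0 u B))) =
    (\<Sum>y\<in>(vecs I :: (nat \<Rightarrow> 'a) set). \<Sum>B\<in>symfuns (I - {p}). \<theta> (\<Sum>i\<in>I - {p}. d i * B i i) * w (card (kern (I - {p}) B)))"
  proof (rule trans[OF sum_symfuns_clear_row[OF two_neq_0 assms(3,2,4)]], intro sum.cong refl)
    fix y and B :: "nat \<Rightarrow> nat \<Rightarrow> 'a" assume B: "B \<in> symfuns (I - {p})"
    have 1: "(\<Sum>i\<in>I. d i * (B i i + u i * y i + y i * u i)) = (\<Sum>i\<in>I. d i * B i i)"
    proof (rule sum.cong)
      fix i assume "i \<in> I"
      then have "d i * u i = 0" by (rule assms(5))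
      then show "d i * (B i i + u i * y i + y i * u i) = d i * B i i" by auto
    qed simp
    have 2: "(\<Sum>i\<in>I. d i * B i i) = (\<Sum>i\<in>I - {p}. d i * B i i)"
      using assms(1,3) dp by (simp add: sum.remove[of I p])
    show "\<theta> (\<Sum>i\<in>I. d i * (B i i + u i * y i + y i * u i)) * w (card (bordered_kern I 0 u (\<lambda>i k. B i k + u i * y k + y i * u k)))
      = \<theta> (\<Sum>i\<in>I - {p}. d i * B i i) * w (card (kern (I - {p}) B))"
      unfolding 1 2 card_bordered_kern_translate card_bordered_kern_delete[where u = u, OF assms(1,3,4) B] ..
  qed
  then show ?thesis by (simp add: weighted_char_sum_def card_vecs[OF assms(1)] q)
qed

text \<open>Translating \<open>B\<close> by \<open>u y^t + y u^t\<close> preserves the bordered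
  kernel size but shifts the trace by \<open>s\<close>, so the sum equals \<open>\<theta> s\<close>
  times itself.\<close>

lemma sum_anisotropic_column:
  assumes "finite I" "u \<in> vecs I" "p \<in> I" "d p * u p \<noteq> 0"
  shows "(\<Sum>B\<in>symfuns I. \<theta> (\<Sum>i\<in>I. d i * B i i) * w (card (bordered_kern I 0 u B))) = 0" (is "?T = 0")
proof -
  obtain s where s: "\<theta> s \<noteq> 1" using nontriv by blast
  \<comment> \<open>The trace shifts by \<open>2 * (d p * u p) * y p\<close>; this entry makes the
    shift equal to \<open>s\<close>.\<close>
  define y where "y = (\<lambda>i. if i = p then s / (2 * (d p * u p)) else 0)"
  have y: "y \<in> vecs I" using assms(3) by (auto simp: y_def vecs_def)
  have tr: "(\<Sum>i\<in>I. d i * (B i i + (u i * y i + y i * u i))) = (\<Sum>i\<in>I. d i * B i i) + s" for B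
  proof -
    have "(\<Sum>i\<in>I. d i * (B i i + (u i * y i + y i * u i))) = (\<Sum>i\<in>I. d i * B i i) + (\<Sum>i\<in>I. if i = p then 2 * (d p * u p) * y p else 0)"
      unfolding sum.distrib[symmetric] by (rule sum.cong) (auto simp: y_def algebra_simps)
    also have "(\<Sum>i\<in>I. if i = p then 2 * (d p * u p) * y p else 0) = 2 * (d p * u p) * y p"
      using assms(1,3) by simp
    also have "\<dots> = s" using assms(4) two_neq_0 by (simp add: y_def)
    finally show ?thesis .
  qed
  have "?T = (\<Sum>B\<in>symfuns I. \<theta> (\<Sum>i\<in>I. d i * (B i i + (u i * y i + y i * u i))) * w (card (bordered_kern I 0 u (\<lambda>i k. B i k + (u i * y k + y i * u k)))))"
    by (rule sum_symfuns_shift[OF rank_two_in_symfuns[OF assms(2) y], symmetric])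
  also have "\<dots> = \<theta> s * ?T"
    unfolding tr theta_add unfolding add.assoc[symmetric] card_bordered_kern_translate by (simp add: sum_distrib_left mult_ac)
  finally show ?thesis using s by simp
qed


text \<open>Summing over the last row and column \<open>(u, c)\<close> of a bordered matrix. If \<open>c \<noteq> 0\<close>, then the
  Schur complement reduces the rank by one; if \<open>c = 0\<close> and \<open>u \<noteq> 0\<close>, then \<open>u\<close> cancels row and
  column \<open>p\<close> and the rank drops by two.\<close>

lemma weighted_char_sum_insert:
  assumes I: "finite I" "j \<notin> I"
    and H: "\<And>p. p \<in> I \<Longrightarrow> d p = 0 \<Longrightarrow> weighted_char_sum (I - {p}) d w = H"
  shows "weighted_char_sum (insert j I) d w = weighted_char_sum I d (\<lambda>k. w (CARD('a) * k))
    + (q ^ card {i\<in>I. d i = 0} - 1) * q ^ card I * H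
    + (\<Sum>c\<in>UNIV - {0}. \<theta> (d j * c) * (\<Sum>u\<in>vecs I. \<theta> (\<Sum>i\<in>I. d i * (u i * u i * (1 / c))))) * weighted_char_sum I d w"
proof -
  define T where "T c u = (\<Sum>B\<in>symfuns I. \<theta> (\<Sum>i\<in>I. d i * B i i) * w (card (bordered_kern I c u B)))" for c and u :: "nat \<Rightarrow> 'a"
  have tr: "(\<Sum>i\<in>insert j I. d i * border j c u B i i) = d j * c + (\<Sum>i\<in>I. d i * B i i)" for c u B
  proof -
    have "(\<Sum>i\<in>I. d i * border j c u B i i) = (\<Sum>i\<in>I. d i * B i i)"
      by (rule sum.cong) (use I(2) in \<open>auto simp: border_def\<close>)
    then show ?thesis using I by (simp add: border_def)
  qed
  have "weighted_char_sum (insert j I) d w = (\<Sum>c\<in>UNIV. \<Sum>u\<in>vecs I. \<theta> (d j * c) * T c u)"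
    unfolding weighted_char_sum_def sum_symfuns_insert[OF I(2)] card_kern_border[OF I] tr theta_add T_def
    by (simp add: sum_distrib_left mult.assoc)
  also have "\<dots> = (\<Sum>u\<in>vecs I. T 0 u) + (\<Sum>c\<in>UNIV - {0}. \<Sum>u\<in>vecs I. \<theta> (d j * c) * T c u)"
    by (subst sum.remove[of UNIV 0]) simp_all
  also have "(\<Sum>c\<in>UNIV - {0}. \<Sum>u\<in>vecs I. \<theta> (d j * c) * T c u) =
    (\<Sum>c\<in>UNIV - {0}. \<theta> (d j * c) * (\<Sum>u\<in>vecs I. \<theta> (\<Sum>i\<in>I. d i * (u i * u i * (1 / c))))) * weighted_char_sum I d w"
  proof -
    have "T c u = \<theta> (\<Sum>i\<in>I. d i * (u i * u i * (1 / c))) * weighted_char_sum I d w" if c: "c \<noteq> 0" and u: "u \<in> vecs I" for c u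
    proof -
      have "T c u = (\<Sum>B\<in>symfuns I. \<theta> (\<Sum>i\<in>I. d i * (B i i + u i * u i * (1 / c))) * w (card (bordered_kern I c u (\<lambda>i k. B i k + u i * u k * (1 / c)))))"
        unfolding T_def by (rule sum_symfuns_shift[OF rank_one_in_symfuns[OF u], symmetric])
      also have "\<dots> = (\<Sum>B\<in>symfuns I. \<theta> (\<Sum>i\<in>I. d i * (u i * u i * (1 / c))) * (\<theta> (\<Sum>i\<in>I. d i * B i i) * w (card (kern I B))))"
        unfolding card_bordered_kern_pivot[OF c] by (simp add: distrib_left sum.distrib theta_add mult_ac)
      finally show ?thesis by (simp add: weighted_char_sum_def sum_distrib_left)
    qed
    then show ?thesis by (simp add: sum_distrib_right sum_distrib_left mult.assoc)
  qed
  \<comment> \<open>With corner 0 only columns supported on the zeros of \<open>d\<close>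
    contribute, by \<open>sum_anisotropic_column\<close>. The zero column multiplies every kernel
    size by \<open>CARD('a)\<close>; each other such column gives
    \<open>q ^ card I * H\<close>.\<close>
  also have "(\<Sum>u\<in>vecs I. T 0 u) = weighted_char_sum I d (\<lambda>k. w (CARD('a) * k)) + (q ^ card {i\<in>I. d i = 0} - 1) * q ^ card I * H"
  proof -
    let ?R = "vecs {i\<in>I. d i = 0} :: (nat \<Rightarrow> 'a) set"
    have z: "(\<lambda>_. 0) \<in> ?R" "?R \<subseteq> vecs I" by (auto simp: vecs_def)
    have fin: "finite (vecs I :: (nat \<Rightarrow> 'a) set)" "finite ?R" using I(1) by (auto intro: finite_vecs)
    have "(\<Sum>u\<in>vecs I. T 0 u) = (\<Sum>u\<in>?R. T 0 u)"
    proof (rule sum.mono_neutral_right[OF fin(1) z(2)], safe)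
      fix u :: "nat \<Rightarrow> 'a" assume u: "u \<in> vecs I" "u \<notin> ?R"
      then obtain p where "p \<in> I" "d p * u p \<noteq> 0" by (auto simp: vecs_def)
      then show "T 0 u = 0" unfolding T_def by (rule sum_anisotropic_column[OF I(1) u(1)])
    qed
    also have "\<dots> = T 0 (\<lambda>_. 0) + (\<Sum>u\<in>?R - {\<lambda>_. 0}. T 0 u)"
      by (rule sum.remove[OF fin(2) z(1)])
    also have "(\<Sum>u\<in>?R - {\<lambda>_. 0}. T 0 u) = (\<Sum>u\<in>?R - {\<lambda>_. 0}. q ^ card I * H)"
    proof (rule sum.cong[OF refl])
      fix u assume u: "u \<in> ?R - {\<lambda>_. 0}"
      then obtain p where "u p \<noteq> 0" by fastforce
      moreover from this have "p \<in> I" "d p = 0" using u by (auto simp: vecs_def)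
      moreover have "d i * u i = 0" if "i \<in> I" for i using u by (auto simp: vecs_def)
      moreover have "u \<in> vecs I" using u z(2) by auto
      ultimately show "T 0 u = q ^ card I * H"
        unfolding T_def using sum_isotropic_column[OF I(1), of u p d w] H[of p] by simp
    qed
    also have "\<dots> = (q ^ card {i\<in>I. d i = 0} - 1) * q ^ card I * H"
    proof -
      have "card ?R = CARD('a) ^ card {i\<in>I. d i = 0}" using I(1) by (intro card_vecs) auto
      moreover have "card ?R = Suc (card (?R - {\<lambda>_. 0}))" by (rule card.remove[OF fin(2) z(1)])
      ultimately have "(of_nat (Suc (card (?R - {\<lambda>_. 0}))) :: complex) = q ^ card {i\<in>I. d i = 0}" by (simp add: q)
      then have "of_nat (card (?R - {\<lambda>_. 0})) = q ^ card {i\<in>I. d i = 0} - 1" by (simp add: algebra_simps)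
      then show ?thesis by (simp add: mult.assoc)
    qed
    also have "T 0 (\<lambda>_. 0) = weighted_char_sum I d (\<lambda>k. w (CARD('a) * k))"
      unfolding T_def card_bordered_kern_zero weighted_char_sum_def ..
    finally show ?thesis .
  qed
  finally show ?thesis .
qed

end

lemma card_filter_add:
  assumes "finite I"
  shows "card I = card {i\<in>I. P i} + card {i\<in>I. \<not> P i}"
proof -
  have "I = {i\<in>I. P i} \<union> {i\<in>I. \<not> P i}" by auto
  moreover have "card ({i\<in>I. P i} \<union> {i\<in>I. \<not> P i}) = card {i\<in>I. P i} + card {i\<in>I. \<not> P i}"
    by (rule card_Un_disjoint) (use assms in auto)
  ultimately show ?thesis by simp
qed

section \<open>The recursion for sums over matrices of fixed rank\<close>

context odd_field_char
begin

lemma card_ge_2: "CARD('a) \<ge> 2"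
  by (rule card_field_ge_2)

lemma q_nz: "q \<noteq> 0"
  by (simp add: q)

lemma q_pow: "k > 0 \<Longrightarrow> q ^ k \<noteq> 1"
  using card_ge_2 by (simp add: q flip: of_nat_power)

text \<open>Rank \<open>r\<close> is expressed by \<open>card kernel * q\<^sup>r = q\<^sup>n\<close>. The index \<open>r\<close> is an integer, so that the shifts
  to \<open>r - 1\<close> and \<open>r - 2\<close> in the recursion are not truncated.\<close>

definition rank_char_sum :: "nat set \<Rightarrow> (nat \<Rightarrow> 'a) \<Rightarrow> int \<Rightarrow> complex" where
  "rank_char_sum I d r = weighted_char_sum I d (\<lambda>k. if of_nat k * q powi r = q ^ card I then 1 else 0)"

text \<open>On non-zero elements \<open>qchar c ^ s\<close> depends only on the parity of
  \<open>s\<close>. The odd case vanishes at \<open>t = 0\<close>, since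
  \<open>qchar 0 = 0\<close>.\<close>

lemma sum_qchar_power:
  "(\<Sum>c\<in>UNIV - {0}. \<theta> (t * c) * qchar c ^ s) =
    (if odd s then qchar t * gauss else if t = 0 then q - 1 else - 1)"
proof -
  have "qchar c ^ s = (if odd s then qchar c else 1)" if "c \<noteq> 0" for c :: 'a
    using that by (auto simp: qchar_def)
  then have "(\<Sum>c\<in>UNIV - {0}. \<theta> (t * c) * qchar c ^ s) = (\<Sum>c\<in>UNIV - {0}. \<theta> (t * c) * (if odd s then qchar c else 1))"
    by simp
  then show ?thesis
    using sum_qchar_theta_nonzero[of t] sum_theta_nonzero[of t] by (cases "odd s") (simp_all add: mult.commute)
qed

text \<open>The terms stem from the zero column, the non-zero columns with corner 0, and the
  non-zero corners; the rank left over is \<open>r\<close>, \<open>r - 2\<close> and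
  \<open>r - 1\<close>. A common value \<open>H\<close> for all zero positions \<open>p\<close> is
  assumed. In the uses below either there is no such position or the sum depends on cardinalities
  only.\<close>

lemma rank_char_sum_insert:
  assumes I: "finite I" "j \<notin> I"
    and H: "\<And>p. p \<in> I \<Longrightarrow> d p = 0 \<Longrightarrow> rank_char_sum (I - {p}) d (r - 2) = H"
    and m: "card {i\<in>I. d i = 0} = m" and s: "card {i\<in>I. d i \<noteq> 0} = s"
  shows "rank_char_sum (insert j I) d r = rank_char_sum I d r + (q ^ m - 1) * q ^ card I * H
    + q ^ m * gauss ^ s * (\<Prod>i\<in>{i\<in>I. d i \<noteq> 0}. qchar (d i)) *
      (if odd s then qchar (d j) * gauss else if d j = 0 then q - 1 else - 1) * rank_char_sum I d (r - 1)"
proof -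
  let ?w = "\<lambda>k. if of_nat k * q powi r = q ^ card (insert j I) then 1 else 0 :: complex"
  let ?eta = "\<Prod>i\<in>{i\<in>I. d i \<noteq> 0}. qchar (d i)"
  have w1: "?w (CARD('a) * k) = (if of_nat k * q powi r = q ^ card I then 1 else 0)" for k
    using I q_nz by (simp add: q)
  have w2: "?w = (\<lambda>k. if of_nat k * q powi (r - 1) = q ^ card I then 1 else 0)"
  proof
    fix k
    have "q powi r = q powi (r - 1) * q" using power_int_add_1[of q "r - 1"] q_nz by simp
    then show "?w k = (if of_nat k * q powi (r - 1) = q ^ card I then 1 else 0)"
      using I q_nz by simp
  qed
  have w3: "weighted_char_sum (I - {p}) d ?w = H" if p: "p \<in> I" "d p = 0" for p
  proof -
    have c: "card I = Suc (card (I - {p}))" using I(1) p(1) by (rule card.remove)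
    have "?w = (\<lambda>k. if of_nat k * q powi (r - 2) = q ^ card (I - {p}) then 1 else 0)"
    proof
      fix k
      have "q powi r = q powi (r - 2) * q * q"
        using power_int_add_1[of q "r - 1"] power_int_add_1[of q "r - 2"] q_nz by simp
      then show "?w k = (if of_nat k * q powi (r - 2) = q ^ card (I - {p}) then 1 else 0)"
        using I q_nz c by simp
    qed
    then show ?thesis using H[OF p] unfolding rank_char_sum_def by simp
  qed
  have G: "(\<Sum>c\<in>UNIV - {0}. \<theta> (d j * c) * (\<Sum>u\<in>vecs I. \<theta> (\<Sum>i\<in>I. d i * (u i * u i * (1 / c))))) =
    q ^ m * gauss ^ s * ?eta * (if odd s then qchar (d j) * gauss else if d j = 0 then q - 1 else - 1)"
  proof -
    have "(\<Sum>c\<in>UNIV - {0}. \<theta> (d j * c) * (\<Sum>u\<in>vecs I. \<theta> (\<Sum>i\<in>I. d i * (u i * u i * (1 / c))))) =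
      (\<Sum>c\<in>UNIV - {0}. q ^ m * gauss ^ s * ?eta * (\<theta> (d j * c) * qchar c ^ s))"
    proof (rule sum.cong[OF refl])
      fix c :: 'a assume "c \<in> UNIV - {0}"
      then have c: "1 / c \<noteq> 0" by simp
      have "qchar (1 / c) = qchar c" using qchar_inverse[of c] by (simp add: divide_inverse)
      then show "\<theta> (d j * c) * (\<Sum>u\<in>vecs I. \<theta> (\<Sum>i\<in>I. d i * (u i * u i * (1 / c)))) =
        q ^ m * gauss ^ s * ?eta * (\<theta> (d j * c) * qchar c ^ s)"
        unfolding sum_theta_quadratic[OF I(1) c] m s by (simp add: power_mult_distrib mult_ac)
    qed
    then show ?thesis unfolding sum_distrib_left[symmetric] sum_qchar_power .
  qed
  have "rank_char_sum (insert j I) d r = weighted_char_sum I d (\<lambda>k. ?w (CARD('a) * k)) + (q ^ m - 1) * q ^ card I * H +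
    q ^ m * gauss ^ s * ?eta * (if odd s then qchar (d j) * gauss else if d j = 0 then q - 1 else - 1) * weighted_char_sum I d ?w"
    unfolding rank_char_sum_def using weighted_char_sum_insert[OF I, of d ?w H, OF w3] unfolding G m by simp
  also have "weighted_char_sum I d (\<lambda>k. ?w (CARD('a) * k)) = rank_char_sum I d r"
    unfolding rank_char_sum_def w1 ..
  also have "weighted_char_sum I d ?w = rank_char_sum I d (r - 1)"
    unfolding rank_char_sum_def w2 ..
  finally show ?thesis .
qed

lemma rank_char_sum_empty: "rank_char_sum {} d r = (if r = 0 then 1 else 0)"
proof -
  have 1: "symfuns {} = {\<lambda>_ _. 0 :: 'a}" by (auto simp: symfuns_def fun_eq_iff)
  have 2: "kern {} (\<lambda>_ _. 0 :: 'a) = {\<lambda>_. 0}" by (auto simp: kern_def)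
  have "q powi r = 1 \<longleftrightarrow> r = 0"
  proof (cases "r \<ge> 0")
    case True
    then show ?thesis using q_pow[of "nat r"] by (cases "r = 0") (auto simp: power_int_def)
  next
    case False
    then have "q powi (- r) \<noteq> 1" using q_pow[of "nat (- r)"] by (simp add: power_int_def)
    then show ?thesis using False by (simp add: power_int_minus)
  qed
  then show ?thesis by (simp add: rank_char_sum_def weighted_char_sum_def 1 2)
qed

lemma gauss_power_even: "gauss ^ (2 * k) = (qchar (- 1 :: 'a) * q) ^ k"
  by (simp add: power_mult gauss_square)

text \<open>Induction on the size: a zero entry is deleted if there is one, otherwise two non-zero
  entries. The closed form follows suit by \<open>odd_rank_sum_rec\<close> and
  \<open>odd_rank_sum_diag\<close>.\<close>

lemma rank_char_sum_odd:
  assumes "finite I" "card {i\<in>I. d i \<noteq> 0} = 2 * y + 1"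
  shows "rank_char_sum I d r = odd_rank_sum q (card I) y r"
  using assms
proof (induction "card I" arbitrary: I y r rule: less_induct)
  case (less I y r)
  note fin = less.prems(1) and cd = less.prems(2)
  show ?case
  proof (cases "\<exists>j\<in>I. d j = 0")
    case True
    then obtain j where j: "j \<in> I" "d j = 0" by blast
    define J where "J = I - {j}"
    have J: "finite J" "j \<notin> J" "I = insert j J" using fin j by (auto simp: J_def)
    have cI: "card I = Suc (card J)" using J by simp
    have nzJ: "{i\<in>J. d i \<noteq> 0} = {i\<in>I. d i \<noteq> 0}" using j by (auto simp: J_def)
    have m: "card J = card {i\<in>J. d i = 0} + (2 * y + 1)"
      using card_filter_add[OF J(1), of "\<lambda>i. d i = 0"] unfolding nzJ cd .
    have H: "rank_char_sum (J - {p}) d (r - 2) = odd_rank_sum q (card J - 1) y (r - 2)" if p: "p \<in> J" "d p = 0" for p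
    proof -
      have "{i\<in>J - {p}. d i \<noteq> 0} = {i\<in>I. d i \<noteq> 0}" using nzJ p by auto
      then show ?thesis using less.hyps[of "J - {p}" y "r - 2"] J cd p cI by (simp add: card_Diff_singleton less_SucI)
    qed
    \<comment> \<open>The term at \<open>r - 1\<close> carries the factor
      \<open>qchar (d j) = qchar 0\<close> and drops out.\<close>
    have "rank_char_sum I d r = rank_char_sum J d r + (q ^ card {i\<in>J. d i = 0} - 1) * q ^ card J * odd_rank_sum q (card J - 1) y (r - 2)"
      unfolding J(3) using rank_char_sum_insert[OF J(1,2) H refl refl] j(2) unfolding nzJ cd by simp
    also have "rank_char_sum J d r = odd_rank_sum q (card J) y r"
      using less.hyps[of J y r] J cd nzJ cI by simp
    also have "odd_rank_sum q (card J) y r + (q ^ card {i\<in>J. d i = 0} - 1) * q ^ card J * odd_rank_sum q (card J - 1) y (r - 2) = odd_rank_sum q (card I) y r"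
      using odd_rank_sum_rec[OF q_nz q_pow, of y "card I" r] m by (simp add: cI mult.commute)
    finally show ?thesis .
  next
    case False
    then have nz: "{i\<in>I. d i \<noteq> 0} = I" by auto
    then have cI: "card I = 2 * y + 1" using cd by simp
    show ?thesis
    proof (cases y)
      case 0
      then obtain j where j: "I = {j}" using cI by (metis add_0 card_1_singletonE mult_0_right)
      then have "d j \<noteq> 0" using False by simp
      then have "rank_char_sum I d r = rank_char_sum {} d r - rank_char_sum {} d (r - 1)"
        unfolding j using rank_char_sum_insert[of "{}" j d r 0 0 0] by simp
      also have "\<dots> = odd_rank_sum q 1 0 r" using odd_rank_sum_1[OF q_nz q_pow, of r] unfolding rank_char_sum_empty by simp
      finally show ?thesis by (simp add: cI 0)
    next
      case (Suc z)
      then have "card I = Suc (Suc (2 * z + 1))" using cI by simp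
      then obtain j K where jK: "I = insert j K" "j \<notin> K" "card K = Suc (2 * z + 1)" "finite K"
        unfolding card_Suc_eq_finite[of I] by blast
      then obtain k J where kJ: "K = insert k J" "k \<notin> J" "card J = 2 * z + 1" "finite J"
        unfolding card_Suc_eq_finite[of K] by blast
      have nzK: "{i\<in>K. d i \<noteq> 0} = K" "{i\<in>K. d i = 0} = {}" and nzJ: "{i\<in>J. d i \<noteq> 0} = J" "{i\<in>J. d i = 0} = {}"
        using False jK kJ by auto
      have dj: "d j \<noteq> 0" using False jK by auto
      \<comment> \<open>Deleting \<open>j\<close> leaves the even set \<open>K\<close> and has
        coefficient \<open>- h\<close>; deleting \<open>k\<close> from \<open>K\<close> has
        coefficient \<open>h\<close>. The product of signs in \<open>h\<close> squares to 1, so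
        \<open>h * h\<close> no longer sees the form.\<close>
      define h where "h = gauss ^ (2 * z + 2) * (\<Prod>i\<in>K. qchar (d i))"
      have SK: "rank_char_sum K d r' = rank_char_sum J d r' + h * rank_char_sum J d (r' - 1)" for r'
        unfolding kJ(1) using rank_char_sum_insert[of J k d r' _ 0 "2 * z + 1"] kJ nzJ
        by (simp add: h_def mult_ac)
      have SI: "rank_char_sum I d r = rank_char_sum K d r - h * rank_char_sum K d (r - 1)"
        unfolding jK(1) using rank_char_sum_insert[of K j d r _ 0 "2 * z + 2"] jK nzK dj
        by (simp add: h_def mult_ac)
      have "h\<^sup>2 = (gauss\<^sup>2) ^ (2 * z + 2) * (\<Prod>i\<in>K. qchar (d i) * qchar (d i))"
        by (simp add: h_def power2_eq_square prod.distrib power_mult_distrib mult_ac)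
      also have "(\<Prod>i\<in>K. qchar (d i) * qchar (d i)) = 1"
        using nzK by (intro prod.neutral) (auto intro: qchar_sq)
      also have "(gauss\<^sup>2) ^ (2 * z + 2) = q ^ (2 * z + 2)"
      proof -
        have "(qchar (- 1 :: 'a))\<^sup>2 = 1" using qchar_sq[of "- 1 :: 'a"] by (simp add: power2_eq_square)
        then have "qchar (- 1 :: 'a) ^ (2 * (z + 1)) = 1" by (simp only: power_mult power_one)
        then show ?thesis by (simp add: gauss_square power_mult_distrib)
      qed
      finally have h2: "h * h = q ^ (2 * z + 2)" by (simp add: power2_eq_square)
      have SJ: "rank_char_sum J d r' = odd_rank_sum q (2 * z + 1) z r'" for r'
        using less.hyps[of J z r'] kJ nzJ jK by simp
      have "rank_char_sum I d r = rank_char_sum J d r - h * h * rank_char_sum J d (r - 2)"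
        unfolding SI SK by (simp add: algebra_simps)
      also have "\<dots> = odd_rank_sum q (2 * z + 3) (Suc z) r"
        using odd_rank_sum_diag[OF q_nz q_pow, of z r] unfolding h2 SJ by simp
      finally show ?thesis using cI Suc by (simp add: numeral_3_eq_3)
    qed
  qed
qed

lemma rank_char_sum_cong: "(\<And>i. i \<in> I \<Longrightarrow> d i = e i) \<Longrightarrow> rank_char_sum I d r = rank_char_sum I e r"
  unfolding rank_char_sum_def weighted_char_sum_def by (auto intro!: sum.cong arg_cong[where f = \<theta>])

text \<open>Both forms agree on \<open>I\<close>, where the rank is odd, so in
  \<open>rank_char_sum_insert\<close> they differ only by the sign of the Gauss term, which is
  \<open>qchar\<close> of the entry at \<open>j\<close>. The exponent
  \<open>card I + 1 - (2 * y + 1) - 1\<close> is the number of zeros of \<open>d\<close> in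
  \<open>I\<close>.\<close>

lemma rank_char_sum_diff:
  assumes I: "finite I" "j \<notin> I" and d: "\<And>i. i \<in> I \<Longrightarrow> d i = 0 \<or> d i = 1" "d j = 1"
    and e: "\<And>i. i \<in> I \<Longrightarrow> e i = d i" "qchar (e j) = - 1"
    and s: "card {i\<in>I. d i \<noteq> 0} = 2 * y + 1"
  shows "rank_char_sum (insert j I) d r - rank_char_sum (insert j I) e r =
    2 * q ^ (card I + 1 - (2 * y + 1) - 1) * (qchar (- 1 :: 'a) * q) ^ (y + 1) * odd_rank_sum q (card I) y (r - 1)"
proof -
  define m where "m = card {i\<in>I. d i = 0}"
  have m: "card I + 1 - (2 * y + 1) - 1 = m"
    using card_filter_add[OF I(1), of "\<lambda>i. d i = 0"] s by (simp add: m_def)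
  have z: "{i\<in>I. e i = 0} = {i\<in>I. d i = 0}" "{i\<in>I. e i \<noteq> 0} = {i\<in>I. d i \<noteq> 0}" using e(1) by auto
  have H: "rank_char_sum (I - {p}) d (r - 2) = odd_rank_sum q (card I - 1) y (r - 2)" if p: "p \<in> I" "d p = 0" for p
  proof -
    have "{i\<in>I - {p}. d i \<noteq> 0} = {i\<in>I. d i \<noteq> 0}" using p by auto
    then show ?thesis using rank_char_sum_odd[of "I - {p}" d y "r - 2"] I(1) s p by (simp add: card_Diff_singleton)
  qed
  have He: "rank_char_sum (I - {p}) e (r - 2) = odd_rank_sum q (card I - 1) y (r - 2)" if p: "p \<in> I" "e p = 0" for p
    using H[of p] p e(1) rank_char_sum_cong[of "I - {p}" e d "r - 2"] by auto
  have Se: "rank_char_sum I e r' = rank_char_sum I d r'" for r' by (rule rank_char_sum_cong) (use e(1) in auto)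
  have d1: "d i = 1" if "i \<in> I" "d i \<noteq> 0" for i using d(1) that by blast
  have eta: "(\<Prod>i\<in>{i\<in>I. d i \<noteq> 0}. qchar (d i)) = 1" "(\<Prod>i\<in>{i\<in>I. d i \<noteq> 0}. qchar (e i)) = 1"
    by (auto simp: d1 e(1) intro!: prod.neutral)
  have g: "gauss ^ (2 * y + 1) * gauss = (qchar (- 1 :: 'a) * q) ^ (y + 1)"
    using gauss_power_even[of "y + 1"] by (simp add: mult_ac)
  have 1: "rank_char_sum (insert j I) d r = rank_char_sum I d r + (q ^ m - 1) * q ^ card I * odd_rank_sum q (card I - 1) y (r - 2) +
    q ^ m * (gauss ^ (2 * y + 1) * gauss) * rank_char_sum I d (r - 1)"
    using rank_char_sum_insert[OF I H m_def[symmetric] s] unfolding eta d(2) by (simp add: mult_ac)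
  have 2: "rank_char_sum (insert j I) e r = rank_char_sum I d r + (q ^ m - 1) * q ^ card I * odd_rank_sum q (card I - 1) y (r - 2) -
    q ^ m * (gauss ^ (2 * y + 1) * gauss) * rank_char_sum I d (r - 1)"
    using rank_char_sum_insert[OF I He _ s[folded z(2)]] unfolding z eta e(2) Se by (simp add: mult_ac m_def)
  show ?thesis
    unfolding 1 2 m g rank_char_sum_odd[OF I(1) s] by simp
qed

end

subsection \<open>Ranks and kernels\<close>

lemma card_span_lin_indpt:
  fixes B :: "'a::{field,finite} vec set"
  assumes B: "B \<subseteq> carrier_vec n" "finite B"
    and li: "\<not> module.lin_dep class_ring (module_vec TYPE('a) n) B"
  shows "card (LinearCombinations.module.span class_ring (module_vec TYPE('a) n) B) = CARD('a) ^ card B"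
proof -
  interpret vec_space "TYPE('a)" n .
  have sp: "span B = (\<lambda>a. lincomb a B) ` (B \<rightarrow>\<^sub>E UNIV)"
  proof
    show "span B \<subseteq> (\<lambda>a. lincomb a B) ` (B \<rightarrow>\<^sub>E UNIV)"
    proof
      fix v assume "v \<in> span B"
      then obtain a where a: "lincomb a B = v" using finite_in_span[OF B(2)] B(1) by auto
      have "lincomb (restrict a B) B = lincomb a B"
        by (rule eq_vecI) (use B in \<open>auto simp: lincomb_index lincomb_dim intro!: sum.cong\<close>)
      then show "v \<in> (\<lambda>a. lincomb a B) ` (B \<rightarrow>\<^sub>E UNIV)"
        using a by (intro image_eqI[of _ _ "restrict a B"]) auto
    qed
    show "(\<lambda>a. lincomb a B) ` (B \<rightarrow>\<^sub>E UNIV) \<subseteq> span B"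
      using finite_span[OF B(2)] B(1) by auto
  qed
  have "inj_on (\<lambda>a. lincomb a B) (B \<rightarrow>\<^sub>E UNIV)"
  proof (rule inj_onI)
    fix a b assume ab: "a \<in> B \<rightarrow>\<^sub>E UNIV" "b \<in> B \<rightarrow>\<^sub>E UNIV" "lincomb a B = lincomb b B"
    have "lincomb (\<lambda>v. a v - b v) B = 0\<^sub>v n"
    proof (rule eq_vecI)
      fix i assume "i < dim_vec (0\<^sub>v n :: 'a vec)"
      then have i: "i < n" by simp
      have "lincomb (\<lambda>v. a v - b v) B $ i = lincomb a B $ i - lincomb b B $ i"
        unfolding lincomb_index[OF i B(1)] by (simp add: left_diff_distrib sum_subtractf)
      then show "lincomb (\<lambda>v. a v - b v) B $ i = 0\<^sub>v n $ i" using ab(3) i by simp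
    qed (use B lincomb_dim in auto)
    then have "(\<lambda>v. a v - b v) \<in> B \<rightarrow> {0}"
      using not_lindepD[OF li B(2), of "\<lambda>v. a v - b v"] by simp
    then have "a v = b v" if "v \<in> B" for v using that by auto
    then show "a = b" using ab(1,2) by (rule PiE_ext[rotated 2])
  qed
  then show ?thesis unfolding sp by (simp add: card_image card_PiE B(2))
qed

definition vec_fun :: "nat \<Rightarrow> 'a::zero vec \<Rightarrow> nat \<Rightarrow> 'a" where
  "vec_fun n v = (\<lambda>i. if i < n then v $ i else 0)"

definition mat_fun :: "nat \<Rightarrow> 'a::zero mat \<Rightarrow> nat \<Rightarrow> nat \<Rightarrow> 'a" where
  "mat_fun n A = (\<lambda>i j. if i < n \<and> j < n then A $$ (i, j) else 0)"

lemma bij_betw_vec_fun: "bij_betw (vec_fun n) (carrier_vec n) (vecs {..<n})"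
  by (rule bij_betw_byWitness[where f' = "\<lambda>v. vec n v"])
    (auto simp: vec_fun_def vecs_def)

lemma mult_mat_vec_fun:
  assumes "A \<in> carrier_mat n n" "v \<in> carrier_vec n" "i < n"
  shows "(A *\<^sub>v v) $ i = (\<Sum>k<n. mat_fun n A i k * vec_fun n v k)"
  using assms by (auto simp: mult_mat_vec_def scalar_prod_def mat_fun_def vec_fun_def atLeast0LessThan intro!: sum.cong)

lemma card_kernel_vec:
  assumes A: "(A :: 'a::{field,finite} mat) \<in> carrier_mat n n"
  shows "card {v \<in> carrier_vec n. A *\<^sub>v v = 0\<^sub>v n} = card (kern {..<n} (mat_fun n A))"
proof -
  have "bij_betw (vec_fun n) {v \<in> carrier_vec n. A *\<^sub>v v = 0\<^sub>v n} (kern {..<n} (mat_fun n A))"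
  proof (rule bij_betw_subset[OF bij_betw_vec_fun])
    have eq: "A *\<^sub>v v = 0\<^sub>v n \<longleftrightarrow> (\<forall>i<n. (\<Sum>k<n. mat_fun n A i k * vec_fun n v k) = 0)" if "v \<in> carrier_vec n" for v
      using A that mult_mat_vec_fun[OF A that] by (auto simp: vec_eq_iff)
    show "vec_fun n ` {v \<in> carrier_vec n. A *\<^sub>v v = 0\<^sub>v n} = kern {..<n} (mat_fun n A)"
    proof (intro equalityI subsetI)
      fix w assume w: "w \<in> kern {..<n} (mat_fun n A)"
      then obtain v where v: "v \<in> carrier_vec n" "w = vec_fun n v"
        using bij_betw_imp_surj_on[OF bij_betw_vec_fun[of n]] unfolding kern_def by (metis (mono_tags, lifting) image_iff mem_Collect_eq)
      then show "w \<in> vec_fun n ` {v \<in> carrier_vec n. A *\<^sub>v v = 0\<^sub>v n}"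
        using w eq[OF v(1)] unfolding kern_def by auto
    next
      fix w assume "w \<in> vec_fun n ` {v \<in> carrier_vec n. A *\<^sub>v v = 0\<^sub>v n}"
      then show "w \<in> kern {..<n} (mat_fun n A)"
        using eq bij_betw_imp_surj_on[OF bij_betw_vec_fun[of n]] unfolding kern_def by auto
    qed
  qed auto
  then show ?thesis by (rule bij_betw_same_card)
qed

lemma card_carrier_vec: "card (carrier_vec n :: 'a::{field,finite} vec set) = CARD('a) ^ n"
  using bij_betw_same_card[OF bij_betw_vec_fun[of n, where 'a = 'a]] card_vecs[of "{..<n}", where 'a = 'a] by simp

lemma finite_carrier_vec: "finite (carrier_vec n :: 'a::{field,finite} vec set)"
  using bij_betw_finite[OF bij_betw_vec_fun[of n, where 'a = 'a]] finite_vecs[of "{..<n}", where 'a = 'a] by simp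

text \<open>Rank-nullity by counting: the fibres of \<open>A\<close> over its column space are
  translates of the kernel, and a maximal independent set of columns is a basis of the column
  space.\<close>

lemma card_kern_rank:
  assumes A: "(A :: 'a::{field,finite} mat) \<in> carrier_mat n n"
  shows "card (kern {..<n} (mat_fun n A)) * CARD('a) ^ vec_space.rank n A = CARD('a) ^ n"
proof -
  interpret vec_space "TYPE('a)" n .
  let ?C = "set (cols A)"
  have C: "?C \<subseteq> carrier_vec n" using cols_dim A by blast
  have "\<exists>B. finite B \<and> maximal B (\<lambda>T. T \<subseteq> ?C \<and> lin_indpt T) \<and> {} \<subseteq> B"
    by (rule maximal_exists_superset[of ?C]) (auto simp: lin_dep_def)
  then obtain B where B: "finite B" "maximal B (\<lambda>T. T \<subseteq> ?C \<and> lin_indpt T)" by blast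
  have BC: "B \<subseteq> ?C" "lin_indpt B" using B(2) unfolding maximal_def by auto
  have BV: "B \<subseteq> carrier_vec n" using BC C by blast
  have "c \<in> span B" if c: "c \<in> ?C" for c
  proof (rule ccontr)
    assume n: "c \<notin> span B"
    have cV: "c \<in> carrier_vec n" using c C by blast
    have cB: "c \<notin> B" using n BV in_own_span by auto
    have "lin_indpt (insert c B)" using lin_dep_iff_in_span[of B c] BV BC(2) cV cB n by auto
    then have "insert c B = B" using B(2) c BC(1) unfolding maximal_def by (metis insert_subset subset_insertI)
    then show False using cB by auto
  qed
  then have "span ?C = span B"
    using span_subsetI[OF BV, of ?C] span_is_monotone[OF BC(1)] by blast
  then have 1: "card (col_space A) = CARD('a) ^ rank A"
    using card_span_lin_indpt[OF BV B(1) BC(2)] rank_card_indpt[OF A B(2)] unfolding col_space_def by simp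
  let ?K = "{v \<in> carrier_vec n. A *\<^sub>v v = 0\<^sub>v n}"
  have im: "col_space A = (*\<^sub>v) A ` carrier_vec n"
    using A by (subst col_space_eq) auto
  have fib: "card {v \<in> carrier_vec n. A *\<^sub>v v = y} = card ?K" if y: "y \<in> (*\<^sub>v) A ` carrier_vec n" for y
  proof -
    from y obtain w where w: "w \<in> carrier_vec n" "y = A *\<^sub>v w" by auto
    have "bij_betw (\<lambda>v. v + w) ?K {v \<in> carrier_vec n. A *\<^sub>v v = y}"
      by (rule bij_betw_byWitness[where f' = "\<lambda>v. v - w"])
        (use A w in \<open>auto simp: mult_add_distrib_mat_vec mult_minus_distrib_mat_vec\<close>)
    then show ?thesis by (rule bij_betw_same_card[symmetric])
  qed
  have "CARD('a) ^ n = (\<Sum>v\<in>(carrier_vec n :: 'a vec set). 1)" by (simp add: card_carrier_vec)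
  also have "\<dots> = (\<Sum>y\<in>(*\<^sub>v) A ` carrier_vec n. \<Sum>v\<in>{v \<in> carrier_vec n. A *\<^sub>v v = y}. 1)"
    by (rule sum.group[symmetric]) (auto simp: finite_carrier_vec)
  also have "\<dots> = card (col_space A) * card ?K"
    unfolding im by (simp add: fib)
  finally show ?thesis unfolding 1 card_kernel_vec[OF A] by (simp add: mult.commute)
qed

lemma rank_eq_iff_card_kern:
  assumes A: "(A :: 'a::{field,finite} mat) \<in> carrier_mat n n"
  shows "vec_space.rank n A = r \<longleftrightarrow> card (kern {..<n} (mat_fun n A)) * CARD('a) ^ r = CARD('a) ^ n"
proof
  assume h: "card (kern {..<n} (mat_fun n A)) * CARD('a) ^ r = CARD('a) ^ n"
  then have "card (kern {..<n} (mat_fun n A)) \<noteq> 0" by (metis mult_eq_0_iff power_not_zero zero_neq_one zero_less_card_finite less_irrefl)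
  then have "CARD('a) ^ vec_space.rank n A = CARD('a) ^ r"
    using h card_kern_rank[OF A] by (metis mult_left_cancel)
  then show "vec_space.rank n A = r"
    using card_field_ge_2[where 'a = 'a] by (simp add: power_inject_exp)
qed (use card_kern_rank[OF A] in auto)

subsection \<open>Classification of symmetric matrices up to congruence\<close>

lemma GL_obtain_inverse:
  assumes "g \<in> GL n"
  obtains h where "h \<in> GL n" "g * h = 1\<^sub>m n" "h * g = 1\<^sub>m n"
proof -
  from assms have g: "g \<in> carrier_mat n n" by (simp add: GL_def)
  from assms obtain h where h: "g * h = 1\<^sub>m n" "h * g = 1\<^sub>m (dim_row h)"
    using g by (auto simp: GL_def invertible_mat_def inverts_mat_def)
  have "dim_row h = n" "dim_col h = n"
    using arg_cong[OF h(1), of dim_col] arg_cong[OF h(2), of dim_col] g by auto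
  then have hc: "h \<in> carrier_mat n n" by auto
  then have "h \<in> GL n"
    using g h by (auto simp: GL_def invertible_mat_def inverts_mat_def)
  then show ?thesis using that h hc by auto
qed

lemma GL_I:
  assumes "g \<in> carrier_mat n n" "h \<in> carrier_mat n n" "g * h = 1\<^sub>m n" "h * g = 1\<^sub>m n"
  shows "g \<in> GL n"
  using assms by (auto simp: GL_def invertible_mat_def inverts_mat_def)

lemma GL_carrier: "g \<in> GL n \<Longrightarrow> g \<in> carrier_mat n n"
  by (simp add: GL_def)

lemma GL_one: "1\<^sub>m n \<in> GL n"
  by (rule GL_I[of _ _ "1\<^sub>m n"]) auto

lemma GL_mult:
  assumes "g \<in> GL n" "h \<in> GL n"
  shows "g * h \<in> GL n"
proof -
  obtain g' where g': "g' \<in> GL n" "g * g' = 1\<^sub>m n" "g' * g = 1\<^sub>m n" using GL_obtain_inverse[OF assms(1)] .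
  obtain h' where h': "h' \<in> GL n" "h * h' = 1\<^sub>m n" "h' * h = 1\<^sub>m n" using GL_obtain_inverse[OF assms(2)] .
  note c = assms[THEN GL_carrier] g'(1)[THEN GL_carrier] h'(1)[THEN GL_carrier]
  show ?thesis
  proof (rule GL_I[of _ _ "h' * g'"])
    have "(g * h) * (h' * g') = g * ((h * h') * g')" using c by (simp add: assoc_mult_mat[of _ n n _ n _ n])
    then show "(g * h) * (h' * g') = 1\<^sub>m n" using c g' h' by simp
    have "(h' * g') * (g * h) = h' * ((g' * g) * h)" using c by (simp add: assoc_mult_mat[of _ n n _ n _ n])
    then show "(h' * g') * (g * h) = 1\<^sub>m n" using c g' h' by simp
  qed (use c in auto)
qed

lemma GL_transpose:
  assumes "g \<in> GL n"
  shows "transpose_mat g \<in> GL n"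
proof -
  obtain g' where g': "g' \<in> GL n" "g * g' = 1\<^sub>m n" "g' * g = 1\<^sub>m n" using GL_obtain_inverse[OF assms(1)] .
  note c = assms[THEN GL_carrier] g'(1)[THEN GL_carrier]
  show ?thesis
  proof (rule GL_I[of _ _ "transpose_mat g'"])
    show "transpose_mat g * transpose_mat g' = 1\<^sub>m n"
      using c g' by (simp add: transpose_mult[symmetric, of _ n n _ n])
    show "transpose_mat g' * transpose_mat g = 1\<^sub>m n"
      using c g' by (simp add: transpose_mult[symmetric, of _ n n _ n])
  qed (use c in auto)
qed

lemma GL_of_trivial_kernel:
  fixes g :: "'a::field mat"
  assumes g: "g \<in> carrier_mat n n" and k: "\<And>v. v \<in> carrier_vec n \<Longrightarrow> g *\<^sub>v v = 0\<^sub>v n \<Longrightarrow> v = 0\<^sub>v n"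
  shows "g \<in> GL n"
proof -
  have "det g \<noteq> 0" using det_0_iff_vec_prod_zero_field[OF g] k by blast
  then have "g \<in> Units (ring_mat TYPE('a) n ())" by (rule det_non_zero_imp_unit[OF g])
  then show ?thesis
    unfolding Units_def ring_mat_def by (auto intro: GL_I[OF g])
qed

lemma congruence_orbit_refl:
  assumes "a \<in> carrier_mat n n"
  shows "a \<in> congruence_orbit n a"
  unfolding congruence_orbit_def by (rule image_eqI[OF _ GL_one]) (use assms in simp)

lemma congruence_assoc:
  assumes "a \<in> carrier_mat n n" "g \<in> carrier_mat n n" "h \<in> carrier_mat n n"
  shows "h * (g * a * transpose_mat g) * transpose_mat h = (h * g) * a * transpose_mat (h * (g :: 'a::field mat))"
  using assms by (simp add: transpose_mult[of _ n n _ n] assoc_mult_mat[of _ n n _ n _ n])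

lemma congruence_orbit_trans:
  assumes a: "a \<in> carrier_mat n n" and b: "b \<in> congruence_orbit n a" and c: "c \<in> congruence_orbit n b"
  shows "c \<in> congruence_orbit n a"
proof -
  obtain g where g: "g \<in> GL n" "b = g * a * transpose_mat g" using b by (auto simp: congruence_orbit_def)
  obtain h where h: "h \<in> GL n" "c = h * b * transpose_mat h" using c by (auto simp: congruence_orbit_def)
  have "c = (h * g) * a * transpose_mat (h * g)"
    unfolding h g using congruence_assoc[OF a] g h GL_carrier by blast
  then show ?thesis using GL_mult[OF h(1) g(1)] by (auto simp: congruence_orbit_def)
qed

lemma congruence_orbit_sym:
  assumes a: "a \<in> carrier_mat n n" and b: "b \<in> congruence_orbit n a"
  shows "a \<in> congruence_orbit n b"
proof -
  obtain g where g: "g \<in> GL n" "b = g * a * transpose_mat g" using b by (auto simp: congruence_orbit_def)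
  obtain g' where g': "g' \<in> GL n" "g' * g = 1\<^sub>m n" using GL_obtain_inverse[OF g(1)] by blast
  have "g' * b * transpose_mat g' = (g' * g) * a * transpose_mat (g' * g)"
    unfolding g(2) using congruence_assoc[OF a] g(1) g'(1) GL_carrier by blast
  also have "\<dots> = a" using a unfolding g'(2) by simp
  finally show ?thesis using g'(1) by (auto simp: congruence_orbit_def image_iff intro!: bexI[of _ g'])
qed

lemma congruence_carrier: "a \<in> carrier_mat n n \<Longrightarrow> b \<in> congruence_orbit n a \<Longrightarrow> b \<in> carrier_mat n n"
  by (auto simp: congruence_orbit_def GL_def)

lemma Sym_carrier: "a \<in> Sym n \<Longrightarrow> a \<in> carrier_mat n n"
  by (simp add: Sym_def)

lemma congruence_in_Sym:
  assumes "a \<in> Sym n" "g \<in> carrier_mat n n"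
  shows "g * a * transpose_mat g \<in> Sym n"
proof -
  have a: "a \<in> carrier_mat n n" "transpose_mat a = a" using assms(1) by (auto simp: Sym_def)
  have "transpose_mat (g * a * transpose_mat g) = g * (transpose_mat a * transpose_mat g)"
    using a(1) assms(2) by (subst transpose_mult[of _ n n _ n]) (auto simp: transpose_mult[of g n n a n])
  also have "\<dots> = g * a * transpose_mat g" using a assms(2) by simp
  finally show ?thesis using a(1) assms(2) by (simp add: Sym_def)
qed

lemma normal_form_Sym: "normal_form n r d \<in> Sym n"
  by (auto simp: Sym_def normal_form_def mat_diag_def)

section \<open>Splitting off a diagonal entry\<close>

definition blk :: "nat \<Rightarrow> 'a::field \<Rightarrow> 'a mat \<Rightarrow> 'a mat" where
  "blk n t a = four_block_mat (mat 1 1 (\<lambda>_. t)) (0\<^sub>m 1 n) (0\<^sub>m n 1) a"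

lemma blk_congruence:
  fixes t :: "'a::field"
  assumes a: "a \<in> carrier_mat n n" and b: "b \<in> congruence_orbit n a"
  shows "blk n t b \<in> congruence_orbit (Suc n) (blk n t a)"
proof -
  obtain g where g: "g \<in> GL n" "b = g * a * transpose_mat g" using b by (auto simp: congruence_orbit_def)
  obtain h where h: "h \<in> GL n" "g * h = 1\<^sub>m n" "h * g = 1\<^sub>m n" using GL_obtain_inverse[OF g(1)] .
  note gc = GL_carrier[OF g(1)] and hc = GL_carrier[OF h(1)]
  have mul: "blk n s x * blk n s' y = blk n (s * s') (x * y)" if "x \<in> carrier_mat n n" "y \<in> carrier_mat n n" for s s' :: 'a and x y
  proof -
    have 1: "mat 1 1 (\<lambda>_. s) * mat 1 1 (\<lambda>_. s') = mat 1 1 (\<lambda>_. s * s')"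
      by (rule eq_matI) (auto simp: scalar_prod_def)
    show ?thesis unfolding blk_def
      by (subst mult_four_block_mat[of _ 1 1 _ n _ n _ _ 1 _ n]) (use that in \<open>auto simp: 1[unfolded One_nat_def]\<close>)
  qed
  have tr: "transpose_mat (blk n s x) = blk n s (transpose_mat x)" if "x \<in> carrier_mat n n" for s :: 'a and x
  proof -
    have 1: "transpose_mat (mat 1 1 (\<lambda>_. s)) = mat 1 1 (\<lambda>_. s)" by (rule eq_matI) auto
    show ?thesis unfolding blk_def
      by (subst transpose_four_block_mat[of _ 1 1 _ n _ n]) (use that in \<open>auto simp: 1[unfolded One_nat_def]\<close>)
  qed
  have one: "blk n 1 (1\<^sub>m n) = 1\<^sub>m (Suc n)"
    unfolding blk_def by (rule eq_matI) auto
  have car: "blk n s x \<in> carrier_mat (Suc n) (Suc n)" if "x \<in> carrier_mat n n" for s :: 'a and x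
    unfolding blk_def using that by auto
  have G: "blk n 1 g \<in> GL (Suc n)"
    by (rule GL_I[of _ _ "blk n 1 h"]) (use gc hc h in \<open>simp_all add: car mul one\<close>)
  have "blk n t b = blk n 1 g * blk n t a * transpose_mat (blk n 1 g)"
    using gc a unfolding g(2) by (simp add: tr mul)
  then show ?thesis using G by (auto simp: congruence_orbit_def)
qed

text \<open>The vector is \<open>transpose_mat g *\<^sub>v v\<close>. In the classification this
  carries the value 1 from a split form back to the original one.\<close>

lemma quadratic_value_congruence:
  assumes a: "(a :: 'a::field mat) \<in> carrier_mat n n" and b: "b \<in> congruence_orbit n a"
    and v: "v \<in> carrier_vec n"
  shows "\<exists>w\<in>carrier_vec n. w \<bullet> (a *\<^sub>v w) = v \<bullet> (b *\<^sub>v v)"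
proof -
  obtain g where g: "g \<in> GL n" "b = g * a * transpose_mat g" using b by (auto simp: congruence_orbit_def)
  note gc = GL_carrier[OF g(1)]
  have "b *\<^sub>v v = g *\<^sub>v (a *\<^sub>v (transpose_mat g *\<^sub>v v))"
    unfolding g(2) using gc a v by (simp add: assoc_mult_mat_vec[of _ n n _ n])
  then have "v \<bullet> (b *\<^sub>v v) = (transpose_mat g *\<^sub>v v) \<bullet> (a *\<^sub>v (transpose_mat g *\<^sub>v v))"
    using transpose_vec_mult_scalar[OF gc, of "a *\<^sub>v (transpose_mat g *\<^sub>v v)" v] gc a v by simp
  then show ?thesis using gc v by (intro bexI[of _ "transpose_mat g *\<^sub>v v"]) auto
qed

lemma scalar_prod_sum: "v \<in> carrier_vec n \<Longrightarrow> w \<in> carrier_vec n \<Longrightarrow> v \<bullet> w = (\<Sum>k<n. v $ k * w $ k)"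
  by (auto simp: scalar_prod_def atLeast0LessThan)

text \<open>Split off an anisotropic vector \<open>v\<close>: the rows of the base change are \<open>v\<close> and the projections of
  all but one unit vectors to the orthogonal complement of \<open>v\<close>.\<close>

lemma split_off_vector:
  fixes a :: "'a::field mat"
  assumes a: "a \<in> Sym (Suc n)" and v: "v \<in> carrier_vec (Suc n)" and t: "v \<bullet> (a *\<^sub>v v) = t" "t \<noteq> 0"
  shows "\<exists>a'\<in>Sym n. blk n t a' \<in> congruence_orbit (Suc n) a"
proof -
  let ?N = "Suc n"
  have ac: "a \<in> carrier_mat ?N ?N" by (rule Sym_carrier[OF a])
  have "v \<noteq> 0\<^sub>v ?N" using t ac by auto
  then obtain p where p: "p < ?N" "v $ p \<noteq> 0" using v by (auto simp: vec_eq_iff)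
  \<comment> \<open>The indices from 1 to \<open>n\<close> are mapped bijectively to all indices
    except \<open>p\<close>. The unit vector at \<open>p\<close> is the one replaced by
    \<open>v\<close>, which keeps the rows of \<open>g\<close> independent as \<open>v $ p\<close>
    is non-zero.\<close>
  define \<sigma> where "\<sigma> i = (if i = p then 0 else i)" for i :: nat
  have \<sigma>: "i < ?N \<Longrightarrow> \<sigma> i < ?N" for i by (simp add: \<sigma>_def)
  define w where "w = a *\<^sub>v v"
  have w: "w \<in> carrier_vec ?N" using ac v by (simp add: w_def)
  \<comment> \<open>\<open>w $ \<sigma> i\<close> is the value of the bilinear form at the unit
    vector of index \<open>\<sigma> i\<close> and \<open>v\<close>. Subtracting
    \<open>w $ \<sigma> i / t\<close> times \<open>v\<close> makes the row orthogonal to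
    \<open>v\<close>.\<close>
  define g where "g = mat ?N ?N (\<lambda>(i, j). if i = 0 then v $ j else (if j = \<sigma> i then 1 else 0) - w $ \<sigma> i / t * v $ j)"
  have gc: "g \<in> carrier_mat ?N ?N" by (simp add: g_def)
  have gx: "(g *\<^sub>v x) $ i = (if i = 0 then v \<bullet> x else x $ \<sigma> i - w $ \<sigma> i / t * (v \<bullet> x))"
    if x: "x \<in> carrier_vec ?N" and i: "i < ?N" for x i
  proof -
    have "(g *\<^sub>v x) $ i = (\<Sum>j<?N. g $$ (i, j) * x $ j)"
      using gc x i by (simp add: mult_mat_vec_def scalar_prod_def atLeast0LessThan)
    also have "\<dots> = (if i = 0 then v \<bullet> x else x $ \<sigma> i - w $ \<sigma> i / t * (v \<bullet> x))"
    proof (cases "i = 0")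
      case True
      then show ?thesis unfolding scalar_prod_sum[OF v x] by (simp add: g_def)
    next
      case False
      have "(\<Sum>j<?N. g $$ (i, j) * x $ j) = (\<Sum>j<?N. (if j = \<sigma> i then x $ j else 0) - w $ \<sigma> i / t * (v $ j * x $ j))"
        using False i by (intro sum.cong) (auto simp: g_def left_diff_distrib)
      also have "\<dots> = x $ \<sigma> i - w $ \<sigma> i / t * (v \<bullet> x)"
        unfolding sum_subtractf sum_distrib_left[symmetric] scalar_prod_sum[OF v x] using \<sigma>[OF i] by simp
      finally show ?thesis using False by simp
    qed
    finally show ?thesis .
  qed
  have "g \<in> GL ?N"
  proof (rule GL_of_trivial_kernel[OF gc])
    fix x :: "'a vec" assume x: "x \<in> carrier_vec ?N" "g *\<^sub>v x = 0\<^sub>v ?N"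
    have vx: "v \<bullet> x = 0" using gx[OF x(1), of 0] x(2) by simp
    have s0: "x $ \<sigma> i = 0" if "i < ?N" "i \<noteq> 0" for i using gx[OF x(1) that(1)] x(2) vx that by simp
    have x0: "x $ k = 0" if k: "k < ?N" "k \<noteq> p" for k
    proof (cases "k = 0")
      case True
      then show ?thesis using s0[of p] k p by (simp add: \<sigma>_def)
    next
      case False
      then show ?thesis using s0[of k] k by (simp add: \<sigma>_def)
    qed
    have "v \<bullet> x = v $ p * x $ p"
      unfolding scalar_prod_sum[OF v x(1)] using p(1) x0 by (subst sum.remove[of _ p]) auto
    then have "x $ p = 0" using vx p(2) by simp
    then show "x = 0\<^sub>v ?N" using x0 x(1) by (intro eq_vecI) auto
  qed
  define c where "c = g * a * transpose_mat g"
  have c: "c \<in> Sym ?N" unfolding c_def by (rule congruence_in_Sym[OF a gc])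
  have cc: "c \<in> carrier_mat ?N ?N" by (rule Sym_carrier[OF c])
  have orb: "c \<in> congruence_orbit ?N a" using \<open>g \<in> GL ?N\<close> by (auto simp: c_def congruence_orbit_def)
  have r0: "row g 0 = v" using v by (auto simp: g_def row_def)
  have c0: "c $$ (i, 0) = (if i = 0 then t else 0)" if i: "i < ?N" for i
  proof -
    have "c $$ (i, 0) = (g * (a * transpose_mat g)) $$ (i, 0)"
      unfolding c_def using gc ac by (simp add: assoc_mult_mat[of _ ?N ?N _ ?N _ ?N])
    also have "\<dots> = row g i \<bullet> (a *\<^sub>v v)"
    proof -
      have "a *\<^sub>v v = vec ?N (\<lambda>i. row a i \<bullet> v)" using ac by (simp add: mult_mat_vec_def)
      then show ?thesis using gc ac i r0 by (simp add: col_mult2[of _ ?N ?N _ ?N])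
    qed
    also have "\<dots> = (g *\<^sub>v w) $ i" unfolding w_def using gc ac v i by simp
    also have "\<dots> = (if i = 0 then t else 0)"
      unfolding gx[OF w i] using t by (simp add: w_def)
    finally show ?thesis .
  qed
  have csym: "c $$ (i, j) = c $$ (j, i)" if "i < ?N" "j < ?N" for i j
  proof -
    have "c $$ (i, j) = transpose_mat c $$ (i, j)" using c by (simp add: Sym_def)
    also have "\<dots> = c $$ (j, i)" using cc that by simp
    finally show ?thesis .
  qed
  define a' where "a' = mat n n (\<lambda>(i, j). c $$ (Suc i, Suc j))"
  have a': "a' \<in> Sym n" unfolding Sym_def a'_def by (auto intro!: csym)
  have "c = blk n t a'"
  proof (rule eq_matI)
    fix i j assume "i < dim_row (blk n t a')" "j < dim_col (blk n t a')"
    then have ij: "i < ?N" "j < ?N" by (auto simp: blk_def a'_def)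
    show "c $$ (i, j) = blk n t a' $$ (i, j)"
      using ij c0[of i] c0[of j] csym[of 0 j] by (cases i; cases j) (auto simp: blk_def a'_def)
  qed (use cc in \<open>auto simp: blk_def a'_def\<close>)
  then show ?thesis using a' orb by auto
qed


text \<open>Polarization: if all values of the quadratic form vanish, so does
  \<open>2 * a $$ (i, j)\<close>.\<close>

lemma exists_anisotropic_vector:
  fixes a :: "'a::field mat"
  assumes two: "(2::'a) \<noteq> 0" and a: "a \<in> Sym n" "a \<noteq> 0\<^sub>m n n"
  shows "\<exists>v\<in>carrier_vec n. v \<bullet> (a *\<^sub>v v) \<noteq> 0"
proof (rule ccontr)
  assume "\<not> ?thesis"
  then have z: "v \<bullet> (a *\<^sub>v v) = 0" if "v \<in> carrier_vec n" for v using that by blast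
  have ac: "a \<in> carrier_mat n n" by (rule Sym_carrier[OF a(1)])
  have u: "unit_vec n i \<bullet> (a *\<^sub>v unit_vec n j) = a $$ (i, j)" if "i < n" "j < n" for i j
    using that ac by simp
  have sym: "a $$ (j, i) = a $$ (i, j)" if "i < n" "j < n" for i j
  proof -
    have "a $$ (j, i) = transpose_mat a $$ (i, j)" using ac that by simp
    then show ?thesis using a(1) by (simp add: Sym_def)
  qed
  have "a $$ (i, j) = 0" if ij: "i < n" "j < n" for i j
  proof -
    let ?x = "unit_vec n i :: 'a vec" and ?y = "unit_vec n j :: 'a vec"
    have "(?x + ?y) \<bullet> (a *\<^sub>v (?x + ?y)) = ?x \<bullet> (a *\<^sub>v ?x) + ?x \<bullet> (a *\<^sub>v ?y) + ?y \<bullet> (a *\<^sub>v ?x) + ?y \<bullet> (a *\<^sub>v ?y)"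
      using ac by (simp add: mult_add_distrib_mat_vec[of _ n n] scalar_prod_add_distrib[of _ n] add_scalar_prod_distrib[of _ n])
    then have "a $$ (i, j) + a $$ (j, i) = 0"
      using z[of "?x + ?y"] z[of ?x] z[of ?y] u ij by simp
    then have "2 * a $$ (i, j) = 0" using sym[OF ij] by simp
    then show ?thesis using two by simp
  qed
  then have "a = 0\<^sub>m n n" using ac by (intro eq_matI) auto
  then show False using a(2) by contradiction
qed

text \<open>Pigeonhole: \<open>d * x^2\<close> and \<open>1 - s * y^2\<close> each take
  \<open>(CARD('a) + 1) / 2\<close> values, so they have a common one.\<close>

lemma sum_of_two_squares_universal:
  fixes s d :: "'a::{field,finite}"
  assumes "odd CARD('a)" "s \<noteq> 0" "d \<noteq> 0"
  shows "\<exists>x y. d * x\<^sup>2 + s * y\<^sup>2 = 1"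
proof -
  let ?Q = "range (\<lambda>x::'a. x\<^sup>2)"
  have "?Q = insert 0 {x. x \<noteq> 0 \<and> (\<exists>y. x = y\<^sup>2)}" by (auto intro: image_eqI[of _ _ 0])
  then have "card ?Q = Suc (card {x::'a. x \<noteq> 0 \<and> (\<exists>y. x = y\<^sup>2)})" by simp
  then have Q: "2 * card ?Q = CARD('a) + 1"
    using card_nonzero_squares[OF assms(1)] card_field_ge_2[where 'a = 'a] by simp
  let ?A = "(\<lambda>z. d * z) ` ?Q" and ?B = "(\<lambda>z. 1 - s * z) ` ?Q"
  have cA: "card ?A = card ?Q" by (rule card_image) (use assms in \<open>auto simp: inj_on_def\<close>)
  have cB: "card ?B = card ?Q" by (rule card_image) (use assms in \<open>auto simp: inj_on_def\<close>)
  have "?A \<inter> ?B \<noteq> {}"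
  proof
    assume "?A \<inter> ?B = {}"
    then have "card (?A \<union> ?B) = card ?A + card ?B" by (intro card_Un_disjoint) auto
    moreover have "card (?A \<union> ?B) \<le> CARD('a)" by (rule card_mono) auto
    ultimately show False using Q cA cB by simp
  qed
  then obtain x y where "d * x\<^sup>2 = 1 - s * y\<^sup>2" by blast
  then have "d * x\<^sup>2 + s * y\<^sup>2 = 1" by simp
  then show ?thesis by blast
qed

lemma quadratic_value_blk:
  fixes a :: "'a::field mat"
  assumes a: "a \<in> carrier_mat n n" and v: "v \<in> carrier_vec n"
  shows "\<exists>w\<in>carrier_vec (Suc n). w \<bullet> (blk n d a *\<^sub>v w) = d * x\<^sup>2 + (v \<bullet> (a *\<^sub>v v)) * y\<^sup>2"
proof -
  let ?x = "vec 1 (\<lambda>_. x)"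
  let ?w = "?x @\<^sub>v (y \<cdot>\<^sub>v v)"
  have 1: "mat 1 1 (\<lambda>_. d) *\<^sub>v ?x = vec 1 (\<lambda>_. d * x)"
    by (rule eq_vecI) (auto simp: scalar_prod_def)
  have z: "0\<^sub>m 1 n *\<^sub>v (y \<cdot>\<^sub>v v) = 0\<^sub>v 1" "0\<^sub>m n 1 *\<^sub>v ?x = 0\<^sub>v n"
    using v by (auto intro!: eq_vecI)
  have "blk n d a *\<^sub>v ?w = (vec 1 (\<lambda>_. d * x) + 0\<^sub>v 1) @\<^sub>v (0\<^sub>v n + a *\<^sub>v (y \<cdot>\<^sub>v v))"
    unfolding blk_def by (subst four_block_mat_mult_vec[of _ 1 1 _ n _ n]) (use a v in \<open>auto simp only: 1 z, auto\<close>)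
  also have "\<dots> = vec 1 (\<lambda>_. d * x) @\<^sub>v (y \<cdot>\<^sub>v (a *\<^sub>v v))"
    using a v by (simp add: mult_mat_vec[of _ n n])
  finally have "?w \<bullet> (blk n d a *\<^sub>v ?w) = ?x \<bullet> vec 1 (\<lambda>_. d * x) + (y \<cdot>\<^sub>v v) \<bullet> (y \<cdot>\<^sub>v (a *\<^sub>v v))"
    using a v by (simp add: scalar_prod_append[of _ 1 _ n])
  also have "\<dots> = d * x\<^sup>2 + (v \<bullet> (a *\<^sub>v v)) * y\<^sup>2"
  proof -
    have "?x \<bullet> vec 1 (\<lambda>_. d * x) = d * x\<^sup>2" by (simp add: scalar_prod_def power2_eq_square mult_ac)
    then show ?thesis using a v by (simp add: power2_eq_square mult_ac)
  qed
  finally have eq: "?w \<bullet> (blk n d a *\<^sub>v ?w) = d * x\<^sup>2 + (v \<bullet> (a *\<^sub>v v)) * y\<^sup>2" .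
  have "?w \<in> carrier_vec (1 + n)" using v by (intro append_carrier_vec) auto
  then show ?thesis using eq by (intro bexI[of _ ?w]) auto
qed

lemma blk_normal_form:
  assumes "r \<ge> 1"
  shows "blk n 1 (normal_form n r d) = normal_form (Suc n) (Suc r) d"
proof (rule eq_matI)
  fix i j assume "i < dim_row (normal_form (Suc n) (Suc r) d)" "j < dim_col (normal_form (Suc n) (Suc r) d)"
  then have ij: "i < Suc n" "j < Suc n" by (auto simp: normal_form_def mat_diag_def)
  show "blk n 1 (normal_form n r d) $$ (i, j) = normal_form (Suc n) (Suc r) d $$ (i, j)"
    using ij assms by (cases i; cases j) (auto simp: blk_def normal_form_def mat_diag_def)
qed (auto simp: blk_def normal_form_def mat_diag_def)

lemma blk_zero: "blk n t (0\<^sub>m n n) = normal_form (Suc n) 1 t"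
proof (rule eq_matI)
  fix i j assume "i < dim_row (normal_form (Suc n) 1 t)" "j < dim_col (normal_form (Suc n) 1 t)"
  then have ij: "i < Suc n" "j < Suc n" by (auto simp: normal_form_def mat_diag_def)
  show "blk n t (0\<^sub>m n n) $$ (i, j) = normal_form (Suc n) 1 t $$ (i, j)"
    using ij by (cases i; cases j) (auto simp: blk_def normal_form_def mat_diag_def)
qed (auto simp: blk_def normal_form_def mat_diag_def)

lemma qchar_nonsquare:
  assumes "\<nexists>t. d = t\<^sup>2"
  shows "d \<noteq> 0" "qchar d = - 1"
  using assms by (auto simp: qchar_def)

lemma smult_quadratic_value:
  fixes a :: "'a::field mat"
  assumes "a \<in> carrier_mat n n" "v \<in> carrier_vec n"
  shows "(c \<cdot>\<^sub>v v) \<bullet> (a *\<^sub>v (c \<cdot>\<^sub>v v)) = (v \<bullet> (a *\<^sub>v v)) * c\<^sup>2"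
  using assms by (simp add: mult_mat_vec[of _ n n] power2_eq_square mult_ac)

text \<open>If the form takes the value 1, that value is split off and induction applies. Otherwise
  no non-zero value is a square and the form has rank one: a further non-zero value on the
  complement would produce 1 by \<open>sum_of_two_squares_universal\<close>.\<close>

theorem symmetric_matrix_classification:
  fixes a :: "'a::{field,finite} mat"
  assumes odd: "odd CARD('a)" and \<delta>: "\<nexists>t. \<delta> = t\<^sup>2"
    and "a \<in> Sym n" "a \<noteq> 0\<^sub>m n n"
  shows "\<exists>r\<in>{1..n}. \<exists>d\<in>{1, \<delta>}. a \<in> congruence_orbit n (normal_form n r d)"
  using assms(3,4)
proof (induction n arbitrary: a)
  case 0
  then have "a = 0\<^sub>m 0 0" by (intro eq_matI) (auto simp: Sym_def)
  then show ?case using 0 by simp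
next
  case (Suc n)
  have ac: "a \<in> carrier_mat (Suc n) (Suc n)" by (rule Sym_carrier) fact
  show ?case
  proof (cases "\<exists>v\<in>carrier_vec (Suc n). v \<bullet> (a *\<^sub>v v) = 1")
    case True
    then obtain v where v: "v \<in> carrier_vec (Suc n)" "v \<bullet> (a *\<^sub>v v) = 1" by blast
    obtain a' where a': "a' \<in> Sym n" "blk n 1 a' \<in> congruence_orbit (Suc n) a"
      using split_off_vector[OF Suc.prems(1) v] by auto
    have orb: "a \<in> congruence_orbit (Suc n) (blk n 1 a')" by (rule congruence_orbit_sym[OF ac a'(2)])
    show ?thesis
    proof (cases "a' = 0\<^sub>m n n")
      case True
      then show ?thesis using orb blk_zero[of n "1::'a"] by (intro bexI[of _ 1]) auto
    next
      case False
      then obtain r d where rd: "r \<in> {1..n}" "d \<in> {1, \<delta>}" "a' \<in> congruence_orbit n (normal_form n r d)"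
        using Suc.IH[OF a'(1)] by blast
      note nfc = Sym_carrier[OF normal_form_Sym, of n r d]
      have "blk n 1 a' \<in> congruence_orbit (Suc n) (normal_form (Suc n) (Suc r) d)"
        using blk_congruence[OF nfc rd(3), of 1] blk_normal_form[of r n d] rd(1) by simp
      then have "a \<in> congruence_orbit (Suc n) (normal_form (Suc n) (Suc r) d)"
        using congruence_orbit_trans[OF Sym_carrier[OF normal_form_Sym] _ orb] by blast
      then show ?thesis using rd by (intro bexI[of _ "Suc r"] bexI[of _ d]) auto
    qed
  next
    case no1: False
    obtain u where u: "u \<in> carrier_vec (Suc n)" "u \<bullet> (a *\<^sub>v u) \<noteq> 0"
      using exists_anisotropic_vector[OF two_neq_0_of_odd_card[OF odd] Suc.prems] by blast
    define t where "t = u \<bullet> (a *\<^sub>v u)"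
    have t0: "t \<noteq> 0" using u by (simp add: t_def)
    have nsq: "\<nexists>c. t = c\<^sup>2"
    proof
      assume "\<exists>c. t = c\<^sup>2"
      then obtain c where c: "t = c\<^sup>2" by blast
      have "(inverse c \<cdot>\<^sub>v u) \<bullet> (a *\<^sub>v (inverse c \<cdot>\<^sub>v u)) = 1"
        unfolding smult_quadratic_value[OF ac u(1)] t_def[symmetric] using c t0 by (simp add: power_inverse)
      then show False using no1 u(1) by (metis smult_carrier_vec)
    qed
    \<comment> \<open>The product of two non-squares is a square, so the value \<open>t\<close> can
      be rescaled to \<open>\<delta>\<close>.\<close>
    have "qchar (\<delta> * t) = 1"
      using qchar_nonsquare[OF nsq] qchar_nonsquare[OF \<delta>] by (simp add: qchar_mult[OF odd])
    then obtain c where c: "\<delta> * t = c\<^sup>2" by (auto simp: qchar_def split: if_splits)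
    have "t * (c / t)\<^sup>2 = \<delta>" using c t0 by (simp add: power2_eq_square field_simps)
    then obtain v where v: "v \<in> carrier_vec (Suc n)" "v \<bullet> (a *\<^sub>v v) = \<delta>"
      using smult_quadratic_value[OF ac u(1), of "c / t"] u(1) unfolding t_def[symmetric] by (metis smult_carrier_vec)
    have d0: "\<delta> \<noteq> 0" using qchar_nonsquare[OF \<delta>] by simp
    obtain a' where a': "a' \<in> Sym n" "blk n \<delta> a' \<in> congruence_orbit (Suc n) a"
      using split_off_vector[OF Suc.prems(1) v d0] by auto
    have a'c: "a' \<in> carrier_mat n n" by (rule Sym_carrier[OF a'(1)])
    have "a' = 0\<^sub>m n n"
    proof (rule ccontr)
      assume "a' \<noteq> 0\<^sub>m n n"
      then obtain w where w: "w \<in> carrier_vec n" "w \<bullet> (a' *\<^sub>v w) \<noteq> 0"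
        using exists_anisotropic_vector[OF two_neq_0_of_odd_card[OF odd] a'(1)] by blast
      obtain x y where "\<delta> * x\<^sup>2 + (w \<bullet> (a' *\<^sub>v w)) * y\<^sup>2 = 1"
        using sum_of_two_squares_universal[OF odd w(2) d0] by blast
      then obtain z where "z \<in> carrier_vec (Suc n)" "z \<bullet> (blk n \<delta> a' *\<^sub>v z) = 1"
        using quadratic_value_blk[OF a'c w(1), of \<delta> x y] by auto
      then show False using quadratic_value_congruence[OF ac a'(2)] no1 by metis
    qed
    then have "a \<in> congruence_orbit (Suc n) (normal_form (Suc n) 1 \<delta>)"
      using congruence_orbit_sym[OF ac a'(2)] blk_zero by metis
    then show ?thesis by (intro bexI[of _ 1] bexI[of _ \<delta>]) auto
  qed
qed


section \<open>Rank and sign as invariants of congruence\<close>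

lemma rank_congruence:
  fixes a :: "'a::{field,finite} mat"
  assumes a: "a \<in> carrier_mat n n" and b: "b \<in> congruence_orbit n a"
  shows "vec_space.rank n b = vec_space.rank n a"
proof -
  obtain g where g: "g \<in> GL n" "b = g * a * transpose_mat g" using b by (auto simp: congruence_orbit_def)
  obtain h where h: "h \<in> GL n" "g * h = 1\<^sub>m n" "h * g = 1\<^sub>m n" using GL_obtain_inverse[OF g(1)] .
  note gc = GL_carrier[OF g(1)] and hc = GL_carrier[OF h(1)]
  have bc: "b \<in> carrier_mat n n" by (rule congruence_carrier[OF a b])
  have bv: "b *\<^sub>v v = g *\<^sub>v (a *\<^sub>v (transpose_mat g *\<^sub>v v))" if "v \<in> carrier_vec n" for v
    unfolding g(2) using gc a that by (simp add: assoc_mult_mat_vec[of _ n n _ n])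
  have g0: "x = 0\<^sub>v n" if "x \<in> carrier_vec n" "g *\<^sub>v x = 0\<^sub>v n" for x
  proof -
    have "x = (h * g) *\<^sub>v x" using that(1) h(3) by simp
    also have "\<dots> = h *\<^sub>v (g *\<^sub>v x)" using gc hc that(1) by (simp add: assoc_mult_mat_vec[of _ n n _ n])
    finally show ?thesis using that(2) hc by auto
  qed
  have inv: "transpose_mat g * transpose_mat h = 1\<^sub>m n" "transpose_mat h * transpose_mat g = 1\<^sub>m n"
    using gc hc h by (simp_all add: transpose_mult[symmetric, of _ n n _ n])
  have inv': "transpose_mat g *\<^sub>v (transpose_mat h *\<^sub>v x) = x" "transpose_mat h *\<^sub>v (transpose_mat g *\<^sub>v x) = x"
    if "x \<in> carrier_vec n" for x
    using that gc hc by (simp_all add: assoc_mult_mat_vec[symmetric, of _ n n _ n] inv)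
  have tc: "transpose_mat g *\<^sub>v x \<in> carrier_vec n" "transpose_mat h *\<^sub>v x \<in> carrier_vec n" if "x \<in> carrier_vec n" for x
    using gc hc that by auto
  have "bij_betw (\<lambda>v. transpose_mat g *\<^sub>v v) {v \<in> carrier_vec n. b *\<^sub>v v = 0\<^sub>v n} {v \<in> carrier_vec n. a *\<^sub>v v = 0\<^sub>v n}"
  proof (rule bij_betw_byWitness[where f' = "\<lambda>v. transpose_mat h *\<^sub>v v"])
    show "(\<lambda>v. transpose_mat g *\<^sub>v v) ` {v \<in> carrier_vec n. b *\<^sub>v v = 0\<^sub>v n} \<subseteq> {v \<in> carrier_vec n. a *\<^sub>v v = 0\<^sub>v n}"
      using tc bv g0 a by auto
    show "(\<lambda>v. transpose_mat h *\<^sub>v v) ` {v \<in> carrier_vec n. a *\<^sub>v v = 0\<^sub>v n} \<subseteq> {v \<in> carrier_vec n. b *\<^sub>v v = 0\<^sub>v n}"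
      using tc bv inv' gc by auto
  qed (use inv' in auto)
  then have "card (kern {..<n} (mat_fun n b)) = card (kern {..<n} (mat_fun n a))"
    unfolding card_kernel_vec[OF a, symmetric] card_kernel_vec[OF bc, symmetric] by (rule bij_betw_same_card)
  then show ?thesis
    unfolding rank_eq_iff_card_kern[OF bc] using card_kern_rank[OF a] by simp
qed

lemma rank_normal_form:
  assumes "1 \<le> r" "r \<le> n" "d \<noteq> 0"
  shows "vec_space.rank n (normal_form n r (d :: 'a::{field,finite})) = r"
proof -
  let ?b = "mat_fun n (normal_form n r d)"
  have row: "(\<Sum>k<n. ?b i k * v k) = (if i < r then (if i + 1 = r then d else 1) * v i else 0)" if "i < n" for i v
  proof -
    have "(\<Sum>k<n. ?b i k * v k) = (\<Sum>k<n. if k = i then ?b i i * v i else 0)"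
      using that by (intro sum.cong) (auto simp: mat_fun_def normal_form_def mat_diag_def)
    also have "\<dots> = ?b i i * v i" using that by simp
    finally show ?thesis using that by (auto simp: mat_fun_def normal_form_def mat_diag_def)
  qed
  have "kern {..<n} ?b = vecs {r..<n}"
  proof (intro equalityI subsetI)
    fix v assume v: "v \<in> kern {..<n} ?b"
    have "v i = 0" if "i < r" for i
      using v row[of i v] that assms by (auto simp: kern_def split: if_splits)
    then show "v \<in> vecs {r..<n}" using v by (auto simp: kern_def vecs_def)
  next
    fix v :: "nat \<Rightarrow> 'a" assume v: "v \<in> vecs {r..<n}"
    then show "v \<in> kern {..<n} ?b" by (auto simp: kern_def vecs_def row)
  qed
  then have "card (kern {..<n} ?b) = CARD('a) ^ (n - r)" by (simp add: card_vecs)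
  then show ?thesis
    unfolding rank_eq_iff_card_kern[OF Sym_carrier[OF normal_form_Sym]] using assms by (simp add: power_add[symmetric])
qed

lemma rank_zero_mat: "vec_space.rank n (0\<^sub>m n n :: 'a::field mat) = 0"
proof -
  interpret vec_space "TYPE('a)" n .
  show ?thesis by (rule rank_0I)
qed

text \<open>The normal form vanishes outside the leading \<open>r\<close> by \<open>r\<close> block,
  so only that block \<open>B\<close> of \<open>g\<close> enters the leading block of the product.
  Comparing determinants there exhibits \<open>\<delta>\<close> as \<open>(det B)^2\<close>.\<close>

lemma normal_forms_not_congruent:
  assumes \<delta>: "\<nexists>t. \<delta> = (t::'a::{field,finite})\<^sup>2" and r: "r \<in> {1..n}" "r' \<in> {1..n}"
  shows "normal_form n r' \<delta> \<notin> congruence_orbit n (normal_form n r 1)"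
proof
  assume o: "normal_form n r' \<delta> \<in> congruence_orbit n (normal_form n r 1)"
  have d0: "\<delta> \<noteq> 0" using qchar_nonsquare[OF \<delta>] by simp
  have "r' = r"
    using rank_congruence[OF Sym_carrier[OF normal_form_Sym] o] rank_normal_form[of r' n \<delta>] rank_normal_form[of r n 1] r d0 by auto
  then obtain g where g: "g \<in> GL n" "normal_form n r \<delta> = g * normal_form n r 1 * transpose_mat g"
    using o by (auto simp: congruence_orbit_def)
  note gc = GL_carrier[OF g(1)]
  have rn: "r \<le> n" "1 \<le> r" using r by auto
  define B where "B = mat r r (\<lambda>(i, j). g $$ (i, j))"
  have Bc: "B \<in> carrier_mat r r" by (simp add: B_def)
  have "B * transpose_mat B = normal_form r r \<delta>"
  proof (rule eq_matI)
    fix i j assume "i < dim_row (normal_form r r \<delta>)" "j < dim_col (normal_form r r \<delta>)"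
    then have ij: "i < r" "j < r" by (auto simp: normal_form_def mat_diag_def)
    have D: "g * normal_form n r 1 = mat n n (\<lambda>(i, j). g $$ (i, j) * (if j < r then 1 else 0))"
      unfolding normal_form_def mat_diag_mult_right[OF gc] using rn by (intro eq_matI) auto
    have "normal_form r r \<delta> $$ (i, j) = normal_form n r \<delta> $$ (i, j)"
      using ij rn by (simp add: normal_form_def mat_diag_def)
    also have "\<dots> = (\<Sum>k<n. (g $$ (i, k) * (if k < r then 1 else 0)) * g $$ (j, k))"
      unfolding g(2) D using ij rn gc by (auto simp: scalar_prod_def atLeast0LessThan intro!: sum.cong)
    also have "\<dots> = (\<Sum>k<r. g $$ (i, k) * g $$ (j, k))"
      by (rule sum.mono_neutral_cong_right) (use rn in auto)
    also have "\<dots> = (B * transpose_mat B) $$ (i, j)"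
      using ij by (auto simp: B_def scalar_prod_def atLeast0LessThan intro!: sum.cong)
    finally show "(B * transpose_mat B) $$ (i, j) = normal_form r r \<delta> $$ (i, j)" ..
  qed (auto simp: B_def normal_form_def mat_diag_def)
  moreover have "det (B * transpose_mat B) = (det B)\<^sup>2"
    using Bc by (simp add: det_mult[of _ r] det_transpose[of _ r] power2_eq_square)
  moreover have "det (normal_form r r \<delta>) = \<delta>"
  proof -
    have c: "normal_form r r \<delta> \<in> carrier_mat r r" by (rule Sym_carrier[OF normal_form_Sym])
    have "upper_triangular (normal_form r r \<delta>)" by (auto simp: upper_triangular_def normal_form_def mat_diag_def)
    then have "det (normal_form r r \<delta>) = (\<Prod>i<r. normal_form r r \<delta> $$ (i, i))"
      using det_upper_triangular[OF _ c] c by (simp add: prod_list_diag_prod atLeast0LessThan)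
    also have "\<dots> = (\<Prod>i<r. if i = r - 1 then \<delta> else 1)"
      by (rule prod.cong) (auto simp: normal_form_def mat_diag_def)
    also have "\<dots> = \<delta>" using rn by simp
    finally show ?thesis .
  qed
  ultimately have "\<delta> = (det B)\<^sup>2" by simp
  then show False using \<delta> by blast
qed

lemma sgn_sym_square_class:
  assumes "r \<in> {1..n}" "a \<in> congruence_orbit n (normal_form n r 1)"
  shows "sgn_sym \<delta> n a = 1"
  using assms by (auto simp: sgn_sym_def)

text \<open>The earlier branches of \<open>sgn_sym\<close> have to be excluded: zero by the rank,
  the square classes of all ranks by \<open>normal_forms_not_congruent\<close>.\<close>

lemma sgn_sym_nonsquare_class:
  assumes \<delta>: "\<nexists>t. \<delta> = (t::'a::{field,finite})\<^sup>2" and r: "r \<in> {1..n}" "a \<in> congruence_orbit n (normal_form n r \<delta>)"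
  shows "sgn_sym \<delta> n a = - 1"
proof -
  have d0: "\<delta> \<noteq> 0" using qchar_nonsquare[OF \<delta>] by simp
  have "vec_space.rank n a = r"
    using rank_congruence[OF Sym_carrier[OF normal_form_Sym] r(2)] rank_normal_form[of r n \<delta>] r(1) d0 by auto
  then have "a \<noteq> 0\<^sub>m n n" using rank_zero_mat[of n, where 'a = 'a] r(1) by auto
  moreover have "a \<notin> congruence_orbit n (normal_form n r' 1)" if "r' \<in> {1..n}" for r'
  proof
    assume "a \<in> congruence_orbit n (normal_form n r' 1)"
    then have "normal_form n r \<delta> \<in> congruence_orbit n (normal_form n r' 1)"
      using congruence_orbit_trans[OF Sym_carrier[OF normal_form_Sym] _ congruence_orbit_sym[OF Sym_carrier[OF normal_form_Sym] r(2)]] by blast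
    then show False using normal_forms_not_congruent[OF \<delta> that r(1)] by contradiction
  qed
  ultimately show ?thesis using r by (auto simp: sgn_sym_def)
qed

subsection \<open>Fourier transforms on symmetric matrices\<close>

abbreviation tr :: "'a::field mat \<Rightarrow> 'a mat \<Rightarrow> 'a" where
  "tr a b \<equiv> mat_trace (transpose_mat a * b)"

lemma tr_eq:
  assumes "a \<in> carrier_mat n n" "b \<in> carrier_mat n n"
  shows "tr a b = (\<Sum>i<n. \<Sum>k<n. a $$ (k, i) * b $$ (k, i))"
  using assms by (auto simp: mat_trace_def scalar_prod_def atLeast0LessThan intro!: sum.cong)

lemma tr_commute:
  assumes "a \<in> carrier_mat n n" "b \<in> carrier_mat n n"
  shows "tr a b = tr b a"
  unfolding tr_eq[OF assms] tr_eq[OF assms(2,1)] by (simp add: mult.commute)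

lemma tr_add_right:
  assumes "a \<in> carrier_mat n n" "b \<in> carrier_mat n n" "c \<in> carrier_mat n n"
  shows "tr a (b + c) = tr a b + tr a c"
  unfolding tr_eq[OF assms(1) add_carrier_mat[OF assms(3)]] tr_eq[OF assms(1,2)] tr_eq[OF assms(1,3)]
  using assms by (simp add: distrib_left sum.distrib)

lemma tr_add_left:
  assumes "a \<in> carrier_mat n n" "b \<in> carrier_mat n n" "c \<in> carrier_mat n n"
  shows "tr (a + b) c = tr a c + tr b c"
  using tr_add_right[OF assms(3,1,2)] tr_commute[of _ n c] assms by simp

lemma tr_zero: "a \<in> carrier_mat n n \<Longrightarrow> tr a (0\<^sub>m n n) = 0"
  by (subst tr_eq[of _ n]) auto

lemma mat_trace_commute:
  assumes "(a :: 'a::field mat) \<in> carrier_mat n n" "b \<in> carrier_mat n n"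
  shows "mat_trace (a * b) = mat_trace (b * a)"
proof -
  have "mat_trace (a * b) = (\<Sum>i<n. \<Sum>k<n. a $$ (i, k) * b $$ (k, i))"
    using assms by (auto simp: mat_trace_def scalar_prod_def atLeast0LessThan intro!: sum.cong)
  also have "\<dots> = (\<Sum>k<n. \<Sum>i<n. b $$ (k, i) * a $$ (i, k))"
    by (subst sum.swap) (simp add: mult.commute)
  also have "\<dots> = mat_trace (b * a)"
    using assms by (auto simp: mat_trace_def scalar_prod_def atLeast0LessThan intro!: sum.cong)
  finally show ?thesis .
qed

text \<open>Cyclicity of the trace moves the group action to the other argument.\<close>

lemma tr_congruence:
  assumes a: "(a :: 'a::field mat) \<in> carrier_mat n n" and b: "b \<in> carrier_mat n n" and g: "g \<in> carrier_mat n n"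
  shows "tr (g * a * transpose_mat g) b = tr a (transpose_mat g * b * g)"
proof -
  have "transpose_mat (g * a * transpose_mat g) = g * (transpose_mat a * transpose_mat g)"
    using a g by (subst transpose_mult[of _ n n _ n]) (auto simp: transpose_mult[of g n n a n])
  then have "tr (g * a * transpose_mat g) b = mat_trace (g * (transpose_mat a * transpose_mat g * b))"
    using a b g by (simp add: assoc_mult_mat[of _ n n _ n _ n])
  also have "\<dots> = mat_trace ((transpose_mat a * transpose_mat g * b) * g)"
    by (rule mat_trace_commute[of _ n]) (use a b g in auto)
  also have "(transpose_mat a * transpose_mat g * b) * g = transpose_mat a * (transpose_mat g * b * g)"
    using a b g by (simp add: assoc_mult_mat[of _ n n _ n _ n])
  finally show ?thesis .
qed

lemma Sym_zero: "0\<^sub>m n n \<in> Sym n"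
  by (simp add: Sym_def)

lemma Sym_add: "a \<in> Sym n \<Longrightarrow> b \<in> Sym n \<Longrightarrow> a + b \<in> Sym n"
  by (auto simp: Sym_def transpose_add)

lemma Sym_minus: "a \<in> Sym n \<Longrightarrow> b \<in> Sym n \<Longrightarrow> a - b \<in> Sym n"
  by (auto simp: Sym_def transpose_minus)

lemma Sym_entry: "a \<in> Sym n \<Longrightarrow> i < n \<Longrightarrow> j < n \<Longrightarrow> a $$ (i, j) = a $$ (j, i)"
proof -
  assume a: "a \<in> Sym n" and ij: "i < n" "j < n"
  then have "a $$ (i, j) = transpose_mat a $$ (i, j)" by (simp add: Sym_def)
  then show "a $$ (i, j) = a $$ (j, i)" using Sym_carrier[OF a] ij by simp
qed

lemma bij_betw_mat_fun: "bij_betw (mat_fun n) (Sym n :: 'a::field mat set) (symfuns {..<n})"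
proof (rule bij_betw_byWitness[where f' = "\<lambda>b. mat n n (\<lambda>(i, j). b i j)"])
  show "\<forall>a\<in>(Sym n :: 'a mat set). mat n n (\<lambda>(i, j). mat_fun n a i j) = a"
    by (auto simp: mat_fun_def dest!: Sym_carrier intro!: eq_matI)
  show "\<forall>b\<in>(symfuns {..<n} :: (nat \<Rightarrow> nat \<Rightarrow> 'a) set). mat_fun n (mat n n (\<lambda>(i, j). b i j)) = b"
  proof
    fix b :: "nat \<Rightarrow> nat \<Rightarrow> 'a" assume b: "b \<in> symfuns {..<n}"
    have "b i j = 0" if "\<not> i < n \<or> \<not> j < n" for i j
    proof -
      have "b i j = b j i" using b by (auto simp: symfuns_def)
      then show ?thesis using that b by (auto simp: symfuns_def)
    qed
    then show "mat_fun n (mat n n (\<lambda>(i, j). b i j)) = b" by (auto simp: mat_fun_def fun_eq_iff)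
  qed
  show "mat_fun n ` (Sym n :: 'a mat set) \<subseteq> symfuns {..<n}"
    by (auto simp: symfuns_def mat_fun_def Sym_entry)
  show "(\<lambda>b. mat n n (\<lambda>(i, j). b i j)) ` (symfuns {..<n} :: (nat \<Rightarrow> nat \<Rightarrow> 'a) set) \<subseteq> Sym n"
    by (auto simp: symfuns_def Sym_def)
qed

lemma finite_Sym: "finite (Sym n :: 'a::{field,finite} mat set)"
  using bij_betw_finite[OF bij_betw_mat_fun[of n, where 'a = 'a]] finite_symfuns[of "{..<n}", where 'a = 'a] by simp

lemma exists_trace_eq:
  assumes two: "(2::'a::field) \<noteq> 0" and c: "c \<in> Sym n" "c \<noteq> 0\<^sub>m n n"
  shows "\<exists>b\<in>Sym n. tr b c = (s::'a)"
proof -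
  have cc: "c \<in> carrier_mat n n" by (rule Sym_carrier[OF c(1)])
  have "\<exists>i j. i < n \<and> j < n \<and> c $$ (i, j) \<noteq> 0"
  proof (rule ccontr)
    assume "\<not> ?thesis"
    then have "c $$ (i, j) = 0" if "i < n" "j < n" for i j using that by blast
    then have "c = 0\<^sub>m n n" using cc by (intro eq_matI) simp_all
    then show False using c(2) by contradiction
  qed
  then obtain i j where ij: "i < n" "j < n" "c $$ (i, j) \<noteq> 0" by blast
  \<comment> \<open>The matrix \<open>b\<close> gets \<open>t\<close> at \<open>(i, j)\<close> and
    at \<open>(j, i)\<close>, hence \<open>2 * t\<close> if these coincide. In both cases the trace
    is \<open>2 * t * c $$ (i, j)\<close>.\<close>
  define t where "t = s / (2 * c $$ (i, j))"
  define b where "b = mat n n (\<lambda>(k, l). (if k = i \<and> l = j then t else 0) + (if k = j \<and> l = i then t else 0))"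
  have bc: "b \<in> carrier_mat n n" unfolding b_def by (rule mat_carrier)
  have bkl: "b $$ (k, l) = (if k = i \<and> l = j then t else 0) + (if k = j \<and> l = i then t else 0)" if "k < n" "l < n" for k l
    unfolding b_def using that by simp
  have "transpose_mat b = b"
  proof (rule eq_matI)
    fix k l assume "k < dim_row b" "l < dim_col b"
    then have kl: "k < n" "l < n" using bc by auto
    have "transpose_mat b $$ (k, l) = b $$ (l, k)" using bc kl by simp
    also have "\<dots> = b $$ (k, l)" unfolding bkl[OF kl] bkl[OF kl(2,1)] by (simp add: add.commute conj_commute)
    finally show "transpose_mat b $$ (k, l) = b $$ (k, l)" .
  qed (use bc in auto)
  then have "b \<in> Sym n" using bc by (simp add: Sym_def)
  moreover have "tr b c = s"
  proof -
    have "tr b c = (\<Sum>l<n. \<Sum>k<n. (if k = i then if l = j then t * c $$ (i, j) else 0 else 0) + (if k = j then if l = i then t * c $$ (j, i) else 0 else 0))"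
      unfolding tr_eq[OF bc cc] by (intro sum.cong refl) (simp add: bkl distrib_right)
    also have "\<dots> = t * c $$ (i, j) + t * c $$ (j, i)"
      using ij by (simp add: sum.distrib)
    also have "\<dots> = s" using Sym_entry[OF c(1) ij(1,2)] ij(3) two by (simp add: t_def field_simps)
    finally show ?thesis .
  qed
  ultimately show ?thesis by blast
qed

section \<open>The character group of the symmetric matrices and the expansion coefficients\<close>

context odd_field_char
begin

lemma Sym_char_apply: "b \<in> Sym n \<Longrightarrow> Sym_char \<theta> n a b = \<theta> (tr a b)"
  by (simp add: Sym_char_def)

lemma inj_on_Sym_char: "inj_on (Sym_char \<theta> n) (Sym n)"
proof (rule inj_onI, rule ccontr)
  fix a a' assume a: "a \<in> Sym n" "a' \<in> Sym n" and eq: "Sym_char \<theta> n a = Sym_char \<theta> n a'" and ne: "a \<noteq> a'"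
  note c = Sym_carrier[OF a(1)] Sym_carrier[OF a(2)]
  obtain s where s: "\<theta> s \<noteq> 1" using nontriv by blast
  have d: "a - a' \<in> Sym n" by (rule Sym_minus[OF a])
  have aa: "a = a' + (a - a')" using c by (intro eq_matI) auto
  have "a - a' \<noteq> 0\<^sub>m n n" using aa ne c by (metis right_add_zero_mat)
  then obtain b where b: "b \<in> Sym n" "tr b (a - a') = s" using exists_trace_eq[OF two_neq_0 d] by blast
  note bc = Sym_carrier[OF b(1)] and dc = Sym_carrier[OF d]
  have "tr a b = tr a' b + tr (a - a') b"
    by (subst aa) (rule tr_add_left[OF c(2) dc bc])
  then have "\<theta> (tr a b) = \<theta> (tr a' b) * \<theta> s"
    using b(2) tr_commute[OF bc dc] by (simp add: theta_add)
  moreover have "\<theta> (tr a b) = \<theta> (tr a' b)"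
    using fun_cong[OF eq, of b] b(1) by (simp add: Sym_char_apply)
  ultimately show False using s theta_nz[of "tr a' b"] by simp
qed

lemma sum_Sym_theta_tr:
  assumes "b \<in> Sym n" "b \<noteq> 0\<^sub>m n n"
  shows "(\<Sum>a\<in>Sym n. \<theta> (- tr a b)) = 0"
proof -
  obtain s where s: "\<theta> s \<noteq> 1" using nontriv by blast
  obtain a0 where a0: "a0 \<in> Sym n" "tr a0 b = - s" using exists_trace_eq[OF two_neq_0 assms] by blast
  have "(\<Sum>a\<in>Sym n. \<theta> (- tr a b)) = (\<Sum>a\<in>Sym n. \<theta> (- tr (a + a0) b))"
  proof (rule sum.reindex_bij_witness[of _ "\<lambda>a. a + a0" "\<lambda>a. a - a0"])
    fix a :: "'a mat" assume a: "a \<in> Sym n"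
    show "a - a0 + a0 = a" "a + a0 - a0 = a"
      using Sym_carrier[OF a] Sym_carrier[OF a0(1)] by (auto intro!: eq_matI)
    then show "\<theta> (- tr (a - a0 + a0) b) = \<theta> (- tr a b)" by simp
  qed (use a0 in \<open>auto intro: Sym_add Sym_minus\<close>)
  also have "\<dots> = (\<Sum>a\<in>Sym n. \<theta> (- tr a b) * \<theta> s)"
    using a0 assms by (intro sum.cong refl) (simp add: tr_add_left[of _ n] Sym_carrier theta_add[symmetric])
  finally show ?thesis using s by (simp add: sum_distrib_right[symmetric])
qed

text \<open>For surjectivity, the sum of \<open>\<xi> b * \<theta> (- tr a b)\<close> over both
  \<open>a\<close> and \<open>b\<close> reduces to \<open>b = 0\<close> and equals the order of
  \<open>Sym n\<close>. So for some \<open>a\<close> the sum over \<open>b\<close> is non-zero, and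
  its behaviour under translation forces \<open>\<xi>\<close> to be the character of
  \<open>a\<close>.\<close>

lemma Sym_chars_eq: "Sym_chars n = Sym_char \<theta> n ` Sym n"
proof (intro equalityI subsetI)
  fix \<xi> assume "\<xi> \<in> Sym_char \<theta> n ` Sym n"
  then obtain a where a: "a \<in> Sym n" "\<xi> = Sym_char \<theta> n a" by blast
  have "additive_character_on (Sym n) \<xi>"
    unfolding additive_character_on_def a(2)
    using a(1) by (auto simp: Sym_char_apply theta_nz Sym_add tr_add_right[of _ n] Sym_carrier theta_add)
  then show "\<xi> \<in> Sym_chars n" unfolding Sym_chars_def a(2) by (auto simp: Sym_char_def)
next
  fix \<xi> :: "'a mat \<Rightarrow> complex" assume "\<xi> \<in> Sym_chars n"
  then have ext: "\<xi> \<in> extensional (Sym n)" and nz: "\<And>a. a \<in> Sym n \<Longrightarrow> \<xi> a \<noteq> 0"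
    and add: "\<And>a b. a \<in> Sym n \<Longrightarrow> b \<in> Sym n \<Longrightarrow> \<xi> (a + b) = \<xi> a * \<xi> b"
    by (auto simp: Sym_chars_def additive_character_on_def)
  have xi0: "\<xi> (0\<^sub>m n n) = 1"
    using add[OF Sym_zero Sym_zero] nz[OF Sym_zero] by simp
  have "(\<Sum>a\<in>Sym n. \<Sum>b\<in>Sym n. \<xi> b * \<theta> (- tr a b)) = (\<Sum>b\<in>Sym n. \<xi> b * (\<Sum>a\<in>Sym n. \<theta> (- tr a b)))"
    by (subst sum.swap) (simp add: sum_distrib_left)
  also have "\<dots> = (\<Sum>b\<in>(Sym n :: 'a mat set). if b = 0\<^sub>m n n then of_nat (card (Sym n :: 'a mat set)) else 0)"
  proof (rule sum.cong[OF refl])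
    fix b :: "'a mat" assume b: "b \<in> Sym n"
    show "\<xi> b * (\<Sum>a\<in>Sym n. \<theta> (- tr a b)) = (if b = 0\<^sub>m n n then of_nat (card (Sym n :: 'a mat set)) else 0)"
      using sum_Sym_theta_tr[OF b] xi0 by (simp add: tr_zero[OF Sym_carrier])
  qed
  also have "\<dots> = of_nat (card (Sym n :: 'a mat set))"
    by (simp add: sum.delta[OF finite_Sym] Sym_zero)
  also have "\<dots> \<noteq> 0" using Sym_zero[of n] finite_Sym[of n] by (auto simp: card_eq_0_iff)
  finally obtain a where a: "a \<in> Sym n" "(\<Sum>b\<in>Sym n. \<xi> b * \<theta> (- tr a b)) \<noteq> 0"
    by (rule sum.not_neutral_contains_not_neutral)
  have "\<xi> c = \<theta> (tr a c)" if c: "c \<in> Sym n" for c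
  proof -
    note ac = Sym_carrier[OF a(1)] and cc = Sym_carrier[OF c]
    have "(\<Sum>b\<in>Sym n. \<xi> b * \<theta> (- tr a b)) = (\<Sum>b\<in>Sym n. \<xi> (b + c) * \<theta> (- tr a (b + c)))"
    proof (rule sum.reindex_bij_witness[of _ "\<lambda>b. b + c" "\<lambda>b. b - c"])
      fix b :: "'a mat" assume b: "b \<in> Sym n"
      show "b - c + c = b" "b + c - c = b"
        using Sym_carrier[OF b] cc by (auto intro!: eq_matI)
      then show "\<xi> (b - c + c) * \<theta> (- tr a (b - c + c)) = \<xi> b * \<theta> (- tr a b)" by simp
    qed (use c in \<open>auto intro: Sym_add Sym_minus\<close>)
    also have "\<dots> = (\<xi> c * \<theta> (- tr a c)) * (\<Sum>b\<in>Sym n. \<xi> b * \<theta> (- tr a b))"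
      unfolding sum_distrib_left
    proof (rule sum.cong[OF refl])
      fix b :: "'a mat" assume b: "b \<in> Sym n"
      have "\<theta> (- tr a (b + c)) = \<theta> (- tr a b) * \<theta> (- tr a c)"
        unfolding tr_add_right[OF ac Sym_carrier[OF b] cc] by (simp add: theta_add[symmetric])
      then show "\<xi> (b + c) * \<theta> (- tr a (b + c)) = \<xi> c * \<theta> (- tr a c) * (\<xi> b * \<theta> (- tr a b))"
        by (simp add: add[OF b c])
    qed
    finally have "\<xi> c * \<theta> (- tr a c) = 1" using a(2) by simp
    then have "\<xi> c * (\<theta> (- tr a c) * \<theta> (tr a c)) = \<theta> (tr a c)" by simp
    then show ?thesis by (simp add: theta_add[symmetric])
  qed
  then have "\<xi> = Sym_char \<theta> n a"
    using ext by (intro extensionalityI[of _ "Sym n"]) (auto simp: Sym_char_def)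
  then show "\<xi> \<in> Sym_char \<theta> n ` Sym n" using a(1) by blast
qed

lemma on_chars_Sym_char: "a \<in> Sym n \<Longrightarrow> on_chars \<theta> n \<phi> (Sym_char \<theta> n a) = \<phi> a"
  unfolding on_chars_def by (simp add: the_inv_into_f_f[OF inj_on_Sym_char])

lemma sum_Sym_eq_rank_char_sum:
  "(\<Sum>b\<in>Sym n. \<theta> (tr (mat_diag n d) b) * chi n r b) = rank_char_sum {..<n} d (int r)"
proof -
  have "(\<Sum>b\<in>Sym n. \<theta> (tr (mat_diag n d) b) * chi n r b) =
    (\<Sum>b\<in>Sym n. \<theta> (\<Sum>i<n. d i * mat_fun n b i i) * (if of_nat (card (kern {..<n} (mat_fun n b))) * q powi int r = q ^ card {..<n} then 1 else 0))"
  proof (rule sum.cong[OF refl])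
    fix b :: "'a mat" assume b: "b \<in> Sym n"
    note bc = Sym_carrier[OF b]
    have "tr (mat_diag n d) b = (\<Sum>i<n. \<Sum>k<n. if k = i then d i * b $$ (i, i) else 0)"
      unfolding tr_eq[OF mat_diag_dim bc] by (intro sum.cong refl) (auto simp: mat_diag_def)
    also have "\<dots> = (\<Sum>i<n. d i * mat_fun n b i i)"
      by (simp add: mat_fun_def)
    finally have 1: "tr (mat_diag n d) b = (\<Sum>i<n. d i * mat_fun n b i i)" .
    have "of_nat (card (kern {..<n} (mat_fun n b))) * q powi int r = q ^ card {..<n} \<longleftrightarrow>
      (of_nat (card (kern {..<n} (mat_fun n b)) * CARD('a) ^ r) :: complex) = of_nat (CARD('a) ^ n)"
      by (simp add: q)
    also have "\<dots> \<longleftrightarrow> vec_space.rank n b = r"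
      unfolding of_nat_eq_iff rank_eq_iff_card_kern[OF bc] ..
    finally show "\<theta> (tr (mat_diag n d) b) * chi n r b = \<theta> (\<Sum>i<n. d i * mat_fun n b i i) * (if of_nat (card (kern {..<n} (mat_fun n b))) * q powi int r = q ^ card {..<n} then 1 else 0)"
      unfolding 1 chi_def by simp
  qed
  also have "\<dots> = rank_char_sum {..<n} d (int r)"
    unfolding rank_char_sum_def weighted_char_sum_def by (rule sum.reindex_bij_betw[OF bij_betw_mat_fun])
  finally show ?thesis .
qed

text \<open>The Fourier transformation conjugates characters, so the sums are evaluated at the
  conjugate of \<open>\<theta>\<close>. The right-hand side of \<open>rank_char_sum_diff\<close> is
  the same for every nontrivial character.\<close>

lemma odd_field_char_cnj: "odd_field_char (\<lambda>x. cnj (\<theta> x)) q"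
proof
  show "additive_character_on UNIV (\<lambda>x. cnj (\<theta> x))"
    by (auto simp: additive_character_on_def theta_add theta_nz)
  show "\<exists>t. cnj (\<theta> t) \<noteq> 1" using nontriv by (metis complex_cnj_cnj complex_cnj_one)
qed (use odd_card q in auto)

lemma fourier_chi: "fourier n (chi n r) (Sym_char \<theta> n a) = (\<Sum>b\<in>Sym n. cnj (\<theta> (tr a b)) * chi n r b)"
  unfolding fourier_def by (intro sum.cong refl) (simp add: Sym_char_apply)

text \<open>The substitution of \<open>transpose_mat g * c * g\<close> for \<open>c\<close>
  preserves the rank and carries one trace pairing to the other.\<close>

lemma fourier_chi_congruence:
  assumes a: "a \<in> Sym n" and b: "b \<in> congruence_orbit n a"
  shows "fourier n (chi n r) (Sym_char \<theta> n b) = fourier n (chi n r) (Sym_char \<theta> n a)"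
proof -
  obtain g where g: "g \<in> GL n" "b = g * a * transpose_mat g" using b by (auto simp: congruence_orbit_def)
  obtain h where h: "h \<in> GL n" "g * h = 1\<^sub>m n" "h * g = 1\<^sub>m n" using GL_obtain_inverse[OF g(1)] .
  note gc = GL_carrier[OF g(1)] and hc = GL_carrier[OF h(1)] and ac = Sym_carrier[OF a]
  have inv: "transpose_mat g * transpose_mat h = 1\<^sub>m n" "transpose_mat h * transpose_mat g = 1\<^sub>m n"
    using gc hc h by (simp_all add: transpose_mult[symmetric, of _ n n _ n])
  have conj_Sym: "transpose_mat k * c * k \<in> Sym n" if "c \<in> Sym n" "k \<in> carrier_mat n n" for c k :: "'a mat"
    using congruence_in_Sym[OF that(1), of "transpose_mat k"] that(2) by simp
  have i: "transpose_mat k * (transpose_mat k' * c * k') * k = c"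
    if "c \<in> carrier_mat n n" "k \<in> carrier_mat n n" "k' \<in> carrier_mat n n"
      "k' * k = 1\<^sub>m n" "transpose_mat k * transpose_mat k' = 1\<^sub>m n" for c k k' :: "'a mat"
  proof -
    have "transpose_mat k * (transpose_mat k' * c * k') * k = (transpose_mat k * transpose_mat k') * c * (k' * k)"
      using that(1-3) by (simp add: assoc_mult_mat[of _ n n _ n _ n])
    then show ?thesis using that by simp
  qed
  show ?thesis
    unfolding fourier_chi
  proof (rule sum.reindex_bij_witness[of _ "\<lambda>c. transpose_mat h * c * h" "\<lambda>c. transpose_mat g * c * g"])
    fix c :: "'a mat" assume c: "c \<in> Sym n"
    note cc = Sym_carrier[OF c]
    show "transpose_mat h * (transpose_mat g * c * g) * h = c" by (rule i[OF cc hc gc h(2) inv(2)])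
    show "transpose_mat g * (transpose_mat h * c * h) * g = c" by (rule i[OF cc gc hc h(3) inv(1)])
    show "transpose_mat g * c * g \<in> Sym n" by (rule conj_Sym[OF c gc])
    show "transpose_mat h * c * h \<in> Sym n" by (rule conj_Sym[OF c hc])
    have "transpose_mat g * c * g \<in> congruence_orbit n c"
      unfolding congruence_orbit_def using GL_transpose[OF g(1)] by (intro image_eqI[of _ _ "transpose_mat g"]) auto
    then have "chi n r (transpose_mat g * c * g) = chi n r c"
      using rank_congruence[OF cc] by (simp add: chi_def)
    then show "cnj (\<theta> (tr a (transpose_mat g * c * g))) * chi n r (transpose_mat g * c * g) = cnj (\<theta> (tr b c)) * chi n r c"
      unfolding g(2) tr_congruence[OF ac cc gc] by simp
  qed
qed

lemma sum_chi:
  fixes a :: "'a mat"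
  assumes "vec_space.rank n a \<le> n"
  shows "(\<Sum>s=0..n. c s * chi n s a) = c (vec_space.rank n a)"
    "(\<Sum>s=1..n. d s * sgn_chi \<delta> n s a) = (if vec_space.rank n a = 0 then 0 else d (vec_space.rank n a) * sgn_sym \<delta> n a)"
proof -
  have "(\<Sum>s=0..n. c s * chi n s a) = (\<Sum>s\<in>{0..n}. if s = vec_space.rank n a then c s else 0)"
    by (intro sum.cong refl) (auto simp: chi_def)
  then show "(\<Sum>s=0..n. c s * chi n s a) = c (vec_space.rank n a)" using assms by simp
  have "(\<Sum>s=1..n. d s * sgn_chi \<delta> n s a) = (\<Sum>s\<in>{1..n}. if s = vec_space.rank n a then d s * sgn_sym \<delta> n a else 0)"
    by (intro sum.cong refl) (auto simp: sgn_chi_def chi_def)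
  then show "(\<Sum>s=1..n. d s * sgn_chi \<delta> n s a) = (if vec_space.rank n a = 0 then 0 else d (vec_space.rank n a) * sgn_sym \<delta> n a)"
    using assms by (auto simp: not_less_eq_eq Suc_le_eq)
qed

lemma is_expansion_iff:
  "is_expansion \<theta> \<delta> n \<Phi> c d \<longleftrightarrow>
    (\<forall>s. s \<notin> {0..n} \<longrightarrow> c s = 0) \<and> (\<forall>s. s \<notin> {1..n} \<longrightarrow> d s = 0) \<and>
    (\<forall>a\<in>Sym n. \<Phi> (Sym_char \<theta> n a) = (\<Sum>s=0..n. c s * chi n s a) + (\<Sum>s=1..n. d s * sgn_chi \<delta> n s a))"
  unfolding is_expansion_def Sym_chars_eq by (simp add: on_chars_Sym_char)

text \<open>On the two orbits of rank \<open>s\<close> an expansion takes the values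
  \<open>c s + d s\<close> and \<open>c s - d s\<close>, so the signed coefficient is half their
  difference. As \<open>expansion\<close> is defined by \<open>THE\<close>, both existence and
  uniqueness have to be established.\<close>

lemma Psi3_eq:
  assumes \<delta>: "\<nexists>t. \<delta> = t\<^sup>2" and s: "1 \<le> s" "s \<le> n"
  shows "Psi3 \<theta> \<delta> n s r = (fourier n (chi n r) (Sym_char \<theta> n (normal_form n s 1)) -
    fourier n (chi n r) (Sym_char \<theta> n (normal_form n s \<delta>))) / 2"
proof -
  let ?F = "\<lambda>a. fourier n (chi n r) (Sym_char \<theta> n a)"
  define T where "T s d = ?F (normal_form n s d)" for s d
  \<comment> \<open>Rank 0 has a single orbit, so the coefficient at 0 is the value itself and
    \<open>d0\<close> vanishes there; beyond \<open>n\<close> both are 0 as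
    \<open>is_expansion\<close> demands.\<close>
  define c0 where "c0 s = (if s = 0 then ?F (0\<^sub>m n n) else if s \<le> n then (T s 1 + T s \<delta>) / 2 else 0)" for s
  define d0 where "d0 s = (if s = 0 then 0 else if s \<le> n then (T s 1 - T s \<delta>) / 2 else 0)" for s
  have \<delta>0: "\<delta> \<noteq> 0" using qchar_nonsquare[OF \<delta>] by simp
  have value_zero: "(\<Sum>s=0..n. c s * chi n s (0\<^sub>m n n :: 'a mat)) + (\<Sum>s=1..n. d s * sgn_chi \<delta> n s (0\<^sub>m n n)) = c 0" for c d
    using sum_chi[of n "0\<^sub>m n n"] by (simp add: rank_zero_mat)
  have value_orbit: "(\<Sum>s=0..n. c s * chi n s a) + (\<Sum>s=1..n. d s * sgn_chi \<delta> n s a) = c k + d k * (if e = 1 then 1 else - 1)"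
    if "k \<in> {1..n}" "e \<in> {1, \<delta>}" "a \<in> congruence_orbit n (normal_form n k e)" for c d a k e
  proof -
    have "vec_space.rank n a = k"
      using rank_congruence[OF Sym_carrier[OF normal_form_Sym] that(3)] rank_normal_form[of k n e] that(1,2) \<delta>0 by auto
    moreover have "sgn_sym \<delta> n a = (if e = 1 then 1 else - 1)"
      using sgn_sym_square_class[OF that(1)] sgn_sym_nonsquare_class[OF \<delta> that(1)] that(2,3) by auto
    ultimately show ?thesis using sum_chi[of n a] that(1) by auto
  qed
  have \<delta>1: "\<delta> \<noteq> 1" using \<delta> by (metis one_power2)
  have ex: "is_expansion \<theta> \<delta> n (fourier n (chi n r)) c0 d0"
    unfolding is_expansion_iff
  proof (intro conjI ballI)
    fix a :: "'a mat" assume a: "a \<in> Sym n"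
    show "?F a = (\<Sum>s=0..n. c0 s * chi n s a) + (\<Sum>s=1..n. d0 s * sgn_chi \<delta> n s a)"
    proof (cases "a = 0\<^sub>m n n")
      case True
      then show ?thesis by (simp only: value_zero) (simp add: c0_def)
    next
      case False
      then obtain k e where k: "k \<in> {1..n}" "e \<in> {1, \<delta>}" "a \<in> congruence_orbit n (normal_form n k e)"
        using symmetric_matrix_classification[OF odd_card \<delta> a] by blast
      have "?F a = T k e" unfolding T_def by (rule fourier_chi_congruence[OF normal_form_Sym k(3)])
      then show ?thesis using k(1,2) \<delta>1 unfolding value_orbit[OF k]
        by (auto simp: c0_def d0_def field_simps)
    qed
  qed (auto simp: c0_def d0_def)
  have "expansion \<theta> \<delta> n (fourier n (chi n r)) = (c0, d0)"
    unfolding expansion_def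
  proof (rule the_equality)
    show "case (c0, d0) of (c, d) \<Rightarrow> is_expansion \<theta> \<delta> n (fourier n (chi n r)) c d" using ex by simp
    fix x assume "case x of (c, d) \<Rightarrow> is_expansion \<theta> \<delta> n (fourier n (chi n r)) c d"
    then obtain c d where x: "x = (c, d)" and e: "is_expansion \<theta> \<delta> n (fourier n (chi n r)) c d" by (cases x) auto
    have E: "?F a = (\<Sum>s=0..n. c s * chi n s a) + (\<Sum>s=1..n. d s * sgn_chi \<delta> n s a)" if "a \<in> Sym n" for a
      using e that unfolding is_expansion_iff by blast
    have supp: "c s = 0" if "s > n" for s using e that unfolding is_expansion_iff by auto
    have supp': "d s = 0" if "s > n \<or> s = 0" for s using e that unfolding is_expansion_iff by auto
    have "c k = c0 k \<and> d k = d0 k" for k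
    proof -
      consider "k = 0" | "k > n" | "k \<in> {1..n}" by fastforce
      then show ?thesis
      proof cases
        case 1
        then show ?thesis using E[OF Sym_zero] unfolding value_zero by (simp add: c0_def d0_def supp')
      next
        case 2
        then show ?thesis by (simp add: c0_def d0_def supp supp')
      next
        case 3
        have o: "normal_form n k e \<in> congruence_orbit n (normal_form n k e)" for e :: 'a
          by (rule congruence_orbit_refl[OF Sym_carrier[OF normal_form_Sym]])
        have "T k 1 = c k + d k" "T k \<delta> = c k - d k"
          unfolding T_def using E[OF normal_form_Sym] value_orbit[OF 3 _ o] \<delta>1 by auto
        then show ?thesis using 3 by (simp add: c0_def d0_def)
      qed
    qed
    then show "x = (c0, d0)" unfolding x by auto
  qed
  then show ?thesis using s by (simp add: Psi3_def d0_def T_def)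
qed

end

theorem proposition6p4p5:
  fixes \<theta> :: "'a::{field,finite} \<Rightarrow> complex"
    and \<delta> :: 'a
    and q \<epsilon> :: complex
    and n s r N x y :: nat
  assumes "odd CARD('a)"
    and "additive_character_on UNIV \<theta>" and "\<exists>t. \<theta> t \<noteq> 1"
    and "\<nexists>t. \<delta> = t ^ 2"
    and "q = of_nat CARD('a)"
    and "\<epsilon> = (if CARD('a) mod 4 = 1 then 1 else - 1)"
    and "n \<ge> 2" and "even s" and "2 \<le> s" and "s \<le> n" and "1 \<le> r" and "r \<le> n"
    and "N = (n - 2) div 2" and "y = (s - 2) div 2" and "x = (r - 1) div 2"
  shows "Psi3 \<theta> \<delta> n s r =
    (- 1) ^ (r + x + 1) * \<epsilon> ^ (y + 1) * q powi (int n + (int x)\<^sup>2 + int x - int y - 1) *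
    qpoch (q powi (2 * int N - (- 1) ^ n)) (q powi (- 2)) x * qbinom (q\<^sup>2) N x *
    affine_qKrawtchouk y x (q powi (- 2 * int N + (- 1) ^ n)) N (q\<^sup>2)"
proof -
  interpret odd_field_char \<theta> q by unfold_locales (fact assms)+
  interpret C: odd_field_char "\<lambda>t. cnj (\<theta> t)" q by (rule odd_field_char_cnj)
  define d where "d e = (\<lambda>i. if i + 1 < s then 1 else if i + 1 = s then e else 0)" for e :: 'a
  have sy: "s = 2 * y + 2" using assms by auto
  \<comment> \<open>The two normal forms differ only at index \<open>s - 1\<close>, their last
    non-zero entry; without it \<open>2 * y + 1\<close> ones remain.\<close>
  define I where "I = {..<n} - {s - 1}"
  have I: "finite I" "s - 1 \<notin> I" "insert (s - 1) I = {..<n}" "card I = n - 1"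
    using assms by (auto simp: I_def)
  have F: "fourier n (chi n r) (Sym_char \<theta> n (normal_form n s e)) = C.rank_char_sum {..<n} (d e) (int r)" for e
    unfolding fourier_chi normal_form_def C.sum_Sym_eq_rank_char_sum[symmetric] d_def ..
  have nz: "card {i\<in>I. d 1 i \<noteq> 0} = 2 * y + 1"
  proof -
    have "{i\<in>I. d 1 i \<noteq> 0} = {..<s - 1}" using assms by (auto simp: I_def d_def)
    then show ?thesis by (simp add: sy)
  qed
  have "C.rank_char_sum (insert (s - 1) I) (d 1) (int r) - C.rank_char_sum (insert (s - 1) I) (d \<delta>) (int r) =
    2 * q ^ (card I + 1 - (2 * y + 1) - 1) * (qchar (- 1 :: 'a) * q) ^ (y + 1) * odd_rank_sum q (card I) y (int r - 1)"
    by (rule C.rank_char_sum_diff[OF I(1,2) _ _ _ _ nz]) (use sy qchar_nonsquare[OF assms(4)] in \<open>auto simp: d_def I_def\<close>)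
  then have "Psi3 \<theta> \<delta> n s r = q ^ (card I + 1 - (2 * y + 1) - 1) * (qchar (- 1 :: 'a) * q) ^ (y + 1) * odd_rank_sum q (card I) y (int r - 1)"
    using Psi3_eq[OF assms(4), of s n r] assms(9,10) unfolding F I(3) by simp
  also have "qchar (- 1 :: 'a) = \<epsilon>"
    unfolding assms(6) by (rule qchar_minus_one[OF assms(1)])
  also have "card I + 1 - (2 * y + 1) - 1 = n - s" using I(4) assms(7) sy by simp
  also have "odd_rank_sum q (card I) y (int r - 1) = (- 1) ^ (r + x + 1) * q ^ (x\<^sup>2 + x) *
    qpoch (q powi (2 * int N - (- 1) ^ n)) (q powi (- 2)) x * qbinom (q\<^sup>2) N x *
    affine_qKrawtchouk y x (q powi (- 2 * int N + (- 1) ^ n)) N (q\<^sup>2)"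
  proof -
    \<comment> \<open>Size \<open>n - 1\<close> turns the half in \<open>odd_rank_sum\<close> into
      \<open>N\<close>, and its sign \<open>(- 1) ^ (n - 1)\<close> into the
      \<open>- ((- 1) ^ n)\<close> of the claim.\<close>
    have "card I - 1 = n - 2" using I(4) by simp
    then have N: "(card I - 1) div 2 = N" by (simp only: assms(13))
    obtain m where n: "n = Suc m" using assms(7) by (cases n) auto
    have e: "qexp (card I) = 2 * int N - (- 1) ^ n"
      unfolding qexp_def N unfolding I(4) n by simp
    have i: "inverse (q powi (2 * int N - (- 1) ^ n)) = q powi (- 2 * int N + (- 1) ^ n)"
      by (simp add: power_int_minus[symmetric])
    have i2: "inverse (q\<^sup>2) = q powi (- 2)" by (simp add: power_int_minus)
    have r: "nat (int r - 1) = r - 1" by simp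
    obtain R where R: "r = Suc R" using assms(11) by (cases r) auto
    have sg: "(- 1 :: complex) ^ (r - 1 + x) = (- 1) ^ (r + x + 1)" by (simp add: R)
    have "\<not> int r - 1 < 0" using assms(11) by simp
    then show ?thesis
      unfolding odd_rank_sum_def Let_def r assms(15)[symmetric] N e i i2 sg by (simp only: if_False)
  qed
  also have "q ^ (n - s) * (\<epsilon> * q) ^ (y + 1) * ((- 1) ^ (r + x + 1) * q ^ (x\<^sup>2 + x) *
    qpoch (q powi (2 * int N - (- 1) ^ n)) (q powi (- 2)) x * qbinom (q\<^sup>2) N x *
    affine_qKrawtchouk y x (q powi (- 2 * int N + (- 1) ^ n)) N (q\<^sup>2)) =
    (- 1) ^ (r + x + 1) * \<epsilon> ^ (y + 1) * (q ^ (n - s) * q ^ (y + 1) * q ^ (x\<^sup>2 + x)) *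
    qpoch (q powi (2 * int N - (- 1) ^ n)) (q powi (- 2)) x * qbinom (q\<^sup>2) N x *
    affine_qKrawtchouk y x (q powi (- 2 * int N + (- 1) ^ n)) N (q\<^sup>2)"
    unfolding power_mult_distrib by (simp only: mult_ac)
  \<comment> \<open>The three powers come from the zero diagonal entries, the Gauss sums and the
    closed form; \<open>n - s + y + 1 = n - y - 1\<close> since
    \<open>s = 2 * y + 2\<close>.\<close>
  also have "q ^ (n - s) * q ^ (y + 1) * q ^ (x\<^sup>2 + x) = q powi (int n + (int x)\<^sup>2 + int x - int y - 1)"
  proof -
    have "int n + (int x)\<^sup>2 + int x - int y - 1 = int (n - s + (y + 1) + (x\<^sup>2 + x))"
      using assms(10) sy by (simp add: of_nat_diff)
    then show ?thesis by (simp only: power_int_of_nat power_add)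
  qed
  finally show ?thesis .
qed

end
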